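(* The spectral parameters of the $D_4$ lattice with reflection planes $\mathscr{F}_{D4}$ and open boundary condition are (each occurrence of $\vartheta$ denotes a possibly different real number with $|\vartheta|\le 1$) \begin{align*} \gamma_{D4,0} &= 0.075554+\vartheta\, 0.00024,\\ \gamma_{D4,1} &= 0.0440957+\vartheta\, 0.00017,\\ \gamma_{D4,2} &= 0.0389569+\vartheta\, 0.00013,\\ \gamma_{D4,3} &= 0.036873324+\vartheta\, 0.00012,\\ \gamma_{D4,4} &= 0.0357604+\vartheta\, 0.00011. \end{align*} The spectral factors are given by \begin{align*} \Gamma_{D4,0} &= 52.9428+\vartheta\, 0.17,\\ \Gamma_{D4,1} &= 68.03486+\vartheta\, 0.27,\\ \Gamma_{D4,2} &= 51.3393+\vartheta\, 0.17,\\ \Gamma_{D4,3} &= 27.1201+\vartheta\, 0.084. \end{align*} In particular, the total variation mixing time of the sandpile dynamics on the $D_4$ lattice (with open boundary) is dominated by the three dimensional boundary behavior, i.e. $\Gamma=\max_{0\le j\le 3}\Gamma_{D4,j}$ is equal to $\Gamma_{D4,1}$ and not to $\Gamma_{D4,0}$.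
   Context: The $D_4$ lattice graph $\mathscr{T}$ has vertex set $\mathbb{Z}^4\cup\big(\mathbb{Z}^4+(\frac12,\frac12,\frac12,\frac12)\big)$, and two vertices are adjacent iff their difference lies in \[U_4=\{\pm e_1,\pm e_2,\pm e_3,\pm e_4\}\cup\{\tfrac12(\epsilon_1,\epsilon_2,\epsilon_3,\epsilon_4):\epsilon_i\in\{\pm1\}\}\] (24-regular). The graph Laplacian is $\Delta f(v)=\deg(v)f(v)-\sum_{(v,w)\in E}f(w)$. A real-valued $\xi\in\ell^2(\mathscr{T})$ is harmonic modulo 1 if $\Delta\xi$ is integer valued. Let $v_1=(1,1,0,0)$, $v_2=(1,-1,0,0)$, $v_3=(0,0,1,1)$, $v_4=(0,0,1,-1)$ and $\mathscr{P}_j=\{x\in\mathbb{R}^4:\langle x,v_j\rangle=0\}$. The lattice graph has reflection symmetry in the family of hyperplanes $\mathscr{F}_{D4}=\{nv_j+\mathscr{P}_j:j\in\{1,2,3,4\},n\in\mathbb{Z}\}$. For $S\subset\{1,2,3,4\}$ let $\mathfrak{S}_S$ be the group generated by the orthogonal reflections in the hyperplanes $\mathscr{P}_j$, $j\in S$, and let $\mathscr{H}^2_S(\mathscr{T})$ be the set of $\xi\in\ell^2(\mathscr{T})$ that are harmonic modulo 1 and anti-symmetric under reflection in each $\mathscr{P}_j$, $j\in S$ ($\xi$ changes sign under the reflection). For $0\le i\le 4$ the spectral parameters are \[ \gamma_{D4,i}=\inf_{S\subset\{1,2,3,4\},\,|S|=i}\ \ \inf_{\xi\in\mathscr{H}^2_S(\mathscr{T}),\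 \xi\not\equiv0\bmod 1}\ \ \sum_{x\in\mathscr{T}/\mathfrak{S}_S}\big(1-\cos(2\pi\xi_x)\big), \] the sum being over $\mathfrak{S}_S$-orbits of vertices (the summand is constant on orbits), and $\xi\equiv0\bmod1$ meaning $\xi$ is integer valued. For $0\le j\le 3$ the $j$th spectral factor is $\Gamma_{D4,j}=\frac{4-j}{\gamma_{D4,j}}$ and $\Gamma=\max_j\Gamma_{D4,j}$. Terminology: the asymptotic total variation mixing time of the sandpile dynamics with open boundary is governed by $\Gamma$. If $\Gamma=\Gamma_{D4,0}$ one says the bulk (top dimensional) behavior controls the mixing time, and otherwise that the boundary behavior controls it; the index $j$ corresponds to boundary of dimension $4-j$, so "dominated by the three dimensional boundary behavior" means that the maximum is attained at $j=1$ and not at $j=0$. *)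

theory Defs
  imports "HOL-Analysis.Analysis"
begin

definition D4_vertices :: "(real^4) set" where
  "D4_vertices = {x. (\<forall>i. x $ i \<in> \<int>) \<or> (\<forall>i. x $ i - 1/2 \<in> \<int>)}"

definition U4 :: "(real^4) set" where
  "U4 = (\<Union>i. {axis i 1, - axis i 1}) \<union> {x. \<forall>i. x $ i = 1/2 \<or> x $ i = - 1/2}"

definition D4_adj :: "real^4 \<Rightarrow> real^4 \<Rightarrow> bool" where
  "D4_adj v w \<longleftrightarrow> v \<in> D4_vertices \<and> w \<in> D4_vertices \<and> w - v \<in> U4"

text \<open>
  Functions on the lattice graph are represented by functions on the ambient space whose values
  off the vertex set are irrelevant: every notion below only inspects them at vertices.
\<close>

definition D4_laplacian :: "(real^4 \<Rightarrow> real) \<Rightarrow> real^4 \<Rightarrow> real" where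
  "D4_laplacian f v = real (card {w. D4_adj v w}) * f v - (\<Sum>w\<in>{w. D4_adj v w}. f w)"

definition D4_l2 :: "(real^4 \<Rightarrow> real) set" where
  "D4_l2 = {\<xi>. (\<lambda>x. (\<xi> x)\<^sup>2) summable_on D4_vertices}"

definition harmonic_mod1 :: "(real^4 \<Rightarrow> real) \<Rightarrow> bool" where
  "harmonic_mod1 \<xi> \<longleftrightarrow> (\<forall>v\<in>D4_vertices. D4_laplacian \<xi> v \<in> \<int>)"

definition zero_mod1 :: "(real^4 \<Rightarrow> real) \<Rightarrow> bool" where
  "zero_mod1 \<xi> \<longleftrightarrow> (\<forall>x\<in>D4_vertices. \<xi> x \<in> \<int>)"

text \<open>Only the indices 1, 2, 3, 4 are meaningful.\<close>

definition normal_vec :: "nat \<Rightarrow> real^4" where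
  "normal_vec j =
     (if j = 1 then vector [1, 1, 0, 0]
      else if j = 2 then vector [1, - 1, 0, 0]
      else if j = 3 then vector [0, 0, 1, 1]
      else vector [0, 0, 1, - 1])"

definition reflection :: "nat \<Rightarrow> real^4 \<Rightarrow> real^4" where
  "reflection j x =
     x - (2 * (x \<bullet> normal_vec j) / (normal_vec j \<bullet> normal_vec j)) *\<^sub>R normal_vec j"

text \<open>
  Reflections are involutions, so closing the identity under composition with them already
  yields a group.
\<close>

inductive_set reflection_group :: "nat set \<Rightarrow> (real^4 \<Rightarrow> real^4) set" for S :: "nat set" where
  one: "id \<in> reflection_group S"
| mult: "\<lbrakk>j \<in> S; g \<in> reflection_group S\<rbrakk> \<Longrightarrow> reflection j \<circ> g \<in> reflection_group S"

definition D4_orbits :: "nat set \<Rightarrow> (real^4) set set" where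
  "D4_orbits S = (\<lambda>x. (\<lambda>g. g x) ` reflection_group S) ` D4_vertices"

definition H2 :: "nat set \<Rightarrow> (real^4 \<Rightarrow> real) set" where
  "H2 S = {\<xi>. \<xi> \<in> D4_l2 \<and> harmonic_mod1 \<xi> \<and>
              (\<forall>j\<in>S. \<forall>x\<in>D4_vertices. \<xi> (reflection j x) = - \<xi> x)}"

text \<open>
  For \<open>\<xi>\<close> in \<open>H2 S\<close> the summand is constant on each orbit, so its image of the orbit is a
  singleton.  The infinite sum converges, since \<open>0 \<le> 1 - cos (2 * pi * t) \<le> 2 * pi\<^sup>2 * t\<^sup>2\<close>.
\<close>

definition orbit_functional :: "nat set \<Rightarrow> (real^4 \<Rightarrow> real) \<Rightarrow> real" where
  "orbit_functional S \<xi> =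
     (\<Sum>\<^sub>\<infinity>orb\<in>D4_orbits S. the_elem ((\<lambda>x. 1 - cos (2 * pi * \<xi> x)) ` orb))"

text \<open>
  For \<open>i \<le> 4\<close> both infima are taken over nonempty sets of nonnegative reals, so the real-valued
  infimum is the true one.
\<close>

definition spectral_parameter :: "nat \<Rightarrow> real" where
  "spectral_parameter i =
     (INF S\<in>{S. S \<subseteq> {1..4} \<and> card S = i}.
        INF \<xi>\<in>{\<xi>\<in>H2 S. \<not> zero_mod1 \<xi>}. orbit_functional S \<xi>)"

definition spectral_factor :: "nat \<Rightarrow> real" where
  "spectral_factor j = (4 - real j) / spectral_parameter j"

definition max_spectral_factor :: real where
  "max_spectral_factor = (MAX j\<in>{0..3}. spectral_factor j)"

end

theory Submission
  imports Defs
begin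

text \<open>
  The pairings of a vertex with the four normal vectors turn the lattice graph into the even points
  of \<open>\<int>\<^sup>4\<close> with the 24 roots of norm two as steps, and the reflections into sign changes of the
  coordinates. Up to signs and translations, the minimisers are the difference of the Green function
  at two adjacent poles (no reflections) and the Green function of a chamber with a pole next to its
  corner (at least one reflection). Indeed, a near-minimiser reduced modulo one is small in norm, and
  testing it against the Laplacians of point masses leaves no room for more than one node in the
  chamber (a node is a point of nonzero Laplacian; without reflections, two nodes of opposite sign);
  the maximum principle then compares it with the Green function of the extremal pole.

  The functional is \<open>2 * pi\<^sup>2\<close> times the squared norm up to a quartic correction carried by the pole.
  The squared norm is the sum of \<open>(n + 1) * r n / 576\<close> where \<open>r n\<close> is the return probability of the
  killed walk. By reflection it is a combination of \<open>\<Sum>n. (n + 1) * p n x\<close>, differences of which are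
  expressed by exchangeability of the steps through a few values of the Green function. These are
  enclosed by tabulated super- and subsolutions. In the smallest two chambers, tabulated
  subsolutions of the squared problem bound the norm from below, and the value for the fourth chamber
  is bounded from above through a symmetrised source in the third.\<close>

section \<open>The even lattice and square summable functions\<close>

text \<open>The exponent is critical: in dimension four \<open>G\<close> decays like one over the
  squared distance, which just fails to be square summable. Hence a single pole is impossible
  without reflections, and the sums of \<open>(n + 1) * p n x\<close> diverge logarithmically. Only
  combinations with coefficients of total zero converge, and these are what reflections produce.
  Their limits come from linear equations valid up to each finite time \<open>N\<close>, one kind
  from the Laplacian and one from exchangeability; eliminating the weighted sums leaves values of
  \<open>G\<close> and a remainder of size \<open>N * p N\<close>, which tends to zero along a
  subsequence because \<open>p\<close> is summable.

  The claimed tolerance is about 0.3 percent, and this decides the method chamber by chamber: the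
  elimination magnifies the errors of the tables, mildly for one and two reflections but about
  eightfold for three, where it serves as an upper bound only. Norms are compared with node counts
  through the Gram matrix of the functions \<open>lap (pt_mass a)\<close>; the resulting constants
  just suffice, three nodes in the bulk needing 9 against 8.3.\<close>

type_synonym pt = "int \<times> int \<times> int \<times> int"

definition roots :: "pt set" where
  "roots = {(a, b, c, d). a\<^sup>2 + b\<^sup>2 + c\<^sup>2 + d\<^sup>2 = 2}"

definition root_list :: "pt list" where
  "root_list =
    [(1,1,0,0), (1,-1,0,0), (-1,1,0,0), (-1,-1,0,0), (1,0,1,0), (1,0,-1,0), (-1,0,1,0), (-1,0,-1,0),
     (1,0,0,1), (1,0,0,-1), (-1,0,0,1), (-1,0,0,-1), (0,1,1,0), (0,1,-1,0), (0,-1,1,0), (0,-1,-1,0),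
     (0,1,0,1), (0,1,0,-1), (0,-1,0,1), (0,-1,0,-1), (0,0,1,1), (0,0,1,-1), (0,0,-1,1), (0,0,-1,-1)]"

lemma sq_le_2_int:
  assumes "(a::int)\<^sup>2 \<le> 2" shows "a \<in> {-1, 0, 1}"
proof (rule ccontr)
  assume "a \<notin> {-1, 0, 1}"
  then have "2 \<le> \<bar>a\<bar>" by auto
  then have "2\<^sup>2 \<le> \<bar>a\<bar>\<^sup>2" by (rule power_mono) simp
  then show False using assms by simp
qed

lemma roots_eq: "roots = set root_list"
proof
  show "set root_list \<subseteq> roots"
    by (simp add: root_list_def roots_def)
  show "roots \<subseteq> set root_list"
  proof
    fix x assume "x \<in> roots"
    then obtain a b c d where x: "x = (a, b, c, d)" and s: "a\<^sup>2 + b\<^sup>2 + c\<^sup>2 + d\<^sup>2 = 2"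
      by (auto simp: roots_def)
    have "a \<in> {-1,0,1}" "b \<in> {-1,0,1}" "c \<in> {-1,0,1}" "d \<in> {-1,0,1}"
      using s zero_le_power2[of a] zero_le_power2[of b] zero_le_power2[of c] zero_le_power2[of d]
      by (intro sq_le_2_int; linarith)+
    then show "x \<in> set root_list"
      using s unfolding x root_list_def by (elim insertE emptyE) simp_all
  qed
qed

lemma distinct_root_list: "distinct root_list"
  by (simp add: root_list_def)

lemma finite_roots [simp]: "finite roots"
  by (simp add: roots_eq)

lemma card_roots: "card roots = 24"
  using distinct_card[OF distinct_root_list] by (simp add: roots_eq) (simp add: root_list_def)

lemma sum_roots:
  fixes F :: "pt \<Rightarrow> 'a::comm_monoid_add"
  shows "(\<Sum>u\<in>roots. F u) =
    F (1,1,0,0) + F (1,-1,0,0) + F (-1,1,0,0) + F (-1,-1,0,0)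
  + F (1,0,1,0) + F (1,0,-1,0) + F (-1,0,1,0) + F (-1,0,-1,0)
  + F (1,0,0,1) + F (1,0,0,-1) + F (-1,0,0,1) + F (-1,0,0,-1)
  + F (0,1,1,0) + F (0,1,-1,0) + F (0,-1,1,0) + F (0,-1,-1,0)
  + F (0,1,0,1) + F (0,1,0,-1) + F (0,-1,0,1) + F (0,-1,0,-1)
  + F (0,0,1,1) + F (0,0,1,-1) + F (0,0,-1,1) + F (0,0,-1,-1)"
proof -
  have "(\<Sum>u\<in>roots. F u) = sum_list (map F root_list)"
    by (simp add: roots_eq sum_list_distinct_conv_sum_set distinct_root_list)
  also have "\<dots> = foldr (\<lambda>u s. F u + s) root_list 0"
    by (simp add: sum_list.eq_foldr foldr_map comp_def)
  finally show ?thesis by (simp add: root_list_def add.assoc)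
qed

lemma uminus_roots: "u \<in> roots \<Longrightarrow> - u \<in> roots"
  by (auto simp: roots_def)

lemma sum_roots_uminus: "(\<Sum>u\<in>roots. F (- u)) = (\<Sum>u\<in>roots. F u)"
  by (rule sum.reindex_bij_witness[of _ uminus uminus]) (auto simp: uminus_roots)

section \<open>Neighbour sums, the graph Laplacian and the pairing of square summable
  functions\<close>

definition nbr :: "(pt \<Rightarrow> real) \<Rightarrow> pt \<Rightarrow> real" where
  "nbr f x = (\<Sum>u\<in>roots. f (x + u))"

definition lap :: "(pt \<Rightarrow> real) \<Rightarrow> pt \<Rightarrow> real" where
  "lap f x = 24 * f x - nbr f x"

definition sqs :: "(pt \<Rightarrow> real) \<Rightarrow> bool" where
  "sqs f \<longleftrightarrow> (\<lambda>x. (f x)\<^sup>2) summable_on UNIV"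

definition ip :: "(pt \<Rightarrow> real) \<Rightarrow> (pt \<Rightarrow> real) \<Rightarrow> real" where
  "ip f g = (\<Sum>\<^sub>\<infinity>x. f x * g x)"

lemma sqs_prod:
  assumes "sqs f" "sqs g"
  shows "(\<lambda>x. f x * g x) summable_on UNIV"
proof (rule abs_summable_summable, rule summable_on_comparison_test)
  show "(\<lambda>x. (f x)\<^sup>2 + (g x)\<^sup>2) summable_on UNIV"
    using assms by (intro summable_on_add) (auto simp: sqs_def)
  show "norm (f x * g x) \<le> (f x)\<^sup>2 + (g x)\<^sup>2" for x
  proof -
    have "0 \<le> (\<bar>f x\<bar> - \<bar>g x\<bar>)\<^sup>2" by simp
    also have "\<dots> = (f x)\<^sup>2 + (g x)\<^sup>2 - 2 * (\<bar>f x\<bar> * \<bar>g x\<bar>)"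
      by (simp add: power2_eq_square algebra_simps)
    finally have "2 * (\<bar>f x\<bar> * \<bar>g x\<bar>) \<le> (f x)\<^sup>2 + (g x)\<^sup>2" by linarith
    moreover have "0 \<le> \<bar>f x\<bar> * \<bar>g x\<bar>" by simp
    ultimately show ?thesis unfolding real_norm_def abs_mult by linarith
  qed
qed simp

lemma bij_add: "bij (\<lambda>x::pt. x + u)"
  by (rule bij_betw_byWitness[where f' = "\<lambda>x. x - u"]) auto

lemma summable_shift:
  fixes f :: "pt \<Rightarrow> real"
  shows "(\<lambda>x. f (x + u)) summable_on UNIV \<longleftrightarrow> f summable_on UNIV"
  using summable_on_reindex_bij_betw[OF bij_add[of u], of f] by simp

lemma infsum_shift:
  fixes f :: "pt \<Rightarrow> real"
  shows "(\<Sum>\<^sub>\<infinity>x. f (x + u)) = (\<Sum>\<^sub>\<infinity>x. f x)"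
  using infsum_reindex_bij_betw[OF bij_add[of u], of f] by simp

lemma sqs_shift: "sqs f \<Longrightarrow> sqs (\<lambda>x. f (x + u))"
  unfolding sqs_def using summable_shift[of "\<lambda>x. (f x)\<^sup>2" u] by simp

lemma sqs_cmult: "sqs f \<Longrightarrow> sqs (\<lambda>x. c * f x)"
  unfolding sqs_def power_mult_distrib by (rule summable_on_cmult_right)

lemma sqs_add:
  assumes "sqs f" "sqs g" shows "sqs (\<lambda>x. f x + g x)"
proof -
  have "(\<lambda>x. ((f x)\<^sup>2 + (g x)\<^sup>2) + 2 * (f x * g x)) summable_on UNIV"
    using assms sqs_prod[OF assms] unfolding sqs_def
    by (intro summable_on_add summable_on_cmult_right)
  then show ?thesis
    unfolding sqs_def by (simp add: power2_sum mult.assoc)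
qed

lemma sqs_diff: "sqs f \<Longrightarrow> sqs g \<Longrightarrow> sqs (\<lambda>x. f x - g x)"
  using sqs_add[of f "\<lambda>x. (-1) * g x"] sqs_cmult[of g "-1"] by simp

lemma sqs_sum: "finite X \<Longrightarrow> (\<And>u. u \<in> X \<Longrightarrow> sqs (F u)) \<Longrightarrow>
    sqs (\<lambda>x. \<Sum>u\<in>X. F u x)"
proof (induction X rule: finite_induct)
  case empty then show ?case by (simp add: sqs_def)
next
  case (insert u X)
  have "sqs (\<lambda>x. F u x + (\<Sum>u\<in>X. F u x))"
    by (intro sqs_add insert.IH) (use insert.prems in auto)
  then show ?case using insert.hyps by simp
qed

lemma sqs_nbr: "sqs f \<Longrightarrow> sqs (nbr f)"
  unfolding nbr_def by (intro sqs_sum sqs_shift) auto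

lemma finite_supp_summable:
  fixes f :: "pt \<Rightarrow> real"
  assumes "finite X" "\<And>x. x \<notin> X \<Longrightarrow> f x = 0"
  shows "f summable_on UNIV" "(\<Sum>\<^sub>\<infinity>x. f x) = (\<Sum>x\<in>X. f x)"
proof -
  have "f summable_on UNIV \<longleftrightarrow> f summable_on X"
    by (rule summable_on_cong_neutral) (use assms in auto)
  then show "f summable_on UNIV" using assms by simp
  have "(\<Sum>\<^sub>\<infinity>x. f x) = (\<Sum>\<^sub>\<infinity>x\<in>X. f x)"
    by (rule infsum_cong_neutral) (use assms in auto)
  then show "(\<Sum>\<^sub>\<infinity>x. f x) = (\<Sum>x\<in>X. f x)" using assms by simp
qed

lemma ip_finite: "finite X \<Longrightarrow> (\<And>x. x \<notin> X \<Longrightarrow> f x = 0)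
    \<Longrightarrow> ip f g = (\<Sum>x\<in>X. f x * g x)"
  unfolding ip_def by (rule finite_supp_summable) auto

lemma ip_commute: "ip f g = ip g f"
  by (simp add: ip_def mult.commute)

lemma infsum_sum:
  fixes F :: "'b \<Rightarrow> pt \<Rightarrow> real"
  assumes "finite X" "\<And>u. u \<in> X \<Longrightarrow> F u summable_on UNIV"
  shows "(\<Sum>\<^sub>\<infinity>x. \<Sum>u\<in>X. F u x) = (\<Sum>u\<in>X. \<Sum>\<^sub>\<infinity>x. F u x)"
proof -
  have "((\<lambda>x. \<Sum>u\<in>X. F u x) has_sum (\<Sum>u\<in>X. \<Sum>\<^sub>\<infinity>x. F u x)) UNIV"
    using assms
  proof (induction X rule: finite_induct)
    case (insert u X)
    then show ?case by (auto intro!: has_sum_add has_sum_infsum)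
  qed simp
  then show ?thesis by (rule infsumI)
qed

definition fs :: "(pt \<Rightarrow> real) \<Rightarrow> bool" where
  "fs f \<longleftrightarrow> finite {x. f x \<noteq> 0}"

lemma fs_sqs: "fs f \<Longrightarrow> sqs f"
  unfolding fs_def sqs_def by (rule finite_supp_summable(1)[of "{x. f x \<noteq> 0}"]) auto

lemma fs_ip: "fs f \<Longrightarrow> ip f g = (\<Sum>x\<in>{x. f x \<noteq> 0}. f x * g x)"
  unfolding fs_def by (rule ip_finite) auto

lemma fs_nbr: assumes "fs f" shows "fs (nbr f)"
proof -
  have "{x. nbr f x \<noteq> 0} \<subseteq> (\<Union>u\<in>roots. (\<lambda>y. y - u) ` {x. f x \<noteq> 0})"
  proof
    fix x assume "x \<in> {x. nbr f x \<noteq> 0}"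
    then obtain u where "u \<in> roots" "f (x + u) \<noteq> 0"
      unfolding nbr_def by (auto intro: sum.not_neutral_contains_not_neutral)
    then show "x \<in> (\<Union>u\<in>roots. (\<lambda>y. y - u) ` {x. f x \<noteq> 0})"
      by (intro UN_I[of u] image_eqI[of _ _ "x + u"]) auto
  qed
  moreover have "finite (\<Union>u\<in>roots. (\<lambda>y. y - u) ` {x. f x \<noteq> 0})"
    using assms by (auto simp: fs_def)
  ultimately show ?thesis unfolding fs_def by (rule finite_subset)
qed

text \<open>Translating the summation variable by u moves the shift to the other factor as a shift
  by -u, and the roots are closed under negation.\<close>

lemma ip_nbr:
  assumes f: "sqs f" and g: "sqs g"
  shows "ip (nbr f) g = ip f (nbr g)"
proof -
  have s1: "(\<lambda>x. f (x + u) * g x) summable_on UNIV" for u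
    by (intro sqs_prod sqs_shift f g)
  have s2: "(\<lambda>x. f x * g (x + u)) summable_on UNIV" for u
    by (intro sqs_prod sqs_shift f g)
  have "ip (nbr f) g = (\<Sum>\<^sub>\<infinity>x. \<Sum>u\<in>roots. f (x + u) * g x)"
    by (simp add: ip_def nbr_def sum_distrib_right)
  also have "\<dots> = (\<Sum>u\<in>roots. \<Sum>\<^sub>\<infinity>x. f (x + u) * g x)"
    by (intro infsum_sum s1) simp
  also have "\<dots> = (\<Sum>u\<in>roots. \<Sum>\<^sub>\<infinity>x. f x * g (x + - u))"
  proof (rule sum.cong[OF refl])
    fix u
    show "(\<Sum>\<^sub>\<infinity>x. f (x + u) * g x) = (\<Sum>\<^sub>\<infinity>x. f x * g (x + - u))"
      using infsum_shift[of "\<lambda>x. f x * g (x + - u)" u] by (simp add: algebra_simps)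
  qed
  also have "\<dots> = (\<Sum>u\<in>roots. \<Sum>\<^sub>\<infinity>x. f x * g (x + u))"
    by (rule sum_roots_uminus)
  also have "\<dots> = (\<Sum>\<^sub>\<infinity>x. \<Sum>u\<in>roots. f x * g (x + u))"
    by (intro infsum_sum[symmetric] s2) simp
  also have "\<dots> = ip f (nbr g)"
    by (simp add: ip_def nbr_def sum_distrib_left)
  finally show ?thesis .
qed

lemma sqs_tendsto:
  assumes "sqs f" "e > 0"
  shows "finite {x. \<bar>f x\<bar> \<ge> e}"
proof (rule ccontr)
  assume inf: "infinite {x. \<bar>f x\<bar> \<ge> e}"
  define M where "M = (\<Sum>\<^sub>\<infinity>x. (f x)\<^sup>2)"
  obtain n :: nat where n: "M < real n * e\<^sup>2"
    using assms(2) reals_Archimedean3[of "e\<^sup>2"] by auto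
  obtain X where X: "X \<subseteq> {x. \<bar>f x\<bar> \<ge> e}" "finite X" "card X = n"
    using infinite_arbitrarily_large[OF inf] by blast
  have "real n * e\<^sup>2 = (\<Sum>x\<in>X. e\<^sup>2)" using X by simp
  also have "\<dots> \<le> (\<Sum>x\<in>X. (f x)\<^sup>2)"
    using X(1) assms(2) by (intro sum_mono) (auto simp: abs_le_square_iff[symmetric])
  also have "\<dots> \<le> M"
    unfolding M_def by (rule finite_sum_le_infsum) (use assms X in \<open>auto simp: sqs_def\<close>)
  finally show False using n by simp
qed

text \<open>Every vertex has a neighbour with larger first coordinate, so a negative minimum would
  propagate to infinitely many points.\<close>

lemma max_principle:
  fixes f :: "pt \<Rightarrow> real"
  assumes van: "\<And>e. e > 0 \<Longrightarrow> finite {x. f x \<le> - e}"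
    and sup: "\<And>x. f x < 0 \<Longrightarrow> nbr f x \<le> 24 * f x"
  shows "f x \<ge> 0"
proof (rule ccontr)
  assume "\<not> 0 \<le> f x"
  then have neg: "f x < 0" by simp
  define X where "X = {y. f y \<le> f x}"
  have finX: "finite X" using van[of "- f x"] neg by (simp add: X_def)
  have xX: "x \<in> X" by (simp add: X_def)
  define m where "m = Min (f ` X)"
  define Y where "Y = {y \<in> X. f y = m}"
  have "m \<in> f ` X" unfolding m_def using finX xX by (intro Min_in) auto
  then have Yne: "Y \<noteq> {}" by (auto simp: Y_def)
  have finY: "finite Y" using finX by (simp add: Y_def)
  have mle: "m \<le> f y" for y
  proof (cases "y \<in> X")
    case True then show ?thesis unfolding m_def using finX by simp
  next
    case False
    have "m \<le> f x" unfolding m_def using finX xX by simp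
    then show ?thesis using False by (simp add: X_def)
  qed
  have "Max (fst ` Y) \<in> fst ` Y" using finY Yne by (intro Max_in) auto
  then obtain y where y: "y \<in> Y" "fst y = Max (fst ` Y)" by auto
  have ymax: "fst z \<le> fst y" if "z \<in> Y" for z
    unfolding y(2) using finY that by simp
  have fy: "f y = m" using y by (simp add: Y_def)
  have "m < 0" using neg mle[of x] by simp
  then have s: "nbr f y \<le> 24 * m" using sup[of y] fy by simp
  have "f (y + (1,1,0,0)) = m"
  proof (rule ccontr)
    assume "f (y + (1,1,0,0)) \<noteq> m"
    then have lt: "m < f (y + (1,1,0,0))" using mle[of "y + (1,1,0,0)"] by simp
    have "(\<Sum>u\<in>roots. m) < (\<Sum>u\<in>roots. f (y + u))"
    proof (rule sum_strict_mono_ex1)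
      have "(1,1,0,0) \<in> roots" by (simp add: roots_def)
      then show "\<exists>u\<in>roots. m < f (y + u)" using lt by blast
    qed (use mle in auto)
    then show False using s by (simp add: nbr_def card_roots)
  qed
  moreover have "m \<le> f x" by (rule mle)
  ultimately have "y + (1,1,0,0) \<in> Y" by (simp add: Y_def X_def)
  then have "fst (y + (1,1,0,0)) \<le> fst y" by (rule ymax)
  then show False by (cases y) simp
qed

section \<open>Killed random walks\<close>

declare split_paired_All [simp del] split_paired_Ex [simp del]

text \<open>The start \<open>s\<close> is not cut down to \<open>D\<close>: killing takes effect from the first step on.\<close>

fun walk :: "pt set \<Rightarrow> (pt \<Rightarrow> real) \<Rightarrow> nat \<Rightarrow> pt \<Rightarrow> real" where
  "walk D s 0 = s"
| "walk D s (Suc n) = (\<lambda>x. if x \<in> D then nbr (walk D s n) x / 24 else 0)"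

definition pt_mass :: "pt \<Rightarrow> pt \<Rightarrow> real" where
  "pt_mass y x = (if x = y then 1 else 0)"

definition supp_in :: "pt set \<Rightarrow> (pt \<Rightarrow> real) \<Rightarrow> bool" where
  "supp_in D f \<longleftrightarrow> (\<forall>x. x \<notin> D \<longrightarrow> f x = 0)"

lemma supp_inD: "supp_in D f \<Longrightarrow> x \<notin> D \<Longrightarrow> f x = 0"
  by (simp add: supp_in_def)

lemma nbr_mono: "(\<And>x. f x \<le> g x) \<Longrightarrow> nbr f x \<le> nbr g x"
  unfolding nbr_def by (intro sum_mono) auto

lemma nbr_nonneg: "(\<And>x. 0 \<le> f x) \<Longrightarrow> 0 \<le> nbr f x"
  unfolding nbr_def by (intro sum_nonneg) auto

lemma nbr_add: "nbr (\<lambda>x. f x + g x) x = nbr f x + nbr g x"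
  by (simp add: nbr_def sum.distrib)

lemma nbr_diff: "nbr (\<lambda>x. f x - g x) x = nbr f x - nbr g x"
  by (simp add: nbr_def sum_subtractf)

lemma nbr_cmult: "nbr (\<lambda>x. c * f x) x = c * nbr f x"
  by (simp add: nbr_def sum_distrib_left)

lemma nbr_uminus: "nbr (\<lambda>x. - f x) x = - nbr f x"
  by (simp add: nbr_def sum_negf)

lemma nbr_shift: "nbr (\<lambda>x. f (x + t)) x = nbr f (x + t)"
  by (simp add: nbr_def algebra_simps)

lemma lap_diff: "lap (\<lambda>x. f x - g x) x = lap f x - lap g x"
  by (simp add: lap_def nbr_diff)

lemma lap_uminus: "lap (\<lambda>x. - f x) x = - lap f x"
  by (simp add: lap_def nbr_uminus)

lemma lap_shift: "lap (\<lambda>x. f (x + t)) x = lap f (x + t)"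
  by (simp add: lap_def nbr_shift)

lemma fs_pt_mass [simp]: "fs (pt_mass y)"
  unfolding fs_def by (rule finite_subset[of _ "{y}"]) (auto simp: pt_mass_def)

lemma fs_add: "fs f \<Longrightarrow> fs g \<Longrightarrow> fs (\<lambda>x. f x + g x)"
  unfolding fs_def by (rule finite_subset[of _ "{x. f x \<noteq> 0} \<union> {x. g x \<noteq> 0}"]) auto

lemma fs_walk: "fs s \<Longrightarrow> fs (walk D s n)"
proof (induction n)
  case (Suc n)
  then have "finite {x. nbr (walk D s n) x \<noteq> 0}"
    using fs_nbr by (simp add: fs_def)
  then show ?case
    unfolding fs_def by (rule finite_subset[rotated]) auto
qed simp

lemma walk_nonneg: "(\<And>x. 0 \<le> s x) \<Longrightarrow> 0 \<le> walk D s n x"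
proof (induction n arbitrary: x)
  case (Suc n) then show ?case by (auto intro!: divide_nonneg_nonneg nbr_nonneg)
qed simp

lemma walk_supp: "supp_in D s \<Longrightarrow> supp_in D (walk D s n)"
  by (cases n) (auto simp: supp_in_def)

lemma walk_add: "walk D (\<lambda>x. s x + t x) n x = walk D s n x + walk D t n x"
proof (induction n arbitrary: x)
  case (Suc n)
  have "walk D (\<lambda>x. s x + t x) n = (\<lambda>x. walk D s n x + walk D t n x)"
    using Suc.IH by (rule ext)
  then show ?case by (simp add: nbr_add add_divide_distrib)
qed simp

lemma walk_mono_dom:
  assumes "D \<subseteq> E" "\<And>x. 0 \<le> s x"
  shows "walk D s n x \<le> walk E s n x"
proof (induction n arbitrary: x)
  case (Suc n)
  have "nbr (walk D s n) x \<le> nbr (walk E s n) x" by (intro nbr_mono Suc.IH)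
  moreover have "0 \<le> nbr (walk E s n) x" by (intro nbr_nonneg walk_nonneg assms)
  ultimately show ?case using assms(1) by (auto simp: divide_right_mono)
qed simp

lemma ip_walk_Suc:
  assumes "fs f" "supp_in D f" "fs s"
  shows "ip f (walk D s (Suc n)) = ip f (nbr (walk D s n)) / 24"
proof -
  have "ip f (walk D s (Suc n)) = (\<Sum>x\<in>{x. f x \<noteq> 0}. f x * (nbr (walk D s n) x / 24))"
    unfolding fs_ip[OF assms(1)] by (rule sum.cong) (use assms(2) in \<open>auto simp: supp_in_def\<close>)
  then show ?thesis
    by (simp add: fs_ip[OF assms(1)] sum_divide_distrib)
qed

text \<open>On functions supported in \<open>D\<close> the killed step is self-adjoint, so steps can
  be moved from one factor to the other one at a time. This semigroup identity is what turns squared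
  norms into return probabilities.\<close>

lemma ip_walk:
  assumes s: "fs s" "supp_in D s" and t: "fs t" "supp_in D t"
  shows "ip (walk D s m) (walk D t n) = ip s (walk D t (m + n))"
proof (induction m arbitrary: n)
  case (Suc m)
  have "ip (walk D s (Suc m)) (walk D t n) = ip (walk D t n) (nbr (walk D s m)) / 24"
    by (subst ip_commute) (rule ip_walk_Suc; intro fs_walk walk_supp s t)
  also have "ip (walk D t n) (nbr (walk D s m)) = ip (walk D s m) (nbr (walk D t n))"
    by (subst ip_nbr[symmetric]) (auto intro!: fs_sqs fs_walk s t simp: ip_commute)
  also have "\<dots> / 24 = ip (walk D s m) (walk D t (Suc n))"
    by (rule ip_walk_Suc[symmetric]; intro fs_walk walk_supp s t)
  also have "\<dots> = ip s (walk D t (Suc m + n))"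
    using Suc.IH[of "Suc n"] by simp
  finally show ?case .
qed simp

lemma ip_pt_mass: "ip (pt_mass y) f = f y"
  using ip_finite[of "{y}" "pt_mass y" f] by (simp add: pt_mass_def)

lemma ip_walk_pt:
  assumes "y \<in> D" "z \<in> D"
  shows "ip (walk D (pt_mass y) m) (walk D (pt_mass z) n) = walk D (pt_mass z) (m + n) y"
  using assms by (subst ip_walk) (auto simp: ip_pt_mass supp_in_def pt_mass_def)

lemma walk_commute:
  assumes "y \<in> D" "z \<in> D"
  shows "walk D (pt_mass y) n z = walk D (pt_mass z) n y"
  using ip_walk_pt[OF assms, of n 0] ip_walk_pt[OF assms, of 0 n]
  by (simp add: ip_pt_mass ip_commute[of _ "pt_mass z"])

text \<open>Reflection principle. The hypothesis on \<open>P\<close> says that a step cannot jump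
  over the wall: it stays on the positive side or lands on a fixed point of \<open>\<rho>\<close>,
  where the difference of the two walks vanishes. That \<open>s\<close> vanishes at mirror images of
  positive points gives the identity at time zero.\<close>

lemma walk_reflect:
  fixes \<rho> :: "pt \<Rightarrow> pt" and D :: "pt set" and s :: "pt \<Rightarrow> real" and P :: "pt \<Rightarrow> bool"
  defines "E \<equiv> {x \<in> D. P x}"
  assumes add: "\<And>x u. \<rho> (x + u) = \<rho> x + \<rho> u"
    and inv: "\<And>x. \<rho> (\<rho> x) = x"
    and rr: "\<And>u. u \<in> roots \<Longrightarrow> \<rho> u \<in> roots"
    and D: "\<And>x. \<rho> x \<in> D \<longleftrightarrow> x \<in> D"
    and P: "\<And>x u. P x \<Longrightarrow> u \<in> roots \<Longrightarrow> P (x + u) \<or> \<rho> (x + u) = x + u"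
    and sE: "supp_in E s" and rs: "\<And>x. P x \<Longrightarrow> s (\<rho> x) = 0" and sD: "supp_in D s"
  shows "x \<in> E \<Longrightarrow> walk E s n x = walk D s n x - walk D s n (\<rho> x)"
proof -
  have nbr_rho: "nbr f (\<rho> x) = nbr (\<lambda>x. f (\<rho> x)) x" for f x
  proof -
    have "nbr f (\<rho> x) = (\<Sum>u\<in>roots. f (\<rho> (x + \<rho> u)))" by (simp add: nbr_def add inv)
    also have "\<dots> = (\<Sum>u\<in>roots. f (\<rho> (x + u)))"
      by (rule sum.reindex_bij_witness[of _ \<rho> \<rho>]) (auto simp: inv rr)
    finally show ?thesis by (simp add: nbr_def)
  qed
  have "x \<in> E \<Longrightarrow> walk E s n x = walk D s n x - walk D s n (\<rho> x)" for x
  proof (induction n arbitrary: x)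
    case 0 then show ?case using rs by (simp add: E_def)
  next
    case (Suc n)
    have "nbr (walk E s n) x = nbr (\<lambda>z. walk D s n z - walk D s n (\<rho> z)) x"
      unfolding nbr_def
    proof (rule sum.cong[OF refl])
      fix u assume u: "u \<in> roots"
      show "walk E s n (x + u) = walk D s n (x + u) - walk D s n (\<rho> (x + u))"
      proof (cases "x + u \<in> E")
        case True then show ?thesis by (rule Suc.IH)
      next
        case False
        then have z: "walk E s n (x + u) = 0"
          by (rule supp_inD[OF walk_supp[OF sE]])
        from False consider "x + u \<notin> D" | "\<not> P (x + u)" by (auto simp: E_def)
        then show ?thesis
        proof cases
          case 1
          then show ?thesis using z walk_supp[OF sD, of n] D[of "x + u"] by (simp add: supp_in_def)
        next
          case 2
          then have "\<rho> (x + u) = x + u" using P[OF _ u, of x] Suc.prems unfolding E_def by blast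
          then show ?thesis using z by simp
        qed
      qed
    qed
    then show ?case
      using Suc.prems D[of x] by (simp add: E_def nbr_diff nbr_rho diff_divide_distrib)
  qed
  then show "x \<in> E \<Longrightarrow> walk E s n x = walk D s n x - walk D s n (\<rho> x)" .
qed

text \<open>Pairing a finitely supported subsolution pair with the walk turns two applications of the
  Green operator into pointwise inequalities.\<close>

lemma subsolution_step:
  assumes s: "fs s" "supp_in D s" "\<And>x. 0 \<le> s x"
    and F: "fs F" "supp_in D F" and g: "fs g" "\<And>x. x \<in> D \<Longrightarrow> lap F x \<le> g x"
  shows "ip (walk D s n) F - ip (walk D s (Suc n)) F \<le> ip (walk D s n) g / 24"
proof -
  define X where "X = {x. walk D s n x \<noteq> 0}"
  have X: "finite X" using fs_walk[OF s(1)] by (simp add: X_def fs_def)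
  have XD: "X \<subseteq> D" using supp_inD[OF walk_supp[OF s(2)]] unfolding X_def by blast
  have ipX: "ip (walk D s n) h = (\<Sum>x\<in>X. walk D s n x * h x)" for h
    unfolding X_def by (rule fs_ip) (rule fs_walk[OF s(1)])
  have "ip (walk D s (Suc n)) F = ip (nbr F) (walk D s n) / 24"
    by (subst ip_commute, subst ip_walk_Suc, (intro F s)+, subst ip_nbr[symmetric])
      (auto intro!: fs_sqs fs_walk s F)
  then have "ip (walk D s n) F - ip (walk D s (Suc n)) F = (\<Sum>x\<in>X. walk D s n x * lap F x) / 24"
    by (simp add: ip_commute[of "nbr F"] ipX lap_def sum_subtractf algebra_simps sum_divide_distrib
        diff_divide_distrib sum_distrib_left)
  also have "\<dots> \<le> (\<Sum>x\<in>X. walk D s n x * g x) / 24"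
    using g(2) XD walk_nonneg[OF s(3)]
    by (intro divide_right_mono sum_mono mult_left_mono) auto
  finally show ?thesis by (simp add: ipX)
qed

text \<open>The hypotheses place \<open>F\<close> below the Green potential of \<open>s\<close> and
  \<open>L\<close> below that of \<open>F\<close>. Applying the Green operator twice splits a total
  time n in n + 1 ways, and each application contributes a factor 1/24, hence the weight and the
  576.\<close>

lemma subsolution_pair:
  assumes s: "fs s" "supp_in D s" "\<And>x. 0 \<le> s x"
    and F: "fs F" "supp_in D F" and L: "fs L" "supp_in D L"
    and FL: "\<And>x. x \<in> D \<Longrightarrow> lap F x \<le> s x" "\<And>x. x \<in> D \<Longrightarrow> lap L x \<le> F x"
    and van: "\<And>x. (\<lambda>n. walk D s n x) \<longlonglongrightarrow> 0"
    and sum: "summable (\<lambda>n. (real n + 1) * ip (walk D s n) s)"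
  shows "ip s L \<le> (\<Sum>n. (real n + 1) * ip (walk D s n) s) / 576"
proof -
  define \<sigma> where "\<sigma> n = ip (walk D s n) s" for n
  define \<phi> where "\<phi> n = ip (walk D s n) F" for n
  define \<mu> where "\<mu> n = ip (walk D s n) L" for n
  have \<sigma>0: "0 \<le> \<sigma> n" for n
    unfolding \<sigma>_def fs_ip[OF fs_walk[OF s(1)]] by (intro sum_nonneg mult_nonneg_nonneg walk_nonneg s)
  have tends: "(\<lambda>n. ip (walk D s n) H) \<longlonglongrightarrow> 0" if "fs H" for H
  proof -
    have "(\<lambda>n. \<Sum>x\<in>{x. H x \<noteq> 0}. H x * walk D s n x) \<longlonglongrightarrow>
        (\<Sum>x\<in>{x. H x \<noteq> 0}. H x * 0)"
      by (intro tendsto_sum tendsto_mult tendsto_const van)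
    then show ?thesis by (simp add: ip_commute[of _ H] fs_ip[OF that])
  qed
  have step1: "\<phi> n \<le> \<sigma> n / 24 + \<phi> (Suc n)" for n
    using subsolution_step[OF s F s(1) FL(1), of n] by (simp add: \<phi>_def \<sigma>_def)
  have step2: "\<mu> n \<le> \<phi> n / 24 + \<mu> (Suc n)" for n
    using subsolution_step[OF s L F(1) FL(2), of n] by (simp add: \<phi>_def \<mu>_def)
  have it1: "\<phi> n \<le> (\<Sum>i<k. \<sigma> (n + i)) / 24 + \<phi> (n + k)" for n k
  proof (induction k)
    case (Suc k) then show ?case using step1[of "n + k"] by (simp add: add_divide_distrib)
  qed simp
  have it2: "\<mu> 0 \<le> (\<Sum>i<k. \<phi> i) / 24 + \<mu> k" for k
  proof (induction k)
    case (Suc k) then show ?case using step2[of k] by (simp add: add_divide_distrib)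
  qed simp
  define M where "M = (\<Sum>n. (real n + 1) * \<sigma> n)"
  have sm: "summable (\<lambda>n. (real n + 1) * \<sigma> n)" using sum by (simp add: \<sigma>_def)
  have double: "(\<Sum>j<N. \<Sum>i<k. \<sigma> (j + i)) \<le> M" for N k
  proof -
    have "(\<Sum>j<N. \<Sum>i<k. \<sigma> (j + i)) = (\<Sum>p\<in>{..<N} \<times> {..<k}. \<sigma> (fst p + snd p))"
      by (simp add: sum.cartesian_product case_prod_beta)
    also have "\<dots> = (\<Sum>m<N + k. \<Sum>p\<in>{p \<in> {..<N} \<times> {..<k}. fst p + snd p = m}. \<sigma> (fst p + snd p))"
      by (rule sum.group[symmetric]) auto
    also have "\<dots> \<le> (\<Sum>m<N + k. (real m + 1) * \<sigma> m)"
    proof (rule sum_mono)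
      fix m
      let ?P = "{p \<in> {..<N} \<times> {..<k}. fst p + snd p = m}"
      have "?P \<subseteq> (\<lambda>i. (i, m - i)) ` {..m}" by (auto simp: image_iff)
      then have "card ?P \<le> card ((\<lambda>i. (i, m - i)) ` {..m})" by (intro card_mono) auto
      also have "\<dots> \<le> m + 1" using card_image_le[of "{..m}" "\<lambda>i. (i, m - i)"] by simp
      finally have "real (card ?P) \<le> real m + 1" by simp
      then show "(\<Sum>p\<in>?P. \<sigma> (fst p + snd p)) \<le> (real m + 1) * \<sigma> m"
        using \<sigma>0 by (simp add: mult_right_mono)
    qed
    also have "\<dots> \<le> M"
      unfolding M_def by (rule sum_le_suminf[OF sm]) (use \<sigma>0 in auto)
    finally show ?thesis .
  qed
  \<comment> \<open>For fixed \<open>N\<close> the finitely many boundary terms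
    \<open>\<phi> (k + j)\<close> vanish as \<open>k\<close> grows, while the double sum stays below
    \<open>M\<close> uniformly in \<open>k\<close>.\<close>
  have b1: "(\<Sum>j<N. \<phi> j) \<le> M / 24" for N
  proof (rule LIMSEQ_le_const)
    show "(\<lambda>k. M / 24 + (\<Sum>j<N. \<phi> (k + j))) \<longlonglongrightarrow> M / 24"
    proof -
      have "(\<lambda>k. M / 24 + (\<Sum>j<N. \<phi> (k + j))) \<longlonglongrightarrow> M / 24 + (\<Sum>j<N. 0)"
        unfolding \<phi>_def
        by (intro tendsto_add tendsto_const tendsto_sum LIMSEQ_ignore_initial_segment tends F)
      then show ?thesis by simp
    qed
    have "(\<Sum>j<N. \<phi> j) \<le> M / 24 + (\<Sum>j<N. \<phi> (k + j))" for k
    proof -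
      have "(\<Sum>j<N. \<phi> j) \<le> (\<Sum>j<N. (\<Sum>i<k. \<sigma> (j + i)) / 24 + \<phi> (k + j))"
        using it1 by (intro sum_mono) (simp add: add.commute[of k])
      also have "\<dots> = (\<Sum>j<N. \<Sum>i<k. \<sigma> (j + i)) / 24 + (\<Sum>j<N. \<phi> (k + j))"
        by (simp add: sum.distrib sum_divide_distrib)
      finally show ?thesis using double[where N=N and k=k] by simp
    qed
    then show "\<exists>K. \<forall>k\<ge>K. (\<Sum>j<N. \<phi> j) \<le> M / 24 + (\<Sum>j<N. \<phi> (k + j))" by blast
  qed
  have "\<mu> 0 \<le> M / 576"
  proof (rule LIMSEQ_le_const)
    have "(\<lambda>k. M / 576 + \<mu> k) \<longlonglongrightarrow> M / 576 + 0"
      unfolding \<mu>_def by (intro tendsto_add tendsto_const tends L)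
    then show "(\<lambda>k. M / 576 + \<mu> k) \<longlonglongrightarrow> M / 576" by simp
    have "\<mu> 0 \<le> M / 576 + \<mu> k" for k
      using it2[of k] b1[of k] by simp
    then show "\<exists>K. \<forall>k\<ge>K. \<mu> 0 \<le> M / 576 + \<mu> k" by blast
  qed
  then show ?thesis by (simp add: \<mu>_def M_def \<sigma>_def)
qed

section \<open>Exchangeability and lattice symmetries\<close>

abbreviation p :: "nat \<Rightarrow> pt \<Rightarrow> real" where
  "p \<equiv> walk UNIV (pt_mass 0)"

lemma pt_mass_nonneg: "0 \<le> pt_mass y x"
  by (simp add: pt_mass_def)

lemma p_nonneg: "0 \<le> p n x"
  by (intro walk_nonneg pt_mass_nonneg)

lemma nbr_p: "nbr (p n) x = 24 * p (Suc n) x"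
  by simp

lemma walk_shift: "walk UNIV (pt_mass y) n x = p n (x - y)"
proof (induction n arbitrary: x)
  case 0 show ?case by (simp add: pt_mass_def)
next
  case (Suc n)
  have "walk UNIV (pt_mass y) n = (\<lambda>x. p n (x + - y))" using Suc.IH by (auto simp: fun_eq_iff)
  then have "nbr (walk UNIV (pt_mass y) n) x = nbr (p n) (x + - y)"
    by (simp only: nbr_shift)
  then show ?case by simp
qed

text \<open>First-step decomposition writes the partial sum up to N + 1 as a unit mass plus a
  neighbour sum of the previous one, and a supersolution dominates the same expression. This bound
  is also what shows that the walk is transient.\<close>

lemma supersolution_bound:
  assumes "\<And>x. 0 \<le> h x" "\<And>x. pt_mass 0 x \<le> lap h x"
  shows "(\<Sum>n<N. p n x) / 24 \<le> h x"
proof (induction N arbitrary: x)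
  case 0 then show ?case using assms(1) by simp
next
  case (Suc N)
  have "(\<Sum>n<Suc N. p n x) = pt_mass 0 x + (\<Sum>n<N. nbr (p n) x / 24)"
    by (subst sum.lessThan_Suc_shift) simp
  also have "(\<Sum>n<N. nbr (p n) x / 24) = nbr (\<lambda>x. (\<Sum>n<N. p n x) / 24) x"
    by (simp add: nbr_def sum.swap[of _ roots] sum_divide_distrib)
  also have "\<dots> \<le> nbr h x" by (intro nbr_mono Suc.IH)
  finally have "(\<Sum>n<Suc N. p n x) \<le> pt_mass 0 x + nbr h x" by simp
  also have "\<dots> \<le> 24 * h x" using assms(2)[of x] by (simp add: lap_def)
  finally show ?case by simp
qed

locale lattice_symmetry =
  fixes \<rho> :: "pt \<Rightarrow> pt"
  assumes add: "\<rho> (x + u) = \<rho> x + \<rho> u"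
    and inv: "\<rho> (\<rho> x) = x"
    and rt: "u \<in> roots \<Longrightarrow> \<rho> u \<in> roots"
begin

lemma nbr_sym: "nbr f (\<rho> x) = nbr (\<lambda>x. f (\<rho> x)) x"
proof -
  have "nbr f (\<rho> x) = (\<Sum>u\<in>roots. f (\<rho> (x + \<rho> u)))" by (simp add: nbr_def add inv)
  also have "\<dots> = (\<Sum>u\<in>roots. f (\<rho> (x + u)))"
    by (rule sum.reindex_bij_witness[of _ \<rho> \<rho>]) (auto simp: inv rt)
  finally show ?thesis by (simp add: nbr_def)
qed

lemma lap_sym: "lap f (\<rho> x) = lap (\<lambda>x. f (\<rho> x)) x"
  by (simp add: lap_def nbr_sym)

lemma zero_sym: "\<rho> 0 = 0"
  using add[of 0 0] by simp

lemma p_sym: "p n (\<rho> x) = p n x"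
proof (induction n arbitrary: x)
  case 0
  have "\<rho> x = 0 \<longleftrightarrow> x = 0" using zero_sym inv by metis
  then show ?case by (simp add: pt_mass_def)
next
  case (Suc n) then show ?case by (simp add: nbr_sym)
qed

end

definition swap12 :: "pt \<Rightarrow> pt" where "swap12 = (\<lambda>(a, b, c, d). (b, a, c, d))"
definition swap23 :: "pt \<Rightarrow> pt" where "swap23 = (\<lambda>(a, b, c, d). (a, c, b, d))"
definition swap34 :: "pt \<Rightarrow> pt" where "swap34 = (\<lambda>(a, b, c, d). (a, b, d, c))"
definition neg1 :: "pt \<Rightarrow> pt" where "neg1 = (\<lambda>(a, b, c, d). (- a, b, c, d))"
definition neg2 :: "pt \<Rightarrow> pt" where "neg2 = (\<lambda>(a, b, c, d). (a, - b, c, d))"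
definition neg3 :: "pt \<Rightarrow> pt" where "neg3 = (\<lambda>(a, b, c, d). (a, b, - c, d))"
definition neg4 :: "pt \<Rightarrow> pt" where "neg4 = (\<lambda>(a, b, c, d). (a, b, c, - d))"

interpretation swap12: lattice_symmetry swap12
  by unfold_locales (auto simp: swap12_def roots_def)
interpretation swap23: lattice_symmetry swap23
  by unfold_locales (auto simp: swap23_def roots_def)
interpretation swap34: lattice_symmetry swap34
  by unfold_locales (auto simp: swap34_def roots_def)
interpretation neg1: lattice_symmetry neg1
  by unfold_locales (auto simp: neg1_def roots_def)
interpretation neg2: lattice_symmetry neg2
  by unfold_locales (auto simp: neg2_def roots_def)
interpretation neg3: lattice_symmetry neg3
  by unfold_locales (auto simp: neg3_def roots_def)
interpretation neg4: lattice_symmetry neg4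
  by unfold_locales (auto simp: neg4_def roots_def)

definition sorted4 :: "pt \<Rightarrow> bool" where
  "sorted4 = (\<lambda>(a, b, c, d). a \<ge> b \<and> b \<ge> c \<and> c \<ge> d \<and> d \<ge> 0)"

text \<open>One sign change suffices as a hypothesis, since conjugating it by swaps yields the other
  three; after taking absolute values the coordinates are sorted by insertion with adjacent
  swaps.\<close>

lemma fundamental_domain:
  assumes inv: "\<And>x. Q (swap12 x) \<Longrightarrow> Q x" "\<And>x. Q (swap23 x) \<Longrightarrow> Q x"
      "\<And>x. Q (swap34 x) \<Longrightarrow> Q x"
      "\<And>x. Q (neg1 x) \<Longrightarrow> Q x"
    and Q: "\<And>x. sorted4 x \<Longrightarrow> Q x"
  shows "Q x"
proof -
  have s12: "Q (b, a, c, d) \<Longrightarrow> Q (a, b, c, d)" for a b c d using inv(1)[of "(a,b,c,d)"] by (simp add: swap12_def)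
  have s23: "Q (a, c, b, d) \<Longrightarrow> Q (a, b, c, d)" for a b c d using inv(2)[of "(a,b,c,d)"] by (simp add: swap23_def)
  have s34: "Q (a, b, d, c) \<Longrightarrow> Q (a, b, c, d)" for a b c d using inv(3)[of "(a,b,c,d)"] by (simp add: swap34_def)
  have n1: "Q (- a, b, c, d) \<Longrightarrow> Q (a, b, c, d)" for a b c d using inv(4)[of "(a,b,c,d)"] by (simp add: neg1_def)
  have a1: "Q (a, b, c, d)" if "Q (\<bar>a\<bar>, b, c, d)" for a b c d
    using that n1[of a b c d] by (cases "a \<ge> 0") auto
  have a2: "Q (a, b, c, d)" if "Q (a, \<bar>b\<bar>, c, d)" for a b c d
    by (rule s12, rule a1, rule s12, rule that)
  have a3: "Q (a, b, c, d)" if "Q (a, b, \<bar>c\<bar>, d)" for a b c d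
    by (rule s23, rule a2, rule s23, rule that)
  have a4: "Q (a, b, c, d)" if "Q (a, b, c, \<bar>d\<bar>)" for a b c d
    by (rule s34, rule a3, rule s34, rule that)
  have o1: "Q (a, b, c, d)" if "a \<ge> b" "b \<ge> c" "c \<ge> d" "d \<ge> 0" for a b c d
    by (rule Q) (use that in \<open>simp add: sorted4_def\<close>)
  have o2: "Q (a, b, c, d)" if "b \<ge> c" "c \<ge> d" "d \<ge> 0" "a \<ge> 0" for a b c d
  proof -
    consider "a \<ge> b" | "b \<ge> a" "a \<ge> c" | "c \<ge> a" "a \<ge> d" | "d \<ge> a" by linarith
    then show ?thesis
    proof cases
      case 1 then show ?thesis using that by (intro o1)
    next
      case 2 then show ?thesis using that by (intro s12[OF o1])
    next
      case 3 then show ?thesis using that by (intro s12[OF s23[OF o1]])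
    next
      case 4 then show ?thesis using that by (intro s12[OF s23[OF s34[OF o1]]]) 
    qed
  qed
  have o3: "Q (a, b, c, d)" if "c \<ge> d" "d \<ge> 0" "a \<ge> 0" "b \<ge> 0" for a b c d
  proof -
    consider "b \<ge> c" | "c \<ge> b" "b \<ge> d" | "d \<ge> b" by linarith
    then show ?thesis
    proof cases
      case 1 then show ?thesis using that by (intro o2)
    next
      case 2 then show ?thesis using that by (intro s23[OF o2])
    next
      case 3 then show ?thesis using that by (intro s23[OF s34[OF o2]])
    qed
  qed
  have o4: "Q (a, b, c, d)" if "a \<ge> 0" "b \<ge> 0" "c \<ge> 0" "d \<ge> 0" for a b c d
    using o3[of d c a b] s34[OF o3[of c d a b]] that by (cases "c \<ge> d") auto
  obtain a b c d where x: "x = (a, b, c, d)" by (cases x)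
  show ?thesis unfolding x
    by (rule a1, rule a2, rule a3, rule a4, rule o4) auto
qed

text \<open>The displacement \<open>x\<close> of an \<open>n\<close>-step walk is a sum of \<open>n\<close> exchangeable steps, so
  \<open>x p n x\<close> is \<open>n\<close> times the contribution of one step.\<close>

definition drift :: "(pt \<Rightarrow> real) \<Rightarrow> (pt \<Rightarrow> real) \<Rightarrow> pt \<Rightarrow> real" where
  "drift \<pi> f x = (\<Sum>u\<in>roots. \<pi> u * f (x + u))"

lemma drift_nbr: "drift \<pi> (nbr f) x = nbr (drift \<pi> f) x"
  unfolding drift_def nbr_def sum_distrib_left
  by (subst sum.swap) (simp add: algebra_simps)

lemma drift_weight:
  assumes add: "\<And>x y. \<pi> (x + y) = \<pi> x + (\<pi> y :: real)"
  shows "nbr (\<lambda>y. \<pi> y * f y) x = drift \<pi> f x + \<pi> x * nbr f x"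
  by (simp add: drift_def nbr_def add distrib_right sum.distrib sum_distrib_left)

text \<open>The sign is negative because \<open>drift\<close> weights the step from x + u to x,
  which is -u. For the induction, apply \<open>nbr\<close> to the identity at time n: on one side
  the product rule \<open>drift_weight\<close> splits off a further drift, on the other
  \<open>drift\<close> commutes with \<open>nbr\<close>, so n + 1 copies become n + 2.\<close>

lemma exchange:
  assumes add: "\<And>x y. \<pi> (x + y) = \<pi> x + (\<pi> y :: real)"
  shows "(real n + 1) * drift \<pi> (p n) x = - (24 * \<pi> x * p (Suc n) x)"
proof (induction n arbitrary: x)
  case 0
  have z: "\<pi> 0 = 0" using add[of 0 0] by simp
  have "(\<lambda>y. \<pi> y * p 0 y) = (\<lambda>y. 0)" by (auto simp: fun_eq_iff pt_mass_def z)
  then have "nbr (\<lambda>y. \<pi> y * p 0 y) x = 0" by (simp add: nbr_def)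
  then show ?case unfolding drift_weight[OF add] nbr_p by (simp del: walk.simps)
next
  case (Suc n)
  have "(\<lambda>y. \<pi> y * p (Suc n) y) = (\<lambda>y. (- (real n + 1) / 24) * drift \<pi> (p n) y)"
  proof (rule ext)
    fix y show "\<pi> y * p (Suc n) y = (- (real n + 1) / 24) * drift \<pi> (p n) y"
      using Suc.IH[of y] by (simp add: field_simps del: walk.simps)
  qed
  then have "nbr (\<lambda>y. \<pi> y * p (Suc n) y) x = (- (real n + 1) / 24) * drift \<pi> (nbr (p n)) x"
    by (simp only: nbr_cmult drift_nbr)
  also have "drift \<pi> (nbr (p n)) x = 24 * drift \<pi> (p (Suc n)) x"
    unfolding nbr_p drift_def by (simp add: sum_distrib_left mult.left_commute del: walk.simps)
  finally show ?case unfolding drift_weight[OF add] nbr_p by (simp add: algebra_simps del: walk.simps)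
qed

definition TT :: "nat \<Rightarrow> pt \<Rightarrow> real" where
  "TT N x = (\<Sum>n<N. (real n + 1) * p n x)"

definition gg :: "nat \<Rightarrow> pt \<Rightarrow> real" where
  "gg N x = (\<Sum>n<N. p n x)"

text \<open>A neighbour sum moves the time up by one, so the weight at time n becomes n instead of n
  + 1. The lost units add up to \<open>gg N\<close>, and the sum now reaches time \<open>N\<close>,
  which leaves the boundary term.\<close>

lemma TT_nbr: "nbr (TT N) x = 24 * (TT N x - gg N x + real N * p N x)"
proof -
  have "nbr (TT N) x = (\<Sum>n<N. (real n + 1) * nbr (p n) x)"
    unfolding TT_def nbr_def by (subst sum.swap) (simp add: sum_distrib_left)
  also have "\<dots> = 24 * (\<Sum>n<N. real (Suc n) * p (Suc n) x)"
    unfolding nbr_p sum_distrib_left by (rule sum.cong) (simp_all del: walk.simps)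
  also have "(\<Sum>n<N. real (Suc n) * p (Suc n) x) = (\<Sum>n<Suc N. real n * p n x)"
    by (subst sum.lessThan_Suc_shift) simp
  also have "\<dots> = TT N x - gg N x + real N * p N x"
    by (simp add: TT_def gg_def algebra_simps sum.distrib)
  finally show ?thesis .
qed

lemma TT_drift:
  assumes add: "\<And>x y. \<pi> (x + y) = \<pi> x + (\<pi> y :: real)"
  shows "drift \<pi> (TT N) x = - (24 * \<pi> x * (gg N x + p N x))"
proof -
  have z: "\<pi> 0 = 0" using add[of 0 0] by simp
  have "drift \<pi> (TT N) x = (\<Sum>n<N. (real n + 1) * drift \<pi> (p n) x)"
    unfolding TT_def drift_def sum_distrib_left by (subst sum.swap) (simp add: algebra_simps)
  also have "\<dots> = - (24 * \<pi> x * (\<Sum>n<N. p (Suc n) x))"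
    unfolding exchange[OF add] by (simp add: sum_negf sum_distrib_left del: walk.simps)
  \<comment> \<open>The term at time zero may be added: the mass sits at the origin, where the
    additive weight \<open>\<pi>\<close> vanishes.\<close>
  also have "24 * \<pi> x * (\<Sum>n<N. p (Suc n) x) = 24 * \<pi> x * (\<Sum>n<Suc N. p n x)"
    using z by (subst sum.lessThan_Suc_shift) (auto simp: pt_mass_def)
  finally show ?thesis by (simp add: gg_def)
qed

section \<open>Tabulated bounds for the Green function\<close>

fun get :: "'a \<Rightarrow> 'a list \<Rightarrow> nat \<Rightarrow> 'a" where
  "get z [] n = z"
| "get z (x # xs) 0 = x"
| "get z (x # xs) (Suc n) = get z xs n"

fun ins :: "int \<Rightarrow> int list \<Rightarrow> int list" where
  "ins x [] = [x]"
| "ins x (y # ys) = (if x \<ge> y then x # y # ys else y # ins x ys)"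

lemma ins_commute: "ins x (ins y zs) = ins y (ins x zs)"
  by (induction zs) auto

type_synonym table = "int list list list list"

definition entry :: "table \<Rightarrow> int \<Rightarrow> int \<Rightarrow> int \<Rightarrow> int \<Rightarrow> int" where
  "entry T a b c d =
     get 0 (get [] (get [] (get [] T (nat a)) (nat b)) (nat c)) (nat (d div 2))"

fun entry_list :: "table \<Rightarrow> int list \<Rightarrow> int" where
  "entry_list T [a, b, c, d] = entry T a b c d"
| "entry_list T _ = 0"

definition look4 :: "table \<Rightarrow> int \<Rightarrow> int \<Rightarrow> int \<Rightarrow> int \<Rightarrow> int" where
  "look4 T a b c d = entry_list T (ins \<bar>a\<bar> (ins \<bar>b\<bar> (ins \<bar>c\<bar> (ins \<bar>d\<bar> []))))"

definition nsum :: "(int \<Rightarrow> int \<Rightarrow> int \<Rightarrow> int \<Rightarrow> 'a)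
    \<Rightarrow> int \<Rightarrow> int \<Rightarrow> int \<Rightarrow> int \<Rightarrow> 'a::comm_monoid_add" where
  "nsum F a b c d =
     F (a+1) (b+1) c d + F (a+1) (b-1) c d + F (a-1) (b+1) c d + F (a-1) (b-1) c d
   + F (a+1) b (c+1) d + F (a+1) b (c-1) d + F (a-1) b (c+1) d + F (a-1) b (c-1) d
   + F (a+1) b c (d+1) + F (a+1) b c (d-1) + F (a-1) b c (d+1) + F (a-1) b c (d-1)
   + F a (b+1) (c+1) d + F a (b+1) (c-1) d + F a (b-1) (c+1) d + F a (b-1) (c-1) d
   + F a (b+1) c (d+1) + F a (b+1) c (d-1) + F a (b-1) c (d+1) + F a (b-1) c (d-1)
   + F a b (c+1) (d+1) + F a b (c+1) (d-1) + F a b (c-1) (d+1) + F a b (c-1) (d-1)"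

lemma nbr_nsum: "nbr f (a, b, c, d) = nsum (\<lambda>a b c d. f (a, b, c, d)) a b c d"
  unfolding nbr_def sum_roots nsum_def by simp

definition nrm :: "int \<Rightarrow> int \<Rightarrow> int \<Rightarrow> int \<Rightarrow> int" where
  "nrm a b c d = a * a + b * b + c * c + d * d"

definition even_pt :: "pt \<Rightarrow> bool" where
  "even_pt = (\<lambda>(a, b, c, d). even (a + b + c + d))"

text \<open>The tables hold \<open>10^10\<close> times a numerical solution, corrected so as to be a super- and a
  subsolution. An entry is addressed by the absolute values of the coordinates in decreasing order;
  the last index is halved since its parity is determined by the others. Beyond the tables the continuum limit of \<open>G\<close> is
  \<open>1 / (12 * pi\<^sup>2 * n)\<close>, about \<open>0.00844343 / n\<close>, at norm \<open>n\<close>: this is where the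
  two rational functions below come from.\<close>

definition tabh :: table where
  "tabh = [[[[460778957]]],
   [[],
    [[44112288],[20192978]]],
   [[[20192978]],
    [[],[14124227]],
    [[10865903],[8411161],[7038006,5263338]]],
   [[],
    [[8411161],[7038006]],
    [[],[6059860],[4694253]],
    [[4729674],[4235564],[3849257,3253673],[3024146,2354107]]],
   [[[5263338]],
    [[],[4694253]],
    [[4235564],[3849257],[3530021,3024146]],
    [[],[3262581],[2824893],[2493939,2231542]],
    [[2653297],[2495594],[2356790,2121058],[2020699],[1769451]]],
   [[],
    [[3253673],[3024146]],
    [[],[2824893],[2493939]],
    [[2495594],[2356790],[2233044,2020699],[1929479]],
    [[],[2021940],[1846231]]],
   [[[2354107]],
    [[],[2231542]],
    [[2121058],[2020699],[1929479,1769451]],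
    [[],[1846231]]]]"

definition tabl :: table where
  "tabl = [[[[460764050]]],
   [[],
    [[44097385],[20178081]]],
   [[[20178081]],
    [[],[14109335]],
    [[10851018],[8396278],[7023128,5248449]]],
   [[],
    [[8396278],[7023128]],
    [[],[6044991],[4679382]],
    [[4714834],[4220717],[3834409,3238765],[3009277,2338940]]],
   [[[5248449]],
    [[],[4679382]],
    [[4220717],[3834409],[3515180,3009277]],
    [[],[3247780],[2810067],[2479107,2216536]],
    [[2638591],[2480867],[2342024,2106204],[2005899,1683932],[1754810,1619236]]],
   [[],
    [[3238765],[3009277]],
    [[],[2810067],[2479107]],
    [[2480867],[2342024],[2218259,2005899],[1914710,1619236]],
    [[],[2007335],[1831628],[1684605,1559290],[1451611]],
    [[1685275],[1620024],[1559736,1451709],[1403186]]],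
   [[[2338940]],
    [[],[2216536]],
    [[2106204],[2005899],[1914710,1754810]],
    [[],[1831628],[1684605],[1559509,1451611]],
    [[1620024],[1559736],[1503795,1403186]]],
   [[],
    [[1683932],[1619236]],
    [[],[1559290],[1451611]],
    [[1451709],[1403186]]]]"

text \<open>\<open>426615000 / (5 * n + 1)\<close> is \<open>10^10 * k / (n + 1/5)\<close> for
  \<open>k = 85323 / 10^7\<close>. Integer division rounds down and adding one rounds up, so
  \<open>hlo\<close> and \<open>hup\<close> enclose the scaled supersolution. In the same way
  \<open>llo\<close> and \<open>lup\<close> enclose the subsolution, with shift -1/10 and
  \<open>k = 84033 / 10^7\<close>.\<close>

definition hlo :: "int \<Rightarrow> int \<Rightarrow> int \<Rightarrow> int \<Rightarrow> int" where
  "hlo a b c d = (let n = nrm a b c d in if n \<le> 48 then look4 tabh a b c d else 426615000 div (5 * n + 1))"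

definition hup :: "int \<Rightarrow> int \<Rightarrow> int \<Rightarrow> int \<Rightarrow> int" where
  "hup a b c d = (let n = nrm a b c d in if n \<le> 48 then look4 tabh a b c d else 426615000 div (5 * n + 1) + 1)"

definition llo :: "int \<Rightarrow> int \<Rightarrow> int \<Rightarrow> int \<Rightarrow> int" where
  "llo a b c d = (let n = nrm a b c d in if n \<le> 60 then look4 tabl a b c d else 840330000 div (10 * n - 1))"

definition lup :: "int \<Rightarrow> int \<Rightarrow> int \<Rightarrow> int \<Rightarrow> int" where
  "lup a b c d = (let n = nrm a b c d in if n \<le> 60 then look4 tabl a b c d else 840330000 div (10 * n - 1) + 1)"

definition sorted_all :: "(int \<Rightarrow> int \<Rightarrow> int \<Rightarrow> int \<Rightarrow> bool)
    \<Rightarrow> int \<Rightarrow> int \<Rightarrow> bool" where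
  "sorted_all P m N = list_all (\<lambda>a. list_all (\<lambda>b. list_all (\<lambda>c. list_all (\<lambda>d.
      N < nrm a b c d \<or> odd (a + b + c + d) \<or> P a b c d) [0..c]) [0..b]) [0..a]) [0..m]"

lemma sorted_allD:
  assumes "sorted_all P m N" "0 \<le> d" "d \<le> c" "c \<le> b" "b \<le> a" "nrm a b c d \<le> N"
    "even (a + b + c + d)" "N < (m + 1) * (m + 1)" "0 \<le> m"
  shows "P a b c d"
proof -
  have "a \<le> m"
  proof (rule ccontr)
    assume "\<not> a \<le> m"
    then have "(m + 1) * (m + 1) \<le> a * a" using assms by (intro mult_mono) auto
    moreover have "a * a \<le> nrm a b c d" by (simp add: nrm_def)
    ultimately show False using assms by linarith
  qed
  then have mem: "a \<in> set [0..m]" "b \<in> set [0..a]" "c \<in> set [0..b]" "d \<in> set [0..c]"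
    using assms(2-5) by simp_all
  have "N < nrm a b c d \<or> odd (a + b + c + d) \<or> P a b c d"
    using assms(1)[unfolded sorted_all_def list_all_iff, THEN bspec, OF mem(1), THEN bspec, OF mem(2),
      THEN bspec, OF mem(3), THEN bspec, OF mem(4)] .
  then show ?thesis using assms(6,7) by linarith
qed

text \<open>The value at the point is rounded down and those at the neighbours up, so the integer
  inequality implies the real one; \<open>a = 0\<close> singles out the origin among sorted points.
  A neighbour of a point of norm n has norm at least n + 2 - 2 sqrt(2 n). This exceeds 48 from the
  even norm 70 on, so the finite check must reach 68. For \<open>tabl\<close> the radius 60 leads to
  84 and 82.\<close>

lemma tabh_check:
  "sorted_all (\<lambda>a b c d. nsum hup a b c d + (if a = 0 then 10000000000 else 0) \<le> 24 * hlo a b c d) 8 68"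
  by code_simp

lemma tabl_check:
  "sorted_all (\<lambda>a b c d. 24 * lup a b c d \<le> nsum llo a b c d + (if a = 0 then 10000000000 else 0)) 9 82"
  by code_simp

definition gfun :: "table \<Rightarrow> int \<Rightarrow> real \<Rightarrow> real \<Rightarrow> pt \<Rightarrow> real" where
  "gfun T R k e = (\<lambda>(a, b, c, d). if odd (a + b + c + d) then 0
     else if nrm a b c d \<le> R then real_of_int (look4 T a b c d) / 10^10
     else k / (real_of_int (nrm a b c d) + e))"

lemma look4_sym:
  "look4 T b a c d = look4 T a b c d" "look4 T a c b d = look4 T a b c d"
  "look4 T a b d c = look4 T a b c d" "look4 T (- a) b c d = look4 T a b c d"
  unfolding look4_def by (auto simp: ins_commute)

lemma gfun_sym:
  "gfun T R k e (swap12 x) = gfun T R k e x" "gfun T R k e (swap23 x) = gfun T R k e x"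
  "gfun T R k e (swap34 x) = gfun T R k e x" "gfun T R k e (neg1 x) = gfun T R k e x"
proof -
  obtain a b c d where x: "x = (a, b, c, d)" by (cases x)
  have e: "b + a + c + d = a + b + c + d" "a + c + b + d = a + b + c + d" "a + b + d + c = a + b + c + d"
    by simp_all
  have o: "odd (- a + b + c + d) \<longleftrightarrow> odd (a + b + c + d)" by presburger
  have n: "nrm b a c d = nrm a b c d" "nrm a c b d = nrm a b c d" "nrm a b d c = nrm a b c d"
    "nrm (- a) b c d = nrm a b c d"
    by (simp_all add: nrm_def)
  show "gfun T R k e (swap12 x) = gfun T R k e x"
    by (simp only: x gfun_def swap12_def look4_sym(1)[of T a b] n e prod.case)
  show "gfun T R k e (swap23 x) = gfun T R k e x"
    by (simp only: x gfun_def swap23_def look4_sym(2)[of T a b c] n e prod.case)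
  show "gfun T R k e (swap34 x) = gfun T R k e x"
    by (simp only: x gfun_def swap34_def look4_sym(3)[of T a b c d] n e prod.case)
  show "gfun T R k e (neg1 x) = gfun T R k e x"
    by (simp only: x gfun_def neg1_def look4_sym(4)[of T a b c d] n o prod.case)
qed

text \<open>The relation \<open>R\<close> is left open so that one reduction to sorted points serves
  both the super- and the subsolution.\<close>

lemma lap_fundamental:
  assumes f: "\<And>x. f (swap12 x) = f x" "\<And>x. f (swap23 x) = f x" "\<And>x. f (swap34 x) = f x"
      "\<And>x. f (neg1 x) = f x"
    and Q: "\<And>x. sorted4 x \<Longrightarrow> R (lap f x) (pt_mass 0 x)"
  shows "R (lap f x) (pt_mass 0 x)"
proof (rule fundamental_domain[of "\<lambda>x. R (lap f x) (pt_mass 0 x)"])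
  show "R (lap f (swap12 x)) (pt_mass 0 (swap12 x)) \<Longrightarrow> R (lap f x) (pt_mass 0 x)" for x
    using swap12.p_sym[of 0 x] by (simp add: swap12.lap_sym f)
  show "R (lap f (swap23 x)) (pt_mass 0 (swap23 x)) \<Longrightarrow> R (lap f x) (pt_mass 0 x)" for x
    using swap23.p_sym[of 0 x] by (simp add: swap23.lap_sym f)
  show "R (lap f (swap34 x)) (pt_mass 0 (swap34 x)) \<Longrightarrow> R (lap f x) (pt_mass 0 x)" for x
    using swap34.p_sym[of 0 x] by (simp add: swap34.lap_sym f)
  show "R (lap f (neg1 x)) (pt_mass 0 (neg1 x)) \<Longrightarrow> R (lap f x) (pt_mass 0 x)" for x
    using neg1.p_sym[of 0 x] by (simp add: neg1.lap_sym f)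
qed (rule Q)

section \<open>Moments of the root system and radial comparison functions far from the
  origin\<close>

definition dot :: "pt \<Rightarrow> pt \<Rightarrow> int" where
  "dot = (\<lambda>(a, b, c, d) (a', b', c', d'). a * a' + b * b' + c * c' + d * d')"

definition nr :: "pt \<Rightarrow> int" where
  "nr x = dot x x"

lemma nr_nrm: "nr (a, b, c, d) = nrm a b c d"
  by (simp add: nr_def dot_def nrm_def)

lemma nr_add: "nr (x + y) = nr x + 2 * dot x y + nr y"
  by (cases x; cases y) (simp add: nr_def dot_def algebra_simps)

lemma nr_root: "u \<in> roots \<Longrightarrow> nr u = 2"
  by (auto simp: roots_def nr_def dot_def power2_eq_square)

lemma dot_uminus: "dot x (- u) = - dot x u"
  by (cases x; cases u) (simp add: dot_def)

lemma dot_root_le: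
  assumes "u \<in> roots" shows "(dot x u)\<^sup>2 \<le> 2 * nr x"
proof -
  obtain a b c d p q r s where x: "x = (a, b, c, d)" and u: "u = (p, q, r, s)"
    by (cases x; cases u)
  have "nr x * nr u - (dot x u)\<^sup>2 = (a * q - b * p)\<^sup>2 + (a * r - c * p)\<^sup>2 + (a * s - d * p)\<^sup>2
      + (b * r - c * q)\<^sup>2 + (b * s - d * q)\<^sup>2 + (c * s - d * r)\<^sup>2"
    unfolding x u nr_def dot_def prod.case power2_eq_square by algebra
  then have "0 \<le> nr x * nr u - (dot x u)\<^sup>2" by simp
  then show ?thesis using nr_root[OF assms] by simp
qed

text \<open>The second and fourth moments of the roots depend on the norm of \<open>x\<close> alone,
  because the 24 roots form a spherical design of strength five. This is what makes radial functions
  adequate far out.\<close>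

lemma sum_dot2: "(\<Sum>u\<in>roots. (dot x u)\<^sup>2) = 12 * nr x"
  by (cases x) (simp add: sum_roots dot_def nr_def power2_eq_square algebra_simps)

lemma sum_dot4: "(\<Sum>u\<in>roots. (dot x u)^4) = 12 * (nr x)\<^sup>2"
  by (cases x) (simp add: sum_roots dot_def nr_def power4_eq_xxxx power2_eq_square algebra_simps)

text \<open>The sixth moment is no longer radial. The bound is Cauchy-Schwarz applied to the second,
  fourth and sixth moments, written as an expanded square with the optimal constant
  \<open>nr x\<close>; equality holds for example at \<open>(2, 0, 0, 0)\<close>.\<close>

lemma sum_dot6: "12 * (nr x)^3 \<le> (\<Sum>u\<in>roots. (dot x u)^6)"
proof -
  have "0 \<le> (\<Sum>u\<in>roots. (dot x u)\<^sup>2 * ((dot x u)\<^sup>2 - nr x)\<^sup>2)"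
    by (intro sum_nonneg) simp
  also have "\<dots> = (\<Sum>u\<in>roots. (dot x u)^6 - 2 * nr x * (dot x u)^4 + (nr x)\<^sup>2 * (dot x u)\<^sup>2)"
    by (intro sum.cong) (simp_all add: power2_eq_square power4_eq_xxxx eval_nat_numeral algebra_simps)
  also have "\<dots> = (\<Sum>u\<in>roots. (dot x u)^6) - 2 * nr x * (\<Sum>u\<in>roots. (dot x u)^4)
      + (nr x)\<^sup>2 * (\<Sum>u\<in>roots. (dot x u)\<^sup>2)"
    by (simp only: sum.distrib sum_subtractf sum_distrib_left)
  also have "\<dots> = (\<Sum>u\<in>roots. (dot x u)^6) - 12 * (nr x)^3"
    unfolding sum_dot2 sum_dot4 by (simp add: power2_eq_square power3_eq_cube)
  finally show ?thesis by simp
qed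

lemma even_pt_add:
  assumes "u \<in> roots" shows "even_pt (x + u) \<longleftrightarrow> even_pt x"
proof -
  obtain a b c d p q r s where x: "x = (a, b, c, d)" and u: "u = (p, q, r, s)"
    by (cases x; cases u)
  have "even (p + q + r + s)" using assms unfolding u roots_eq root_list_def by auto
  then show ?thesis unfolding x u even_pt_def by simp presburger
qed

lemma even_nr: "even (nr x) \<longleftrightarrow> even_pt x"
  by (cases x) (simp add: nr_nrm nrm_def even_pt_def)

text \<open>Adding the terms of opposite roots cancels the odd powers and leaves a geometric series
  in \<open>4 * t^2 / s^2\<close>. For the upper bound everything from the second power on is kept
  as an exact remainder and bounded through \<open>4 * t^2 \<le> 8 * n\<close>; for the lower bound
  the series is cut after the third power.\<close>

lemma recip_pair:
  fixes s n t :: real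
  assumes "4 * t\<^sup>2 \<le> 8 * n" "8 * n < s\<^sup>2" "0 < s"
  shows "1 / (s + 2 * t) + 1 / (s - 2 * t) \<le> 2 / s * (1 + 4 * t\<^sup>2 / s\<^sup>2 + 16 * t^4 / (s\<^sup>2 * (s\<^sup>2 - 8 * n)))"
    and "2 / s * (1 + 4 * t\<^sup>2 / s\<^sup>2 + 16 * t^4 / s^4 + 64 * t^6 / s^6) \<le> 1 / (s + 2 * t) + 1 / (s - 2 * t)"
proof -
  define q where "q = 4 * t\<^sup>2"
  have q: "0 \<le> q" "q \<le> 8 * n" by (use assms in \<open>auto simp: q_def\<close>)
  have D: "0 < s\<^sup>2 - q" using assms q by simp
  have st: "s\<^sup>2 - q = (s + 2 * t) * (s - 2 * t)" by (simp add: q_def power2_eq_square algebra_simps)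
  then have nz: "s + 2 * t \<noteq> 0" "s - 2 * t \<noteq> 0" using D by auto
  have "1 / (s + 2 * t) + 1 / (s - 2 * t) = 2 * s / (s\<^sup>2 - q)"
    unfolding st using nz by (simp add: field_simps)
  also have "\<dots> = 2 / s * (s\<^sup>2 / (s\<^sup>2 - q))"
    using assms(3) by (simp add: power2_eq_square)
  finally have eq: "1 / (s + 2 * t) + 1 / (s - 2 * t) = 2 / s * (s\<^sup>2 / (s\<^sup>2 - q))" .
  have e1: "s\<^sup>2 / (s\<^sup>2 - q) = 1 + q / s\<^sup>2 + q\<^sup>2 / (s\<^sup>2 * (s\<^sup>2 - q))"
  proof -
    have gen: "S / (S - q) = 1 + q / S + q\<^sup>2 / (S * (S - q))" if "S \<noteq> 0" "S - q \<noteq> 0" for S :: real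
      using that by (simp add: divide_simps) algebra
    show ?thesis by (rule gen) (use D assms(3) in auto)
  qed
  have "q\<^sup>2 / (s\<^sup>2 * (s\<^sup>2 - q)) \<le> q\<^sup>2 / (s\<^sup>2 * (s\<^sup>2 - 8 * n))"
    using q assms D by (intro divide_left_mono mult_left_mono mult_pos_pos) auto
  then have "s\<^sup>2 / (s\<^sup>2 - q) \<le> 1 + q / s\<^sup>2 + q\<^sup>2 / (s\<^sup>2 * (s\<^sup>2 - 8 * n))" using e1 by simp
  then have "2 / s * (s\<^sup>2 / (s\<^sup>2 - q)) \<le> 2 / s * (1 + q / s\<^sup>2 + q\<^sup>2 / (s\<^sup>2 * (s\<^sup>2 - 8 * n)))"
    using assms(3) by (intro mult_left_mono) auto
  then show "1 / (s + 2 * t) + 1 / (s - 2 * t) \<le> 2 / s * (1 + 4 * t\<^sup>2 / s\<^sup>2 + 16 * t^4 / (s\<^sup>2 * (s\<^sup>2 - 8 * n)))"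
    unfolding eq by (simp add: q_def power_mult_distrib flip: power_mult)
  define z where "z = q / s\<^sup>2"
  have z: "0 \<le> z" "z < 1" using q D assms(3) by (auto simp: z_def)
  have "1 + z + z\<^sup>2 + z^3 \<le> 1 / (1 - z)"
  proof -
    have "(1 + z + z\<^sup>2 + z^3) * (1 - z) = 1 - z^4" by (simp add: power2_eq_square eval_nat_numeral algebra_simps)
    also have "\<dots> \<le> 1" using z by simp
    finally show ?thesis using z by (simp add: pos_le_divide_eq)
  qed
  also have "1 / (1 - z) = s\<^sup>2 / (s\<^sup>2 - q)"
    using D assms(3) by (simp add: z_def field_simps)
  finally have "2 / s * (1 + z + z\<^sup>2 + z^3) \<le> 2 / s * (s\<^sup>2 / (s\<^sup>2 - q))"
    using assms(3) by (intro mult_left_mono) auto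
  moreover have "z\<^sup>2 = 16 * t^4 / s^4" "z^3 = 64 * t^6 / s^6"
    by (simp_all add: z_def q_def power_divide power_mult_distrib flip: power_mult)
  ultimately show "2 / s * (1 + 4 * t\<^sup>2 / s\<^sup>2 + 16 * t^4 / s^4 + 64 * t^6 / s^6) \<le> 1 / (s + 2 * t) + 1 / (s - 2 * t)"
    unfolding eq by (simp add: z_def q_def)
qed

lemma sum_roots_pair:
  fixes F :: "pt \<Rightarrow> real"
  shows "(\<Sum>u\<in>roots. F u) = (\<Sum>u\<in>roots. F u + F (- u)) / 2"
  using sum_roots_uminus[of F] by (simp add: sum.distrib)

lemma sum_recip:
  fixes s :: real and x :: pt
  defines "n \<equiv> real_of_int (nr x)"
  assumes s: "8 * n < s\<^sup>2" "0 < s"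
  shows "(\<Sum>u\<in>roots. 1 / (s + 2 * of_int (dot x u)))
      \<le> (1 / s) * (24 + 48 * n / s\<^sup>2 + 192 * n\<^sup>2 / (s\<^sup>2 * (s\<^sup>2 - 8 * n)))"
    and "(1 / s) * (24 + 48 * n / s\<^sup>2 + 192 * n\<^sup>2 / s^4 + 768 * n^3 / s^6)
      \<le> (\<Sum>u\<in>roots. 1 / (s + 2 * of_int (dot x u)))"
proof -
  let ?t = "\<lambda>u. real_of_int (dot x u)"
  have t: "4 * (?t u)\<^sup>2 \<le> 8 * n" if "u \<in> roots" for u
  proof -
    have "real_of_int ((dot x u)\<^sup>2) \<le> real_of_int (2 * nr x)"
      using dot_root_le[OF that, of x] by (rule of_int_le_iff[THEN iffD2])
    then show ?thesis by (simp add: n_def)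
  qed
  have s2: "(\<Sum>u\<in>roots. (?t u)\<^sup>2) = 12 * n"
    using arg_cong[OF sum_dot2[of x], of real_of_int] by (simp add: n_def)
  have s4: "(\<Sum>u\<in>roots. (?t u)^4) = 12 * n\<^sup>2"
    using arg_cong[OF sum_dot4[of x], of real_of_int] by (simp add: n_def)
  have s6: "12 * n^3 \<le> (\<Sum>u\<in>roots. (?t u)^6)"
    using of_int_le_iff[where 'a = real, THEN iffD2, OF sum_dot6[of x]] by (simp add: n_def)
  have pair: "(\<Sum>u\<in>roots. 1 / (s + 2 * ?t u)) = (\<Sum>u\<in>roots. 1 / (s + 2 * ?t u) + 1 / (s - 2 * ?t u)) / 2"
    by (subst sum_roots_pair) (simp add: dot_uminus)
  have "(\<Sum>u\<in>roots. 1 / (s + 2 * ?t u) + 1 / (s - 2 * ?t u))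
      \<le> (\<Sum>u\<in>roots. 2 / s * (1 + 4 * (?t u)\<^sup>2 / s\<^sup>2 + 16 * (?t u)^4 / (s\<^sup>2 * (s\<^sup>2 - 8 * n))))"
    by (intro sum_mono recip_pair t s)
  also have "\<dots> = 2 / s * (24 + 4 * (\<Sum>u\<in>roots. (?t u)\<^sup>2) / s\<^sup>2
      + 16 * (\<Sum>u\<in>roots. (?t u)^4) / (s\<^sup>2 * (s\<^sup>2 - 8 * n)))"
    by (simp add: sum.distrib card_roots flip: sum_distrib_left sum_divide_distrib)
  also have "\<dots> = 2 * ((1 / s) * (24 + 48 * n / s\<^sup>2 + 192 * n\<^sup>2 / (s\<^sup>2 * (s\<^sup>2 - 8 * n))))"
    unfolding s2 s4 by simp
  finally show "(\<Sum>u\<in>roots. 1 / (s + 2 * ?t u))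
      \<le> (1 / s) * (24 + 48 * n / s\<^sup>2 + 192 * n\<^sup>2 / (s\<^sup>2 * (s\<^sup>2 - 8 * n)))"
    unfolding pair by simp
  have "2 * ((1 / s) * (24 + 48 * n / s\<^sup>2 + 192 * n\<^sup>2 / s^4 + 768 * n^3 / s^6))
     \<le> 2 / s * (24 + 4 * (\<Sum>u\<in>roots. (?t u)\<^sup>2) / s\<^sup>2 + 16 * (\<Sum>u\<in>roots. (?t u)^4) / s^4
      + 64 * (\<Sum>u\<in>roots. (?t u)^6) / s^6)"
  proof -
    have "768 * n^3 / s^6 \<le> 64 * (\<Sum>u\<in>roots. (?t u)^6) / s^6"
      using s6 s(2) by (intro divide_right_mono) auto
    then have "24 + 48 * n / s\<^sup>2 + 192 * n\<^sup>2 / s^4 + 768 * n^3 / s^6 \<le>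
      24 + 4 * (\<Sum>u\<in>roots. (?t u)\<^sup>2) / s\<^sup>2 + 16 * (\<Sum>u\<in>roots. (?t u)^4) / s^4
      + 64 * (\<Sum>u\<in>roots. (?t u)^6) / s^6"
      unfolding s2 s4 by simp
    from mult_left_mono[OF this, of "2 / s"] show ?thesis using s(2) by simp
  qed
  also have "\<dots> = (\<Sum>u\<in>roots. 2 / s * (1 + 4 * (?t u)\<^sup>2 / s\<^sup>2 + 16 * (?t u)^4 / s^4 + 64 * (?t u)^6 / s^6))"
    by (simp add: sum.distrib card_roots flip: sum_distrib_left sum_divide_distrib)
  also have "\<dots> \<le> (\<Sum>u\<in>roots. 1 / (s + 2 * ?t u) + 1 / (s - 2 * ?t u))"
    by (intro sum_mono recip_pair(2)[where n = n] t s)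
  finally show "(1 / s) * (24 + 48 * n / s\<^sup>2 + 192 * n\<^sup>2 / s^4 + 768 * n^3 / s^6)
      \<le> (\<Sum>u\<in>roots. 1 / (s + 2 * ?t u))"
    unfolding pair by simp
qed

lemma frac_le_24:
  fixes N M C :: real
  assumes "C * N \<le> M" "0 < M" "0 < C"
  shows "24 * N / M \<le> 24 / C"
proof -
  have "N / M \<le> 1 / C"
    unfolding pos_divide_le_eq[OF assms(2)] times_divide_eq_left pos_le_divide_eq[OF assms(3)]
    using assms(1) by (simp add: mult.commute)
  then show ?thesis by simp
qed

lemma frac_ge_24:
  fixes N M C :: real
  assumes "M \<le> C * N" "0 < M" "0 < C"
  shows "24 / C \<le> 24 * N / M"
proof -
  have "1 / C \<le> N / M"
    unfolding pos_le_divide_eq[OF assms(2)] times_divide_eq_left pos_divide_le_eq[OF assms(3)]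
    using assms(1) by (simp add: mult.commute)
  then show ?thesis by simp
qed

text \<open>For \<open>s = n + 2 + e\<close>, the expansion summed over the roots minus
  \<open>24 / (s - 2)\<close> is \<open>- 48 * e / s^3\<close> up to higher order in
  \<open>1 / s\<close>. So the sign of the shift decides: \<open>e = 1/5\<close> gives a
  supersolution, and \<open>e = - 1/10\<close> in \<open>far_lower\<close> a subsolution.\<close>

lemma far_upper:
  fixes s n :: real
  assumes "n \<ge> 70" "s = n + 11/5"
  shows "(1 / s) * (24 + 48 * n / s\<^sup>2 + 192 * n\<^sup>2 / (s\<^sup>2 * (s\<^sup>2 - 8 * n))) \<le> 24 / (s - 2)"
proof -
  define y where "y = n - 70"
  have y: "y \<ge> 0" "n = 70 + y" "s = 361/5 + y" using assms by (auto simp: y_def)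
  define w where "w = s\<^sup>2 - 8 * n"
  have wy: "w = (361/5)\<^sup>2 - 560 + (722/5 - 8) * y + y\<^sup>2"
    unfolding w_def y(2,3) by (simp add: power2_eq_square algebra_simps)
  have w: "w > 0" unfolding wy using y(1) by (simp add: power2_eq_square add_pos_nonneg)
  have s: "s > 2" using y by simp
  have "s * s\<^sup>2 * w - (s - 2) * (s\<^sup>2 * w + 2 * n * w + 8 * n\<^sup>2)
      = (18168382/625) + (347926/125) * y + (1546/25) * y\<^sup>2 + (2/5) * y^3"
    unfolding wy unfolding y(2,3) by (simp add: power2_eq_square power3_eq_cube) algebra
  then have key: "(s - 2) * (s\<^sup>2 * w + 2 * n * w + 8 * n\<^sup>2) \<le> s * s\<^sup>2 * w"
    using y(1) by (smt (verit) mult_nonneg_nonneg zero_le_power divide_nonneg_nonneg)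
  have "(1 / s) * (24 + 48 * n / s\<^sup>2 + 192 * n\<^sup>2 / (s\<^sup>2 * w))
      = 24 * (s\<^sup>2 * w + 2 * n * w + 8 * n\<^sup>2) / (s * s\<^sup>2 * w)"
    using s w by (simp add: field_simps power2_eq_square)
  also have "\<dots> \<le> 24 / (s - 2)"
    by (rule frac_le_24[OF key]) (use s w in auto)
  finally show ?thesis by (simp add: w_def)
qed

lemma far_lower:
  fixes s n :: real
  assumes "n \<ge> 84" "s = n + 19/10"
  shows "24 / (s - 2) \<le> (1 / s) * (24 + 48 * n / s\<^sup>2 + 192 * n\<^sup>2 / s^4 + 768 * n^3 / s^6)"
proof -
  define y where "y = n - 84"
  have y: "y \<ge> 0" "n = 84 + y" "s = 859/10 + y" using assms by (auto simp: y_def)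
  have s: "s > 2" using y by simp
  have "(s - 2) * (s^6 + 2 * n * s^4 + 8 * n\<^sup>2 * s\<^sup>2 + 32 * n^3) \<ge> s * s^6"
  proof -
    \<comment> \<open>The witnesses are the coefficients of the difference expanded at
      \<open>n = 84\<close>; the inequality is just their nonnegativity.\<close>
    have "\<exists>c0 c1 c2 c3 c4 c5. 0 \<le> c0 \<and> 0 \<le> c1 \<and> 0 \<le> c2 \<and> 0 \<le> c3 \<and>
        0 \<le> c4 \<and> 0 \<le> c5 \<and>
       (s - 2) * (s^6 + 2 * n * s^4 + 8 * n\<^sup>2 * s\<^sup>2 + 32 * n^3) - s * s^6
       = c0 + c1 * y + c2 * y^2 + c3 * y^3 + c4 * y^4 + c5 * y^5"
      by (rule exI[of _ "(235283817113519/500000)"], rule exI[of _ "(338485495897/10000)"], rule exI[of _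
          "(463445483/500)"], rule exI[of _ "(613221/50)"], rule exI[of _ "(791/10)"], rule exI[of _ "(1/5)"])
        (simp add: y(2,3) field_simps eval_nat_numeral)
    then show ?thesis using y(1)
      by (smt (verit) mult_nonneg_nonneg zero_le_power)
  qed
  then have "24 / (s - 2) \<le> 24 * (s^6 + 2 * n * s^4 + 8 * n\<^sup>2 * s\<^sup>2 + 32 * n^3) / (s * s^6)"
    by (rule frac_ge_24) (use s in auto)
  also have "\<dots> = (1 / s) * (24 + 48 * n / s\<^sup>2 + 192 * n\<^sup>2 / s^4 + 768 * n^3 / s^6)"
    using s by (simp add: field_simps eval_nat_numeral)
  finally show ?thesis .
qed

abbreviation h :: "pt \<Rightarrow> real" where
  "h \<equiv> gfun tabh 48 (85323 / 10^7) (1/5)"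

abbreviation l :: "pt \<Rightarrow> real" where
  "l \<equiv> gfun tabl 60 (84033 / 10^7) (- (1/10))"

lemma gfun_odd: "\<not> even_pt x \<Longrightarrow> gfun T R k e x = 0"
  by (cases x) (simp add: gfun_def even_pt_def)

lemma gfun_far: "even_pt x \<Longrightarrow> nr x > R \<Longrightarrow> gfun T R k e x = k / (real_of_int (nr x) + e)"
  by (cases x) (simp add: gfun_def even_pt_def nr_nrm)

lemma lap_odd: "\<not> even_pt x \<Longrightarrow> lap (gfun T R k e) x = 0"
  unfolding lap_def nbr_def by (simp add: gfun_odd even_pt_add)

lemma pt_mass_odd: "\<not> even_pt x \<Longrightarrow> pt_mass 0 x = 0"
  by (auto simp: pt_mass_def even_pt_def zero_prod_def)

text \<open>The quadratic hypothesis says n + 2 - 2 sqrt(2 n) > R. By \<open>dot_root_le\<close>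
  this forces every neighbour outside the table, where the closed formula applies.\<close>

lemma nbr_far:
  assumes ev: "even_pt x" and R: "(real_of_int (nr x) - 2 * (R / 2 - 1))\<^sup>2 > 8 * real_of_int (nr x)"
    "real_of_int (nr x) > R" and R': "real_of_int R' = R"
  shows "nbr (gfun T R' k e) x
    = k * (\<Sum>u\<in>roots. 1 / (real_of_int (nr x) + 2 + e + 2 * of_int (dot x u)))"
proof -
  have "gfun T R' k e (x + u) = k * (1 / (real_of_int (nr x) + 2 + e + 2 * of_int (dot x u)))"
    if u: "u \<in> roots" for u
  proof -
    have nx: "nr (x + u) = nr x + 2 * dot x u + 2" by (simp add: nr_add nr_root[OF u])
    have "R' < nr (x + u)"
    proof (rule ccontr)
      assume "\<not> R' < nr (x + u)"
      then have "real_of_int (nr x + 2 * dot x u + 2) \<le> R" unfolding nx R'[symmetric] by simp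
      then have le: "0 \<le> real_of_int (nr x) - 2 * (R / 2 - 1)" "real_of_int (nr x) - 2 * (R / 2 - 1)
          \<le> - (2 * real_of_int (dot x u))"
        using R(2) by auto
      then have "(real_of_int (nr x) - 2 * (R / 2 - 1))\<^sup>2 \<le> (- (2 * real_of_int (dot x u)))\<^sup>2"
        by (intro power_mono)
      also have "\<dots> = real_of_int (4 * (dot x u)\<^sup>2)" by (simp add: power_mult_distrib)
      also have "\<dots> \<le> real_of_int (4 * (2 * nr x))"
        using dot_root_le[OF u, of x] by (intro of_int_le_iff[THEN iffD2] mult_left_mono) auto
      finally show False using R(1) by simp
    qed
    moreover have "even_pt (x + u)" using ev by (simp add: even_pt_add[OF u])
    ultimately have "gfun T R' k e (x + u) = k / (real_of_int (nr (x + u)) + e)"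
      by (intro gfun_far)
    also have "real_of_int (nr (x + u)) + e = real_of_int (nr x) + 2 + e + 2 * of_int (dot x u)"
      by (simp add: nx)
    finally show ?thesis by simp
  qed
  then show ?thesis unfolding nbr_def sum_distrib_left by (intro sum.cong) auto
qed

lemma swap24: "c * (24 / d) = 24 * (c / (d::real))"
  by simp

lemma h_far:
  assumes "even_pt x" "nr x \<ge> 70" shows "0 \<le> lap h x"
proof -
  define n where "n = real_of_int (nr x)"
  have n: "n \<ge> 70" using assms(2) by (simp add: n_def)
  then obtain y where y: "n = 70 + y" "y \<ge> 0" by (metis add.commute diff_add_cancel diff_ge_0_iff_ge)
  have yy: "0 \<le> y * y" using y by simp
  have "(n - 46)\<^sup>2 - 8 * n = y * y + 40 * y + 16" unfolding y(1) by (simp add: power2_eq_square algebra_simps)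
  then have q: "8 * n < (n - 46)\<^sup>2" using yy y(2) by linarith
  have far: "nbr h x = 85323 / 10^7 * (\<Sum>u\<in>roots. 1 / (n + 2 + 1/5 + 2 * of_int (dot x u)))"
    unfolding n_def by (rule nbr_far[where R = 48])
      (use assms n q in \<open>simp_all flip: n_def\<close>)
  have "(n + 11/5)\<^sup>2 = y * y + 722/5 * y + 130321/25"
    unfolding y(1) by (simp add: power2_eq_square algebra_simps)
  then have s: "8 * n < (n + 11/5)\<^sup>2" "0 < n + 11/5"
    using y yy by linarith+
  have "(\<Sum>u\<in>roots. 1 / (n + 11/5 + 2 * of_int (dot x u))) \<le> 24 / (n + 11/5 - 2)"
    using sum_recip(1)[of x "n + 11/5"] far_upper[OF n refl] s by (simp flip: n_def)
  then have "nbr h x \<le> 85323 / 10^7 * (24 / (n + 1/5))"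
    unfolding far by (intro mult_left_mono) (auto simp: algebra_simps)
  also have "\<dots> = 24 * (85323 / 10^7 / (n + 1/5))" by (rule swap24)
  also have "85323 / 10^7 / (n + 1/5) = h x"
    unfolding n_def by (rule gfun_far[symmetric]) (use assms in auto)
  finally show ?thesis by (simp add: lap_def)
qed

lemma l_far:
  assumes "even_pt x" "nr x \<ge> 84" shows "lap l x \<le> 0"
proof -
  define n where "n = real_of_int (nr x)"
  have n: "n \<ge> 84" using assms(2) by (simp add: n_def)
  then obtain y where y: "n = 84 + y" "y \<ge> 0" by (metis add.commute diff_add_cancel diff_ge_0_iff_ge)
  have yy: "0 \<le> y * y" using y by simp
  have "(n - 58)\<^sup>2 - 8 * n = y * y + 44 * y + 4" unfolding y(1) by (simp add: power2_eq_square algebra_simps)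
  then have q: "8 * n < (n - 58)\<^sup>2" using yy y(2) by linarith
  have far: "nbr l x = 84033 / 10^7 * (\<Sum>u\<in>roots. 1 / (n + 2 + - (1/10) + 2 * of_int (dot x u)))"
    unfolding n_def by (rule nbr_far[where R = 60])
      (use assms n q in \<open>simp_all flip: n_def\<close>)
  have "(n + 19/10)\<^sup>2 = y * y + 859/5 * y + 737881/100"
    unfolding y(1) by (simp add: power2_eq_square algebra_simps)
  then have s: "8 * n < (n + 19/10)\<^sup>2" "0 < n + 19/10"
    using y yy by linarith+
  have "24 / (n + 19/10 - 2) \<le> (\<Sum>u\<in>roots. 1 / (n + 19/10 + 2 * of_int (dot x u)))"
    using sum_recip(2)[of x "n + 19/10"] far_lower[OF n refl] s by (simp flip: n_def)
  then have "84033 / 10^7 * (24 / (n - 1/10)) \<le> nbr l x"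
    unfolding far by (intro mult_left_mono) (auto simp: algebra_simps)
  moreover have "l x = 84033 / 10^7 / (n + - (1/10))"
    unfolding n_def by (rule gfun_far) (use assms in auto)
  then have "84033 / 10^7 * (24 / (n - 1/10)) = 24 * l x"
    using swap24[of "84033 / 10^7" "n - 1/10"] by simp
  ultimately show ?thesis by (simp add: lap_def)
qed

section \<open>From the integer checks to super- and subsolutions on the whole lattice\<close>

lemma int_div_bounds:
  fixes a b :: int assumes "0 < b"
  shows "real_of_int (a div b) \<le> real_of_int a / real_of_int b"
    and "real_of_int a / real_of_int b \<le> real_of_int (a div b + 1)"
  using floor_correct[of "real_of_int a / real_of_int b"]
  by (simp_all add: floor_divide_of_int_eq)

lemma h_bounds:
  assumes "even (a + b + c + d)"
  shows "real_of_int (hlo a b c d) \<le> 10^10 * h (a, b, c, d)"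
    and "10^10 * h (a, b, c, d) \<le> real_of_int (hup a b c d)"
proof -
  have n: "0 \<le> nrm a b c d" by (simp add: nrm_def)
  have eq: "10^10 * (85323 / 10^7 / (real_of_int (nrm a b c d) + 1/5))
    = real_of_int 426615000 / real_of_int (5 * nrm a b c d + 1)"
    using n by (simp add: field_simps)
  have b: "0 < 5 * nrm a b c d + 1" using n by simp
  show "real_of_int (hlo a b c d) \<le> 10^10 * h (a, b, c, d)"
    using int_div_bounds(1)[OF b, of 426615000] assms eq by (auto simp: hlo_def Let_def gfun_def)
  show "10^10 * h (a, b, c, d) \<le> real_of_int (hup a b c d)"
    using int_div_bounds(2)[OF b, of 426615000] assms eq by (auto simp: hup_def Let_def gfun_def)
qed

lemma l_bounds:
  assumes "even (a + b + c + d)"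
  shows "real_of_int (llo a b c d) \<le> 10^10 * l (a, b, c, d)"
    and "10^10 * l (a, b, c, d) \<le> real_of_int (lup a b c d)"
proof -
  have eq: "10^10 * (84033 / 10^7 / (real_of_int (nrm a b c d) + - (1/10)))
    = real_of_int 840330000 / real_of_int (10 * nrm a b c d - 1)" if "nrm a b c d > 60"
    using that by (simp add: field_simps)
  have b: "0 < 10 * nrm a b c d - 1" if "nrm a b c d > 60" using that by simp
  show "real_of_int (llo a b c d) \<le> 10^10 * l (a, b, c, d)"
    using int_div_bounds(1)[OF b, of 840330000] assms eq by (auto simp: llo_def Let_def gfun_def)
  show "10^10 * l (a, b, c, d) \<le> real_of_int (lup a b c d)"
    using int_div_bounds(2)[OF b, of 840330000] assms eq by (auto simp: lup_def Let_def gfun_def)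
qed

lemma nsum_mono:
  fixes F :: "int \<Rightarrow> int \<Rightarrow> int \<Rightarrow> int \<Rightarrow> real"
  assumes "\<And>a b c d. even (a + b + c + d) \<Longrightarrow> F a b c d \<le> G a b c d" "even (a + b + c + d)"
  shows "nsum F a b c d \<le> nsum G a b c d"
  unfolding nsum_def by (intro add_mono assms(1)) (use assms(2) in presburger)+

lemma nsum_of_int: "nsum (\<lambda>a b c d. real_of_int (F a b c d)) a b c d = real_of_int (nsum F a b c d)"
  by (simp add: nsum_def)

lemma nsum_cmult: "nsum (\<lambda>a b c d. r * F a b c d) a b c d = (r::real) * nsum F a b c d"
  by (simp add: nsum_def algebra_simps)

lemma h_near:
  assumes "sorted4 x" "even_pt x" "nr x < 70" shows "pt_mass 0 x \<le> lap h x"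
proof -
  obtain a b c d where x: "x = (a, b, c, d)" by (cases x)
  have o: "0 \<le> d" "d \<le> c" "c \<le> b" "b \<le> a" using assms(1) by (auto simp: x sorted4_def)
  have ev: "even (a + b + c + d)" using assms(2) by (simp add: x even_pt_def)
  have n: "nrm a b c d \<le> 68" using assms(2,3) even_nr[of x] by (auto simp: x nr_nrm elim!: evenE)
  have chk: "nsum hup a b c d + (if a = 0 then 10000000000 else 0) \<le> 24 * hlo a b c d"
    by (rule sorted_allD[OF tabh_check o n ev]) auto
  have "pt_mass 0 x = (if a = 0 then 1 else 0)"
    using o by (auto simp: x pt_mass_def zero_prod_def)
  then have "10^10 * (pt_mass 0 x + nbr h x)
     = real_of_int (if a = 0 then 10000000000 else 0) + nsum (\<lambda>a b c d. 10^10 * h (a, b, c, d)) a b c d"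
    unfolding nsum_cmult x nbr_nsum by (simp add: distrib_left)
  also have "\<dots> \<le> real_of_int (if a = 0 then 10000000000 else 0) + real_of_int (nsum hup a b c d)"
    unfolding nsum_of_int[symmetric] by (intro add_left_mono nsum_mono h_bounds ev)
  also have "\<dots> \<le> real_of_int (24 * hlo a b c d)"
    using chk by (simp only: of_int_add[symmetric] of_int_le_iff add.commute)
  also have "\<dots> \<le> 10^10 * (24 * h x)"
    using h_bounds(1)[OF ev] by (simp add: x)
  finally show ?thesis by (simp add: lap_def)
qed

lemma l_near:
  assumes "sorted4 x" "even_pt x" "nr x < 84" shows "lap l x \<le> pt_mass 0 x"
proof -
  obtain a b c d where x: "x = (a, b, c, d)" by (cases x)
  have o: "0 \<le> d" "d \<le> c" "c \<le> b" "b \<le> a" using assms(1) by (auto simp: x sorted4_def)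
  have ev: "even (a + b + c + d)" using assms(2) by (simp add: x even_pt_def)
  have n: "nrm a b c d \<le> 82" using assms(2,3) even_nr[of x] by (auto simp: x nr_nrm elim!: evenE)
  have chk: "24 * lup a b c d \<le> nsum llo a b c d + (if a = 0 then 10000000000 else 0)"
    by (rule sorted_allD[OF tabl_check o n ev]) auto
  have "10^10 * (24 * l x) \<le> real_of_int (24 * lup a b c d)"
    using l_bounds(2)[OF ev] by (simp add: x)
  also have "\<dots> \<le> real_of_int (if a = 0 then 10000000000 else 0) + real_of_int (nsum llo a b c d)"
    using chk by (simp only: of_int_add[symmetric] of_int_le_iff add.commute)
  also have "\<dots> \<le> real_of_int (if a = 0 then 10000000000 else 0) + nsum (\<lambda>a b c d. 10^10 * l (a, b, c, d)) a b c d"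
    unfolding nsum_of_int[symmetric] by (intro add_left_mono nsum_mono l_bounds ev)
  also have "pt_mass 0 x = (if a = 0 then 1 else 0)"
    using o by (auto simp: x pt_mass_def zero_prod_def)
  then have "real_of_int (if a = 0 then 10000000000 else 0) + nsum (\<lambda>a b c d. 10^10 * l (a, b, c, d)) a b c d
      = 10^10 * (pt_mass 0 x + nbr l x)"
    unfolding nsum_cmult x nbr_nsum by (simp add: distrib_left)
  finally show ?thesis by (simp add: lap_def)
qed

lemma h_super: "pt_mass 0 x \<le> lap h x"
proof (rule lap_fundamental[where R = "\<lambda>a b. b \<le> a"])
  fix x assume s: "sorted4 x"
  consider "\<not> even_pt x" | "even_pt x" "nr x < 70" | "even_pt x" "nr x \<ge> 70" by linarith
  then show "pt_mass 0 x \<le> lap h x"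
  proof cases
    case 1 then show ?thesis by (simp add: lap_odd pt_mass_odd)
  next
    case 2 then show ?thesis using h_near s by blast
  next
    case 3
    then have "x \<noteq> 0" by (auto simp: nr_def dot_def zero_prod_def)
    then show ?thesis using h_far[OF 3] by (simp add: pt_mass_def)
  qed
qed (rule gfun_sym)+

lemma l_sub: "lap l x \<le> pt_mass 0 x"
proof (rule lap_fundamental[where R = "\<lambda>a b. a \<le> b"])
  fix x assume s: "sorted4 x"
  consider "\<not> even_pt x" | "even_pt x" "nr x < 84" | "even_pt x" "nr x \<ge> 84" by linarith
  then show "lap l x \<le> pt_mass 0 x"
  proof cases
    case 1 then show ?thesis by (simp add: lap_odd pt_mass_odd)
  next
    case 2 then show ?thesis using l_near s by blast
  next
    case 3
    then show ?thesis using l_far[OF 3] pt_mass_nonneg[of 0 x] by linarith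
  qed
qed (rule gfun_sym)+

definition nonneg_table :: "table \<Rightarrow> bool" where
  "nonneg_table = list_all (list_all (list_all (list_all (\<lambda>v. 0 \<le> v))))"

lemma get_all: "list_all P xs \<Longrightarrow> P z \<Longrightarrow> P (get z xs n)"
  by (induction z xs n rule: get.induct) auto

lemma entry_nonneg:
  assumes "nonneg_table T" shows "0 \<le> entry T a b c d"
proof -
  let ?P1 = "list_all (\<lambda>v. 0 \<le> (v::int))"
  have "list_all (list_all ?P1) (get [] T (nat a))"
    by (rule get_all[where P = "list_all (list_all ?P1)"]) (use assms in \<open>simp_all add: nonneg_table_def\<close>)
  then have "list_all ?P1 (get [] (get [] T (nat a)) (nat b))"
    by (rule get_all[where P = "list_all ?P1"]) simp
  then have "?P1 (get [] (get [] (get [] T (nat a)) (nat b)) (nat c))"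
    by (rule get_all[where P = ?P1]) simp
  then have "0 \<le> get 0 (get [] (get [] (get [] T (nat a)) (nat b)) (nat c)) (nat (d div 2))"
    by (rule get_all[where P = "\<lambda>v. 0 \<le> v"]) simp
  then show ?thesis by (simp add: entry_def)
qed

lemma entry_list_nonneg: "nonneg_table T \<Longrightarrow> 0 \<le> entry_list T xs"
  by (induction T xs rule: entry_list.induct) (auto simp: entry_nonneg)

lemma look4_nonneg: "nonneg_table T \<Longrightarrow> 0 \<le> look4 T a b c d"
  unfolding look4_def by (rule entry_list_nonneg)

lemma nonneg_tabs: "nonneg_table tabh" "nonneg_table tabl"
  by code_simp+

lemma gfun_nonneg:
  assumes "nonneg_table T" "0 \<le> k" "- real_of_int R \<le> e" shows "0 \<le> gfun T R k e x"
  using assms by (cases x) (auto simp: gfun_def look4_nonneg intro!: divide_nonneg_nonneg)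

lemma h_nonneg: "0 \<le> h x" and l_nonneg: "0 \<le> l x"
  by (rule gfun_nonneg; simp add: nonneg_tabs)+

lemma finite_nr: "finite {x. nr x \<le> M}"
proof (rule finite_subset)
  have sq: "\<bar>a\<bar> \<le> a * a" for a :: int
  proof (cases "a = 0")
    case False
    then have "\<bar>a\<bar> * 1 \<le> \<bar>a\<bar> * \<bar>a\<bar>" by (intro mult_left_mono) auto
    then show ?thesis by simp
  qed simp
  show "{x. nr x \<le> M} \<subseteq> {-M..M} \<times> {-M..M} \<times> {-M..M} \<times> {-M..M}"
  proof
    fix x assume "x \<in> {x. nr x \<le> M}"
    moreover obtain a b c d where x: "x = (a, b, c, d)" by (cases x)
    ultimately have "a * a + b * b + c * c + d * d \<le> M" by (simp add: nr_nrm nrm_def)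
    then have "\<bar>a\<bar> \<le> M" "\<bar>b\<bar> \<le> M" "\<bar>c\<bar> \<le> M" "\<bar>d\<bar> \<le> M"
      using sq[of a] sq[of b] sq[of c] sq[of d] zero_le_square[of a] zero_le_square[of b]
        zero_le_square[of c] zero_le_square[of d] by linarith+
    then show "x \<in> {-M..M} \<times> {-M..M} \<times> {-M..M} \<times> {-M..M}"
      by (simp add: x abs_le_iff)
  qed
qed simp

lemma gfun_vanish:
  assumes "0 \<le> k" "\<epsilon> > 0" shows "finite {x. gfun T R k e x \<ge> \<epsilon>}"
proof (rule finite_subset)
  show "{x. gfun T R k e x \<ge> \<epsilon>} \<subseteq> {x. nr x \<le> max R \<lceil>k / \<epsilon> + \<bar>e\<bar>\<rceil>}"
  proof
    fix x assume "x \<in> {x. gfun T R k e x \<ge> \<epsilon>}"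
    then have g: "gfun T R k e x \<ge> \<epsilon>" by simp
    have "nr x \<le> max R \<lceil>k / \<epsilon> + \<bar>e\<bar>\<rceil>"
    proof (rule ccontr)
      assume "\<not> ?thesis"
      then have R: "R < nr x" and "\<lceil>k / \<epsilon> + \<bar>e\<bar>\<rceil> < nr x" by auto
      then have k: "k / \<epsilon> + \<bar>e\<bar> < real_of_int (nr x)" by linarith
      have "even_pt x" using g assms gfun_odd[of x T R k e] by (cases "even_pt x") auto
      then have "gfun T R k e x = k / (real_of_int (nr x) + e)" using R by (rule gfun_far)
      then have le: "\<epsilon> \<le> k / (real_of_int (nr x) + e)" using g by simp
      have "0 \<le> k / \<epsilon>" using assms by simp
      then have p: "0 < real_of_int (nr x) + e" "k / \<epsilon> < real_of_int (nr x) + e"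
        using k by linarith+
      have "k < (real_of_int (nr x) + e) * \<epsilon>" using p(2) assms(2) by (simp add: pos_divide_less_eq)
      moreover have "(real_of_int (nr x) + e) * \<epsilon> \<le> k" using le p(1) by (simp add: pos_le_divide_eq mult.commute)
      ultimately show False by simp
    qed
    then show "x \<in> {x. nr x \<le> max R \<lceil>k / \<epsilon> + \<bar>e\<bar>\<rceil>}" by simp
  qed
qed (rule finite_nr)

section \<open>The Green function\<close>

lemma partial_p_le: "(\<Sum>n<N. p n x) \<le> 24 * h x"
  using supersolution_bound[of h x N, OF h_nonneg h_super] by simp

lemma summable_p: "summable (\<lambda>n. p n x)"
  by (rule summableI_nonneg_bounded[OF p_nonneg partial_p_le])

definition G :: "pt \<Rightarrow> real" where
  "G x = (\<Sum>n. p n x) / 24"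

lemma p_sums: "(\<lambda>n. p n x) sums (24 * G x)"
  using summable_sums[OF summable_p] by (simp add: G_def)

lemma p_tendsto: "(\<lambda>n. p n x) \<longlonglongrightarrow> 0"
  by (rule summable_LIMSEQ_zero[OF summable_p])

lemma gg_tendsto: "(\<lambda>N. gg N x) \<longlonglongrightarrow> 24 * G x"
  using p_sums[of x] by (simp add: sums_def gg_def)

lemma G_nonneg: "0 \<le> G x"
  using suminf_nonneg[OF summable_p p_nonneg] by (simp add: G_def)

lemma G_le_h: "G x \<le> h x"
  using suminf_le_const[OF summable_p partial_p_le, of x] by (simp add: G_def field_simps)

lemma lap_G: "lap G x = pt_mass 0 x"
proof -
  have "(\<lambda>n. \<Sum>u\<in>roots. p n (x + u)) sums (\<Sum>u\<in>roots. 24 * G (x + u))"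
    by (rule sums_sum) (rule p_sums)
  then have "(\<lambda>n. nbr (p n) x) sums (24 * nbr G x)"
    by (simp add: nbr_def sum_distrib_left)
  then have "(\<lambda>n. p (Suc n) x) sums (nbr G x)"
    using sums_divide[of "\<lambda>n. nbr (p n) x" "24 * nbr G x" 24] by simp
  then have "(\<lambda>n. p n x) sums (nbr G x + p 0 x)" by (subst sums_Suc_iff[symmetric])
  then have "24 * G x = nbr G x + p 0 x" using p_sums sums_unique2[of "\<lambda>n. p n x"] by metis
  then show ?thesis by (simp add: lap_def)
qed

lemma l_le_G: "l x \<le> G x"
proof -
  have "0 \<le> G x - l x"
  proof (rule max_principle[of "\<lambda>x. G x - l x"])
    fix e :: real assume "e > 0"
    then have "finite {x. l x \<ge> e}" by (intro gfun_vanish) auto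
    moreover have "{x. G x - l x \<le> - e} \<subseteq> {x. l x \<ge> e}"
      using G_nonneg by (smt (verit) Collect_mono_iff)
    ultimately show "finite {x. G x - l x \<le> - e}" by (rule finite_subset[rotated])
  next
    fix x show "nbr (\<lambda>x. G x - l x) x \<le> 24 * (G x - l x)"
      using l_sub[of x] lap_G[of x] by (simp add: nbr_diff lap_def)
  qed
  then show ?thesis by simp
qed

lemma G_vanish: "e > 0 \<Longrightarrow> finite {x. G x \<ge> e}"
  by (rule finite_subset[of _ "{x. h x \<ge> e}"]) (use G_le_h gfun_vanish[of "85323 / 10^7" e] in \<open>force intro: order_trans\<close>)+

lemma G_odd: "\<not> even_pt x \<Longrightarrow> G x = 0"
  using G_le_h[of x] G_nonneg[of x] gfun_odd[of x] by simp

section \<open>Elimination of the weighted sums by symmetry, Laplacian and drift\<close>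

definition symm :: "(pt \<Rightarrow> real) \<Rightarrow> bool" where
  "symm f \<longleftrightarrow> (\<forall>x. f (swap12 x) = f x \<and> f (swap23 x) = f x \<and> f (swap34 x)
      = f x \<and> f (neg1 x) = f x)"

fun sl :: "(pt \<Rightarrow> real) \<Rightarrow> int list \<Rightarrow> real" where
  "sl f [a, b, c, d] = f (a, b, c, d)"
| "sl f _ = 0"

text \<open>Used as a rewrite rule: all values of a symmetric function on one orbit collapse to a
  single opaque term \<open>sl f\<close> of a sorted list. The equations of \<open>sl\<close> leave
  the simplifier afterwards, since together the two rules would loop.\<close>

lemma symm_sl:
  assumes "symm f"
  shows "f (a, b, c, d) = sl f (ins \<bar>a\<bar> (ins \<bar>b\<bar> (ins \<bar>c\<bar> (ins \<bar>d\<bar> []))))"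
proof -
  let ?Q = "\<lambda>x. f x = (case x of (a, b, c, d) \<Rightarrow> sl f (ins \<bar>a\<bar> (ins
      \<bar>b\<bar> (ins \<bar>c\<bar> (ins \<bar>d\<bar> [])))))"
  have "?Q (a, b, c, d)"
  proof (rule fundamental_domain[of ?Q])
    fix x :: pt obtain a b c d where x: "x = (a, b, c, d)" by (cases x)
    have f: "f (swap12 x) = f x" "f (swap23 x) = f x" "f (swap34 x) = f x" "f (neg1 x) = f x"
      using assms by (auto simp: symm_def)
    show "?Q (swap12 x) \<Longrightarrow> ?Q x" unfolding f
      using ins_commute[of "\<bar>b\<bar>" "\<bar>a\<bar>"] by (simp only: x swap12_def prod.case)
    show "?Q (swap23 x) \<Longrightarrow> ?Q x" unfolding f
      using ins_commute[of "\<bar>c\<bar>" "\<bar>b\<bar>"] by (simp only: x swap23_def prod.case)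
    show "?Q (swap34 x) \<Longrightarrow> ?Q x" unfolding f
      using ins_commute[of "\<bar>d\<bar>" "\<bar>c\<bar>" "[]"] by (simp only: x swap34_def prod.case)
    show "?Q (neg1 x) \<Longrightarrow> ?Q x" unfolding f
      by (simp only: x neg1_def prod.case abs_minus_cancel)
    assume "sorted4 x"
    then have "0 \<le> d" "d \<le> c" "c \<le> b" "b \<le> a" by (auto simp: x sorted4_def)
    then show "?Q x" by (simp add: x)
  qed
  then show ?thesis by simp
qed

declare sl.simps [simp del]

lemma symm_p: "symm (p n)"
  by (simp only: symm_def swap12.p_sym swap23.p_sym swap34.p_sym neg1.p_sym simp_thms)

lemma symm_TT: "symm (TT N)"
  by (simp only: symm_def TT_def swap12.p_sym swap23.p_sym swap34.p_sym neg1.p_sym simp_thms)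

lemma symm_gg: "symm (gg N)"
  by (simp only: symm_def gg_def swap12.p_sym swap23.p_sym swap34.p_sym neg1.p_sym simp_thms)

lemma symm_G: "symm G"
  by (simp only: symm_def G_def swap12.p_sym swap23.p_sym swap34.p_sym neg1.p_sym simp_thms)

definition fst1 :: "pt \<Rightarrow> real" where "fst1 = (\<lambda>(a, b, c, d). real_of_int a)"

lemma fst1_add: "fst1 (x + y) = fst1 x + fst1 y"
  by (cases x; cases y) (simp add: fst1_def)

lemmas TT_simps = nbr_nsum nsum_def drift_def sum_roots fst1_def
  symm_sl[OF symm_TT] symm_sl[OF symm_gg] symm_sl[OF symm_p]

definition err :: "nat \<Rightarrow> real" where
  "err N = (real N + 1) * (p N (0,0,0,0) + p N (1,1,0,0) + p N (2,0,0,0) + p N (1,1,1,1) + p N (2,1,1,0))"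

lemma abs_add_bound: "\<bar>x\<bar> \<le> A \<Longrightarrow> \<bar>y\<bar> \<le> B \<Longrightarrow> \<bar>x + y\<bar> \<le> A + (B::real)"
  by linarith

lemma abs_mult_bound: "0 \<le> a \<Longrightarrow> \<bar>c\<bar> \<le> 500 \<Longrightarrow> \<bar>c * a\<bar> \<le> 500 * (a::real)"
  by (simp add: abs_mult mult_right_mono)

text \<open>The left sides are the return sums of the chambers with one, two and three reflections.
  They follow by linear elimination from the Laplace and drift equations at a few points next to the
  origin; the third combination reaches further out and also needs the two equations at
  \<open>(2, 1, 1, 0)\<close>. The boundary terms have coefficients of modulus at most 240, so 500
  is a comfortable common bound.\<close>

lemma TT_identities:
  fixes N :: nat
  defines "t \<equiv> TT N" and "g \<equiv> gg N"
  shows "\<bar>t (0,0,0,0) - t (2,0,0,0)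
        - (8/7 * g (0,0,0,0) + 6/7 * g (2,0,0,0) - 2/7 * g (1,1,1,1))\<bar> \<le> 500 * err N" (is ?k1)
    and "\<bar>t (0,0,0,0) - 2 * t (2,0,0,0) + t (2,2,0,0)
        - (24/7 * g (0,0,0,0) - 24 * g (1,1,0,0) + 4/7 * g (2,0,0,0) - 20/7 * g (1,1,1,1))\<bar> \<le> 500 * err N" (is ?k2)
    and "\<bar>t (0,0,0,0) - 3 * t (2,0,0,0) + 3 * t (2,2,0,0) - t (2,2,2,0)
        - (16 * g (0,0,0,0) - 120 * g (1,1,0,0) - 8 * g (2,0,0,0) - 56 * g (1,1,1,1)
           - 24 * g (2,1,1,0))\<bar> \<le> 500 * err N" (is ?k3)
proof -
  define E where "E x = real N * p N x" for x
  note fold_E = E_def[symmetric]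
  note i0 = TT_nbr[of N "(0,0,0,0)", simplified TT_simps, simplified, unfolded sl.simps fold_E]
  note i1 = TT_nbr[of N "(1,1,0,0)", simplified TT_simps, simplified, unfolded sl.simps fold_E]
  note i2 = TT_nbr[of N "(2,0,0,0)", simplified TT_simps, simplified, unfolded sl.simps fold_E]
  note i11 = TT_nbr[of N "(1,1,1,1)", simplified TT_simps, simplified, unfolded sl.simps fold_E]
  note i3 = TT_nbr[of N "(2,1,1,0)", simplified TT_simps, simplified, unfolded sl.simps fold_E]
  note j1 = TT_drift[OF fst1_add, of N "(1,1,0,0)", simplified drift_def sum_roots fst1_def, simplified,
      simplified symm_sl[OF symm_TT], simplified, unfolded sl.simps]
  note j2 = TT_drift[OF fst1_add, of N "(2,0,0,0)", simplified drift_def sum_roots fst1_def, simplified,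
      simplified symm_sl[OF symm_TT], simplified, unfolded sl.simps]
  note j11 = TT_drift[OF fst1_add, of N "(1,1,1,1)", simplified drift_def sum_roots fst1_def, simplified,
      simplified symm_sl[OF symm_TT], simplified, unfolded sl.simps]
  note j3 = TT_drift[OF fst1_add, of N "(2,1,1,0)", simplified drift_def sum_roots fst1_def, simplified,
      simplified symm_sl[OF symm_TT], simplified, unfolded sl.simps]
  have nn: "0 \<le> p N x" "0 \<le> E x" for x using p_nonneg by (auto simp: E_def simp del: walk.simps)
  note e = nn[of "(0,0,0,0)"] nn[of "(1,1,0,0)"] nn[of "(2,0,0,0)"] nn[of "(1,1,1,1)"] nn[of "(2,1,1,0)"]
  have er: "err N = (E (0,0,0,0) + E (1,1,0,0) + E (2,0,0,0)
      + E (1,1,1,1) + E (2,1,1,0))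
      + (p N (0,0,0,0) + p N (1,1,0,0) + p N (2,0,0,0) + p N (1,1,1,1) + p N (2,1,1,0))"
    by (simp add: err_def E_def algebra_simps del: walk.simps)
  have k1: "TT N (0,0,0,0) - TT N (2,0,0,0) = (8/7) * gg N (0,0,0,0) + (6/7) * gg N (2,0,0,0) + (-2/7) * gg N
      (1,1,1,1) + ((-8/7) * (E (0,0,0,0)) + (-12/7) * (E (1,1,0,0)) + (-12/7) * p N (1,1,0,0) + (6/7) * (E
      (2,0,0,0)) + (12/7) * p N (2,0,0,0) + (-2/7) * (E (1,1,1,1)) + (-4/7) * p N (1,1,1,1))"
    using i0 i1 i2 i11 j1 j2 j11 by linarith
  have k2: "TT N (0,0,0,0) - 2 * TT N (2,0,0,0) + TT N (2,2,0,0) = (24/7) * gg N (0,0,0,0) + (-24) * gg N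
      (1,1,0,0) + (4/7) * gg N (2,0,0,0) + (-20/7) * gg N (1,1,1,1) + ((-24/7) * (E (0,0,0,0)) + (-120/7) *
      (E (1,1,0,0)) + (-288/7) * p N (1,1,0,0) + (4/7) * (E (2,0,0,0)) + (8/7) * p N (2,0,0,0) + (-20/7) * (E
      (1,1,1,1)) + (-40/7) * p N (1,1,1,1))"
    using i0 i1 i2 i11 j1 j2 j11 by linarith
  have k3: "TT N (0,0,0,0) - 3 * TT N (2,0,0,0) + 3 * TT N (2,2,0,0) - TT N (2,2,2,0) = (16) * gg N (0,0,0,0)
      + (-120) * gg N (1,1,0,0) + (-8) * gg N (2,0,0,0) + (-56) * gg N (1,1,1,1) + (-24) * gg N (2,1,1,0) +
      ((-16) * (E (0,0,0,0)) + (-120) * (E (1,1,0,0)) + (-240) * p N (1,1,0,0) + (-8) * (E (2,0,0,0)) + (-16)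
      * p N (2,0,0,0) + (-24) * (E (1,1,1,1)) + (-80) * p N (1,1,1,1) + (-24) * (E (2,1,1,0)) + (-48) * p N (2,1,1,0))"
    using i0 i1 i2 i11 j1 j2 j11 i3 j3 by linarith
  have "\<bar>(-8/7) * (E (0,0,0,0)) + (-12/7) * (E (1,1,0,0)) + (-12/7) * p N (1,1,0,0) + (6/7) * (E
      (2,0,0,0)) + (12/7) * p N (2,0,0,0) + (-2/7) * (E (1,1,1,1)) + (-4/7) * p N (1,1,1,1)\<bar> \<le> 500 *
      E (0,0,0,0) + 500 * E (1,1,0,0) + 500 * p N (1,1,0,0) + 500 * E (2,0,0,0) + 500 * p N (2,0,0,0) + 500 *
      E (1,1,1,1) + 500 * p N (1,1,1,1)"
    by (intro abs_add_bound abs_mult_bound nn) simp_all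
  also have "\<dots> \<le> \<dots> + (500 * p N (0,0,0,0) + 500 * E (2,1,1,0) + 500 * p N (2,1,1,0))"
    using nn by (simp add: add_nonneg_nonneg del: walk.simps)
  also have "\<dots> = 500 * err N" unfolding er by (simp add: algebra_simps del: walk.simps)
  finally show ?k1 unfolding t_def g_def k1 by (simp add: algebra_simps)
  have "\<bar>(-24/7) * (E (0,0,0,0)) + (-120/7) * (E (1,1,0,0)) + (-288/7) * p N (1,1,0,0) + (4/7) * (E
      (2,0,0,0)) + (8/7) * p N (2,0,0,0) + (-20/7) * (E (1,1,1,1)) + (-40/7) * p N (1,1,1,1)\<bar> \<le> 500
      * E (0,0,0,0) + 500 * E (1,1,0,0) + 500 * p N (1,1,0,0) + 500 * E (2,0,0,0) + 500 * p N (2,0,0,0) + 500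
      * E (1,1,1,1) + 500 * p N (1,1,1,1)"
    by (intro abs_add_bound abs_mult_bound nn) simp_all
  also have "\<dots> \<le> \<dots> + (500 * p N (0,0,0,0) + 500 * E (2,1,1,0) + 500 * p N (2,1,1,0))"
    using nn by (simp add: add_nonneg_nonneg del: walk.simps)
  also have "\<dots> = 500 * err N" unfolding er by (simp add: algebra_simps del: walk.simps)
  finally show ?k2 unfolding t_def g_def k2 by (simp add: algebra_simps)
  have "\<bar>(-16) * (E (0,0,0,0)) + (-120) * (E (1,1,0,0)) + (-240) * p N (1,1,0,0) + (-8) * (E (2,0,0,0))
      + (-16) * p N (2,0,0,0) + (-24) * (E (1,1,1,1)) + (-80) * p N (1,1,1,1) + (-24) * (E (2,1,1,0)) + (-48)
      * p N (2,1,1,0)\<bar> \<le> 500 * E (0,0,0,0) + 500 * E (1,1,0,0) + 500 * p N (1,1,0,0) + 500 * E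
      (2,0,0,0) + 500 * p N (2,0,0,0) + 500 * E (1,1,1,1) + 500 * p N (1,1,1,1) + 500 * E (2,1,1,0) + 500 * p
      N (2,1,1,0)"
    by (intro abs_add_bound abs_mult_bound nn) simp_all
  also have "\<dots> \<le> \<dots> + (500 * p N (0,0,0,0))"
    using nn by (simp add: add_nonneg_nonneg del: walk.simps)
  also have "\<dots> = 500 * err N" unfolding er by (simp add: algebra_simps del: walk.simps)
  finally show ?k3 unfolding t_def g_def k3 by (simp add: algebra_simps del: walk.simps)
qed

text \<open>The error term is summable up to a factor \<open>n\<close>, hence small infinitely often.\<close>

lemma err_small:
  assumes "\<epsilon> > 0" shows "\<exists>N\<ge>M. err N < \<epsilon>"
proof (rule ccontr)
  assume "\<not> ?thesis"
  then have big: "\<epsilon> \<le> err N" if "N \<ge> M" for N using that by (meson not_less)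
  define s where "s N = p N (0,0,0,0) + p N (1,1,0,0) + p N (2,0,0,0) + p N (1,1,1,1) + p N (2,1,1,0)" for N
  have sms: "summable s" unfolding s_def by (intro summable_add summable_p)
  have bd: "norm (\<epsilon> * inverse (real (Suc N))) \<le> s N" if "N \<ge> M" for N
  proof -
    have "err N = (real N + 1) * s N" unfolding err_def s_def ..
    then have "\<epsilon> \<le> s N * real (Suc N)" using big[OF that] by (simp add: algebra_simps)
    then have "\<epsilon> / real (Suc N) \<le> s N" by (subst pos_divide_le_eq) simp_all
    moreover have "norm (\<epsilon> * inverse (real (Suc N))) = \<epsilon> / real (Suc N)"
      using assms by (simp add: divide_inverse abs_mult)
    ultimately show ?thesis by simp
  qed
  have "summable (\<lambda>N. \<epsilon> * inverse (real (Suc N)))"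
    by (rule summable_comparison_test[OF exI[of _ M] sms]) (use bd in blast)
  then have "summable (\<lambda>N. inverse (real (Suc N)))"
    using assms by (simp add: summable_cmult_iff)
  then have "summable (\<lambda>n. inverse (real n))"
    by (subst (asm) summable_Suc_iff)
  then show False using not_summable_harmonic[where 'a = real] by simp
qed

text \<open>\<open>err\<close> is known to be small only for infinitely many \<open>N\<close>. That
  suffices because the partial sums increase: closeness to \<open>\<beta>\<close> along a
  subsequence bounds all of them by \<open>\<beta>\<close>, and from one close index on they remain
  close.\<close>

lemma sums_of_identity:
  fixes f B :: "nat \<Rightarrow> real"
  assumes f: "\<And>n. 0 \<le> f n" and B: "B \<longlonglongrightarrow> \<beta>"
    and e: "\<And>N. \<bar>(\<Sum>n<N. f n) - B N\<bar> \<le> 500 * err N"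
  shows "f sums \<beta>"
proof -
  have ev: "eventually (\<lambda>N. \<bar>B N - \<beta>\<bar> < \<epsilon>) sequentially" if "\<epsilon> > 0" for \<epsilon>
    using B that by (auto simp: tendsto_iff dist_real_def)
  have approx: "\<exists>N\<ge>M. \<bar>(\<Sum>n<N. f n) - \<beta>\<bar> < \<epsilon>" if eps: "\<epsilon> > 0" for \<epsilon> M
  proof -
    obtain M' where M': "\<And>N. N \<ge> M' \<Longrightarrow> \<bar>B N - \<beta>\<bar> < \<epsilon> / 2"
      using ev[of "\<epsilon> / 2"] eps unfolding eventually_sequentially by auto
    obtain N where "N \<ge> max M M'" "err N < \<epsilon> / 1000"
      using err_small[of "\<epsilon> / 1000" "max M M'"] eps by auto
    moreover have "\<bar>(\<Sum>n<N. f n) - \<beta>\<bar> \<le> \<bar>(\<Sum>n<N. f n) - B N\<bar> + \<bar>B N - \<beta>\<bar>"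
      by linarith
    moreover have "\<bar>B N - \<beta>\<bar> < \<epsilon> / 2" using M'[of N] calculation(1) by simp
    moreover have "500 * err N < \<epsilon> / 2" using calculation(2) by simp
    ultimately have "\<bar>(\<Sum>n<N. f n) - \<beta>\<bar> < \<epsilon>" using e[of N] by simp
    then show ?thesis using \<open>N \<ge> max M M'\<close> by auto
  qed
  have mono: "(\<Sum>n<M. f n) \<le> (\<Sum>n<N. f n)" if "M \<le> N" for M N
    using that f by (intro sum_mono2) auto
  have up: "(\<Sum>n<M. f n) \<le> \<beta>" for M
  proof (rule field_le_epsilon)
    fix \<epsilon> :: real assume "\<epsilon> > 0"
    then obtain N where "N \<ge> M" "\<bar>(\<Sum>n<N. f n) - \<beta>\<bar> < \<epsilon>" using approx by blast
    then show "(\<Sum>n<M. f n) \<le> \<beta> + \<epsilon>" using mono[of M N] by linarith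
  qed
  have "(\<lambda>N. \<Sum>n<N. f n) \<longlonglongrightarrow> \<beta>"
  proof (rule LIMSEQ_I)
    fix r :: real assume "0 < r"
    then obtain M where M: "\<bar>(\<Sum>n<M. f n) - \<beta>\<bar> < r" using approx by blast
    have "norm ((\<Sum>n<N. f n) - \<beta>) < r" if "N \<ge> M" for N
      using M mono[OF that] up[of N] by auto
    then show "\<exists>no. \<forall>N\<ge>no. norm ((\<Sum>n<N. f n) - \<beta>) < r" by blast
  qed
  then show ?thesis by (simp add: sums_def)
qed

section \<open>Reflections and chambers\<close>

definition negs :: "nat \<Rightarrow> pt \<Rightarrow> pt" where
  "negs i = (if i = 0 then neg1 else if i = 1 then neg2 else if i = 2 then neg3 else neg4)"

definition coord :: "nat \<Rightarrow> pt \<Rightarrow> int" where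
  "coord i = (\<lambda>(a, b, c, d). if i = 0 then a else if i = 1 then b else if i = 2 then c else d)"

definition chamber :: "nat \<Rightarrow> pt set" where
  "chamber k = {x. \<forall>i<k. 0 < coord i x}"

lemma chamber_Suc: "chamber (Suc k) = {x \<in> chamber k. 0 < coord k x}"
  by (auto simp: chamber_def less_Suc_eq)

lemma negs_cases: "negs i = neg1 \<or> negs i = neg2 \<or> negs i = neg3 \<or> negs i = neg4"
  by (auto simp: negs_def)

lemma negs_symmetry: "lattice_symmetry (negs i)"
  using negs_cases[of i] neg1.lattice_symmetry_axioms neg2.lattice_symmetry_axioms
    neg3.lattice_symmetry_axioms neg4.lattice_symmetry_axioms by metis

interpretation negs: lattice_symmetry "negs i" for i
  by (rule negs_symmetry)

lemma negs_commute: "negs i (negs j x) = negs j (negs i x)"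
  by (cases x) (auto simp: negs_def neg1_def neg2_def neg3_def neg4_def)

lemma coord_negs: "i < 4 \<Longrightarrow> j < 4 \<Longrightarrow> coord i (negs j x) = (if i = j then - coord i x else coord i x)"
  by (cases x) (auto simp: coord_def negs_def neg1_def neg2_def neg3_def neg4_def)

lemma coord_add: "coord i (x + y) = coord i x + coord i y"
  by (cases x; cases y) (auto simp: coord_def)

lemma coord_diff: "coord i (x - y) = coord i x - coord i y"
  by (cases x; cases y) (auto simp: coord_def)

lemma coord_root: "u \<in> roots \<Longrightarrow> - 1 \<le> coord i u \<and> coord i u \<le> 1"
  unfolding roots_eq root_list_def by (auto simp: coord_def)

lemma negs_fix: "i < 4 \<Longrightarrow> coord i x = 0 \<Longrightarrow> negs i x = x"
  by (cases x) (auto simp: coord_def negs_def neg1_def neg2_def neg3_def neg4_def split: if_splits)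

text \<open>The signed sum over all sign changes of the first \<open>k\<close> coordinates, built
  one reflection at a time.\<close>

fun ws :: "nat \<Rightarrow> (pt \<Rightarrow> real) \<Rightarrow> pt \<Rightarrow> real" where
  "ws 0 f = f"
| "ws (Suc k) f = (\<lambda>x. ws k f x - ws k f (negs k x))"

lemma ws_antisym: "i < k \<Longrightarrow> ws k f (negs i x) = - ws k f x"
proof (induction k arbitrary: x)
  case (Suc k)
  show ?case
  proof (cases "i = k")
    case True then show ?thesis by (simp add: negs.inv)
  next
    case False
    then have "i < k" using Suc.prems by simp
    then show ?thesis using Suc.IH by (simp add: negs_commute[of k i])
  qed
qed simp

lemma ws_sums: "(\<And>x. (\<lambda>n. f n x) sums F x) \<Longrightarrow> (\<lambda>n. ws k (f n) x) sums ws k F x"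
proof (induction k arbitrary: x)
  case (Suc k) then show ?case unfolding ws.simps by (intro sums_diff Suc.IH Suc.prems)
qed simp

lemma ws_lap: "lap (ws k f) x = ws k (lap f) x"
proof (induction k arbitrary: x)
  case (Suc k)
  have "lap (ws (Suc k) f) x = lap (ws k f) x - lap (ws k f) (negs k x)"
    by (simp add: lap_diff negs.lap_sym)
  then show ?case by (simp add: Suc.IH)
qed simp

text \<open>Method of images, one wall at a time: the chamber already treated restricts only earlier
  coordinates, so it is invariant under the next sign change and \<open>walk_reflect\<close>
  applies.\<close>

lemma walk_chamber:
  assumes "k \<le> 4" "y \<in> chamber k" "x \<in> chamber k"
  shows "walk (chamber k) (pt_mass y) n x = ws k (\<lambda>x. p n (x - y)) x"
  using assms
proof (induction k arbitrary: x n)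
  case 0
  have "chamber 0 = UNIV" by (simp add: chamber_def)
  then show ?case by (simp only: ws.simps walk_shift[of y])
next
  case (Suc k)
  have yk: "y \<in> chamber k" "0 < coord k y" using Suc.prems by (auto simp: chamber_Suc)
  have xk: "x \<in> chamber k" using Suc.prems by (simp add: chamber_Suc)
  have nD: "negs k z \<in> chamber k \<longleftrightarrow> z \<in> chamber k" for z
    unfolding chamber_def mem_Collect_eq
    by (rule all_cong) (use Suc.prems(1) coord_negs in auto)
  have "walk {x \<in> chamber k. 0 < coord k x} (pt_mass y) n x
    = walk (chamber k) (pt_mass y) n x - walk (chamber k) (pt_mass y) n (negs k x)"
  proof (rule walk_reflect[where \<rho> = "negs k" and P = "\<lambda>x. 0 < coord k x"])
    show "negs k (x + u) = negs k x + negs k u" for x u by (rule negs.add)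
    show "negs k (negs k x) = x" for x by (rule negs.inv)
    show "u \<in> roots \<Longrightarrow> negs k u \<in> roots" for u by (rule negs.rt)
    show "negs k x \<in> chamber k \<longleftrightarrow> x \<in> chamber k" for x by (rule nD)
    show "0 < coord k (x + u) \<or> negs k (x + u) = x + u" if "0 < coord k x" "u \<in> roots" for x u
      using coord_root[OF that(2), of k] that(1) negs_fix[of k "x + u"] Suc.prems(1)
      unfolding coord_add by force
    show "supp_in {x \<in> chamber k. 0 < coord k x} (pt_mass y)"
      using yk by (simp add: supp_in_def pt_mass_def)
    show "supp_in (chamber k) (pt_mass y)"
      using yk by (simp add: supp_in_def pt_mass_def)
    show "pt_mass y (negs k x) = 0" if "0 < coord k x" for x
      using that yk coord_negs[of k k x] Suc.prems(1) by (auto simp: pt_mass_def)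
    show "x \<in> {x \<in> chamber k. 0 < coord k x}" using Suc.prems by (simp add: chamber_Suc)
  qed
  also have "walk (chamber k) (pt_mass y) n x = ws k (\<lambda>x. p n (x - y)) x"
    using Suc.prems yk xk by (intro Suc.IH) auto
  also have "walk (chamber k) (pt_mass y) n (negs k x) = ws k (\<lambda>x. p n (x - y)) (negs k x)"
    using Suc.prems yk xk nD by (intro Suc.IH) auto
  finally show ?case by (simp add: chamber_Suc)
qed

text \<open>The Green function of the chamber with pole \<open>y\<close>, continued
  antisymmetrically across the walls to the whole lattice.\<close>

definition xi :: "nat \<Rightarrow> pt \<Rightarrow> pt \<Rightarrow> real" where
  "xi k y = ws k (\<lambda>x. G (x - y))"

lemma walk_chamber_sums:
  assumes "k \<le> 4" "y \<in> chamber k" "x \<in> chamber k"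
  shows "(\<lambda>n. walk (chamber k) (pt_mass y) n x) sums (24 * xi k y x)"
proof -
  have "(\<lambda>n. ws k (\<lambda>x. p n (x - y)) x) sums ws k (\<lambda>x. 24 * G (x - y)) x"
    by (rule ws_sums) (rule p_sums)
  moreover have "ws k (\<lambda>x. 24 * f x) z = 24 * ws k f z" for f z
    by (induction k arbitrary: z) (simp_all add: algebra_simps)
  ultimately show ?thesis using walk_chamber[OF assms] by (simp add: xi_def)
qed

lemma lap_xi: "lap (xi k y) x = ws k (pt_mass y) x"
proof -
  have "lap (\<lambda>x. G (x - y)) x = pt_mass y x" for x
    using lap_shift[of G "- y" x] by (simp add: lap_G pt_mass_def)
  then have "lap (\<lambda>x. G (x - y)) = pt_mass y" by (rule ext)
  then show ?thesis by (simp add: xi_def ws_lap)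
qed

text \<open>Since the reflected coordinates of the pole equal one, an image is displaced by two in
  each changed coordinate. By symmetry, images with equally many changes contribute equally, hence
  the alternating binomial coefficients.\<close>

lemma ws_return:
  assumes "symm f"
  shows "ws 1 (\<lambda>x. f (x - (1, b, c, d))) (1, b, c, d) = f (0,0,0,0) - f (2,0,0,0)"
    and "ws 2 (\<lambda>x. f (x - (1, 1, c, d))) (1, 1, c, d) = f (0,0,0,0) - 2 * f (2,0,0,0) + f (2,2,0,0)"
    and "ws 3 (\<lambda>x. f (x - (1, 1, 1, d))) (1, 1, 1, d)
      = f (0,0,0,0) - 3 * f (2,0,0,0) + 3 * f (2,2,0,0) - f (2,2,2,0)"
    and "ws 4 (\<lambda>x. f (x - (1, 1, 1, 1))) (1, 1, 1, 1)
      = f (0,0,0,0) - 4 * f (2,0,0,0) + 6 * f (2,2,0,0) - 4 * f (2,2,2,0) + f (2,2,2,2)"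
  by (simp_all add: zero_prod_def eval_nat_numeral negs_def neg1_def neg2_def neg3_def neg4_def symm_sl[OF assms])

text \<open>Pairs of times with a given sum: this is where the weight \<open>n + 1\<close> comes from.\<close>

lemma double_sum_le:
  fixes \<sigma> :: "nat \<Rightarrow> real"
  assumes "\<And>n. 0 \<le> \<sigma> n"
  shows "(\<Sum>j<N. \<Sum>i<k. \<sigma> (j + i)) \<le> (\<Sum>m<N + k. (real m + 1) * \<sigma> m)"
proof -
  have "(\<Sum>j<N. \<Sum>i<k. \<sigma> (j + i)) = (\<Sum>p\<in>{..<N} \<times> {..<k}. \<sigma> (fst p + snd p))"
    by (simp add: sum.cartesian_product case_prod_beta)
  also have "\<dots> = (\<Sum>m<N + k. \<Sum>p\<in>{p \<in> {..<N} \<times> {..<k}. fst p + snd p = m}. \<sigma> (fst p + snd p))"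
    by (rule sum.group[symmetric]) auto
  also have "\<dots> \<le> (\<Sum>m<N + k. (real m + 1) * \<sigma> m)"
  proof (rule sum_mono)
    fix m
    let ?P = "{p \<in> {..<N} \<times> {..<k}. fst p + snd p = m}"
    have "?P \<subseteq> (\<lambda>i. (i, m - i)) ` {..m}" by (auto simp: image_iff)
    then have "card ?P \<le> card ((\<lambda>i. (i, m - i)) ` {..m})" by (intro card_mono) auto
    also have "\<dots> \<le> m + 1" using card_image_le[of "{..m}" "\<lambda>i. (i, m - i)"] by simp
    finally have "real (card ?P) \<le> real m + 1" by simp
    then show "(\<Sum>p\<in>?P. \<sigma> (fst p + snd p)) \<le> (real m + 1) * \<sigma> m"
      using assms by (simp add: mult_right_mono)
  qed
  finally show ?thesis .
qed

lemma double_sum_ge: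
  fixes \<sigma> :: "nat \<Rightarrow> real"
  assumes "\<And>n. 0 \<le> \<sigma> n"
  shows "(\<Sum>m<N. (real m + 1) * \<sigma> m) \<le> (\<Sum>j<N. \<Sum>i<N. \<sigma> (j + i))"
proof -
  have "(\<Sum>m<N. (real m + 1) * \<sigma> m) = (\<Sum>m<N. \<Sum>j\<in>{..m}. \<sigma> m)" by (simp add: add.commute)
  also have "\<dots> = (\<Sum>(m, j)\<in>(SIGMA m:{..<N}. {..m}). \<sigma> m)"
    by (rule sum.Sigma) auto
  also have "\<dots> = (\<Sum>(j, i)\<in>(\<lambda>(m, j). (j, m - j)) ` (SIGMA m:{..<N}. {..m}). \<sigma> (j + i))"
    by (subst sum.reindex) (auto simp: inj_on_def case_prod_beta intro!: sum.cong)
  also have "\<dots> \<le> (\<Sum>(j, i)\<in>{..<N} \<times> {..<N}. \<sigma> (j + i))"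
    by (rule sum_mono2) (use assms in auto)
  also have "\<dots> = (\<Sum>j<N. \<Sum>i<N. \<sigma> (j + i))" by (simp add: sum.cartesian_product)
  finally show ?thesis .
qed

lemma ip_sum_left:
  assumes "finite I" "\<And>i. i \<in> I \<Longrightarrow> fs (f i)" "sqs g"
  shows "ip (\<lambda>x. \<Sum>i\<in>I. f i x) g = (\<Sum>i\<in>I. ip (f i) g)"
  unfolding ip_def sum_distrib_right
  by (rule infsum_sum) (auto intro!: sqs_prod fs_sqs assms)

lemma fs_sum: "finite I \<Longrightarrow> (\<And>i. i \<in> I \<Longrightarrow> fs (f i)) \<Longrightarrow>
    fs (\<lambda>x. \<Sum>i\<in>I. f i x)"
proof (induction I rule: finite_induct)
  case (insert i I)
  then show ?case using fs_add[of "f i" "\<lambda>x. \<Sum>i\<in>I. f i x"] by simp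
qed (simp add: fs_def)

lemma ip_sum_sum:
  assumes "finite I" "finite J" "\<And>i. i \<in> I \<Longrightarrow> fs (f i)" "\<And>i. i \<in> J \<Longrightarrow> fs (g i)"
  shows "ip (\<lambda>x. \<Sum>i\<in>I. f i x) (\<lambda>x. \<Sum>j\<in>J. g j x) = (\<Sum>i\<in>I. \<Sum>j\<in>J. ip (f i) (g j))"
proof -
  have "ip (\<lambda>x. \<Sum>i\<in>I. f i x) (\<lambda>x. \<Sum>j\<in>J. g j x) = (\<Sum>i\<in>I. ip (f i)
      (\<lambda>x. \<Sum>j\<in>J. g j x))"
    by (intro ip_sum_left fs_sqs fs_sum assms)
  also have "\<dots> = (\<Sum>i\<in>I. \<Sum>j\<in>J. ip (f i) (g j))"
    by (intro sum.cong refl, subst (1 2) ip_commute) (auto intro!: ip_sum_left fs_sqs assms)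
  finally show ?thesis .
qed

lemma has_sum_ip: "sqs f \<Longrightarrow> ip f f = s \<Longrightarrow> ((\<lambda>x. (f x)\<^sup>2) has_sum s) UNIV"
  unfolding sqs_def ip_def power2_eq_square by (auto simp: has_sum_infsum)

lemma sqs_bounded:
  assumes "\<And>X. finite X \<Longrightarrow> (\<Sum>x\<in>X. (f x)\<^sup>2) \<le> B"
  shows "sqs f" "ip f f \<le> B"
proof -
  show s: "sqs f" unfolding sqs_def
    by (rule nonneg_bdd_above_summable_on) (use assms in \<open>auto intro!: bdd_aboveI[of _ B]\<close>)
  have "(\<Sum>\<^sub>\<infinity>x. (f x)\<^sup>2) \<le> B"
    by (rule infsum_le_finite_sums) (use assms s in \<open>auto simp: sqs_def\<close>)
  then show "ip f f \<le> B" by (simp add: ip_def power2_eq_square)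
qed

text \<open>By self-adjointness the squared norm of a truncated potential is a double sum of return
  probabilities, in which a total time n occurs n + 1 times. As \<open>g\<close> is not known to be
  square summable beforehand, the truncations serve both ways: from above on finite sets, and from
  below because they increase to \<open>24 * g\<close>.\<close>

lemma green_square_sum:
  assumes y: "y \<in> D" and g: "\<And>x. (\<lambda>n. walk D (pt_mass y) n x) sums (24 * g x)"
    and K: "(\<lambda>n. (real n + 1) * walk D (pt_mass y) n y) sums (576 * \<kappa>)"
  shows "((\<lambda>x. (g x)\<^sup>2) has_sum \<kappa>) UNIV"
proof -
  let ?w = "\<lambda>n x. walk D (pt_mass y) n x"
  have w0: "0 \<le> ?w n x" for n x by (intro walk_nonneg pt_mass_nonneg)
  define S where "S N x = (\<Sum>n<N. ?w n x)" for N x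
  have S_tends: "(\<lambda>N. S N x) \<longlonglongrightarrow> 24 * g x" for x using g[of x] by (simp add: sums_def S_def)
  have S_le: "S N x \<le> 24 * g x" for N x
    unfolding S_def using sums_unique[OF g[of x]] sum_le_suminf[OF sums_summable[OF g[of x]], of "{..<N}"] w0 by simp
  have S0: "0 \<le> S N x" for N x unfolding S_def by (intro sum_nonneg w0)
  have fsS: "fs (S N)" for N unfolding S_def by (intro fs_sum fs_walk) auto
  have ipS: "ip (S N) (S N) = (\<Sum>j<N. \<Sum>i<N. ?w (j + i) y)" for N
    unfolding S_def using ip_walk_pt[OF y y] by (subst ip_sum_sum) (auto intro!: fs_walk)
  have Kle: "(\<Sum>n<N. (real n + 1) * ?w n y) \<le> 576 * \<kappa>" for N
    using sum_le_suminf[OF sums_summable[OF K], of "{..<N}"] sums_unique[OF K] w0 by simp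
  have S_up: "ip (S N) (S N) \<le> 576 * \<kappa>" for N
    unfolding ipS using double_sum_le[of "\<lambda>n. ?w n y" N N] w0 Kle[of "N + N"] by simp
  have S_lo: "(\<Sum>n<N. (real n + 1) * ?w n y) \<le> ip (S N) (S N)" for N
    unfolding ipS using double_sum_ge[of "\<lambda>n. ?w n y" N] w0 by simp
  have S_fin: "(\<Sum>x\<in>X. (S N x)\<^sup>2) \<le> ip (S N) (S N)" if "finite X" for X N
    unfolding ip_def power2_eq_square
    by (rule finite_sum_le_infsum) (use that sqs_prod[OF fs_sqs[OF fsS] fs_sqs[OF fsS]] in auto)
  have bnd: "(\<Sum>x\<in>X. (g x)\<^sup>2) \<le> \<kappa>" if "finite X" for X
  proof (rule LIMSEQ_le_const2)
    show "(\<lambda>N. (\<Sum>x\<in>X. (S N x / 24)\<^sup>2)) \<longlonglongrightarrow> (\<Sum>x\<in>X. (g x)\<^sup>2)"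
    proof (intro tendsto_sum tendsto_power)
      fix x show "(\<lambda>N. S N x / 24) \<longlonglongrightarrow> g x"
        using tendsto_divide[OF S_tends[of x] tendsto_const[of 24]] by simp
    qed
    have "(\<Sum>x\<in>X. (S N x / 24)\<^sup>2) \<le> \<kappa>" for N
      using S_fin[OF that, of N] S_up[of N] by (simp add: power_divide flip: sum_divide_distrib)
    then show "\<exists>M. \<forall>N\<ge>M. (\<Sum>x\<in>X. (S N x / 24)\<^sup>2) \<le> \<kappa>" by blast
  qed
  note sg = sqs_bounded[OF bnd]
  have "576 * \<kappa> \<le> 576 * ip g g"
  proof (rule LIMSEQ_le_const2)
    show "(\<lambda>N. \<Sum>n<N. (real n + 1) * ?w n y) \<longlonglongrightarrow> 576 * \<kappa>" using K by (simp add: sums_def)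
    have "(\<Sum>n<N. (real n + 1) * ?w n y) \<le> 576 * ip g g" for N
    proof -
      have "ip (S N) (S N) \<le> ip (\<lambda>x. 24 * g x) (\<lambda>x. 24 * g x)"
        unfolding ip_def
      proof (rule infsum_mono)
        show "S N x * S N x \<le> 24 * g x * (24 * g x)" for x
          using S_le[of N x] S0[of N x] by (intro mult_mono) linarith+
      qed (intro sqs_prod fs_sqs fsS sqs_cmult sg)+
      also have "\<dots> = 576 * ip g g"
        unfolding ip_def by (subst infsum_cmult_right'[symmetric]) (simp add: algebra_simps)
      finally show ?thesis using S_lo[of N] by simp
    qed
    then show "\<exists>M. \<forall>N\<ge>M. (\<Sum>n<N. (real n + 1) * ?w n y) \<le> 576 * ip g g" by blast
  qed
  then have "ip g g = \<kappa>" using sg(2) by simp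
  then show ?thesis using has_sum_ip[of g \<kappa>] sqs_bounded(1)[of g \<kappa>] bnd by blast
qed

section \<open>Tabulated bounds in the small chambers\<close>

text \<open>Numerical subsolutions in a ball for the chambers of three and four reflections: \<open>tF4\<close> and \<open>tF3\<close>
  for a point source at the pole, \<open>tL4\<close> and \<open>tL3\<close> for the source \<open>tF4\<close> and
  \<open>tF3\<close>, and \<open>tFM\<close>, \<open>tLM\<close> for a symmetric pair of point sources.\<close>

definition tF4 :: table where "tF4 = [[],
    [[],[[],[422311189]]],
    [[],[],[[],[22578099],[0,7672659]]],
    [[],[[],[3315426]],[[],[],[3314124]],[[],[1690847],[0,1484298],[754746,531649]]],
    [[],[],[[],[631208],[0,852389]],[[],[],[459208],[0,321153]],[[],[162247],[0,198664]]],
    [[],[[],[97640]],[[],[],[149929]],[[],[83820]]]]"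
definition tL4 :: table where "tL4 = [[],
    [[],[[],[18168767]]],
    [[],[],[[],[2289881],[0,1286902]]],
    [[],[[],[518393]],[[],[],[602552]],[[],[316912],[0,373858],[197238,166444]]],
    [[],[],[[],[149588],[0,225704]],[[],[],[124135],[0,101661]],[[],[45439],[0,63378]]],
    [[],[[],[28463]],[[],[],[45591]],[[],[25760]]]]"
definition tF3 :: table where "tF3 = [[],
    [[],[[],[425757000,3443287,119964,6980]]],
    [[],[[],[23283870,695659,42233]],[[],[26154947,3566789,221843,13625],[8739872,1029067,86629]]],
    [[],[[],[5168670,1845450,131156,8200]],[[],[3923723,579189,52665],[5157972,1813419,247655]],[[],
      [2688499,974568,147829],[2094552,528811,62363],[1676355,849145,162906]]],
    [[],[[],[876617,223664,22036]],[[],[1282201,629108,104584],[1306471,367273,43897]],[[],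
      [738969,215345,26639],[1106664,582259,116490],[703230,231456]],[[],[435530,235513,49813],
      [486359,164217],[443998,257196],[212911]]],
    [[],[[],[266311,153256,31183]],[[],[314326,106952],[492979,281491,58402]],[[],[289389,166584,35119],
      [343020,116530],[317488,181769]],[[],[137575,48164],[217065,124720],[149441]],[[],[59163]]],
    [[],[[],[62106,21273]],[[],[99692,56137],[117244]],[[],[67976],[107523]]],
    [[],[[],[13481]]]]"
definition tL3 :: table where "tL3 = [[],
    [[],[[],[18734493,563897,40259,3476]]],
    [[],[[],[2478068,181284,18566]],[[],[3000830,704085,82251,6936],[1626914,315095,40267]]],
    [[],[[],[904702,381145,49956,4205]],[[],[806358,184811,24870],[1148270,526719,104545]],[[],
      [631394,300457,64050],[631357,209251,31240],[566326,329657,77553]]],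
    [[],[[],[239162,76800,10606]],[[],[367209,204773,46092],[422346,149572,22171]],[[],[248772,90637,13642],
      [392377,233775,56328],[289239,108451]],[[],[165245,100082,24841],[204893,78284],[197630,121661],[103186]]],
    [[],[[],[96134,59386,14308]],[[],[121464,46933],[196564,119823,28770]],[[],[118020,72569,17594],
      [148979,56099],[144267,86950]],[[],[61559,23847],[99597,60277],[73003]],[[],[27907]]],
    [[],[[],[27685,10042]],[[],[45217,26114],[54650]],[[],[31996],[51408]]],
    [[],[[],[6634]]]]"
definition tFM :: table where "tFM = [[],
    [[],[[],[429172967,3533093,83266]]],
    [[],[[],[46512934,23924276,666150]],[[],[29613210,3674337],[17260402,9550749,872779]]],
    [[],[[],[6931164,1887636]],[[],[7681554,4341716,464951],[6652884,1711862]],[[],[3417496,885684],[3675008,2146013],[1839396]]],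
    [[],[[],[1643787,977973]],[[],[1681591,530529],[2163943,1263402]],[[],[1145477,669001],[1120643]]],
    [[],[[],[281542]],[[],[386061]]]]"
definition tLM :: table where "tLM = [[],
    [[],[[],[19279266,585528,23854]]],
    [[],[[],[4918780,2623471,163096]],[[],[3634239,719980],[3115331,1810649,235269]]],
    [[],[[],[1233618,381899]],[[],[1511112,896370,127761],[1487455,452648]],[[],[793259,243340],[984808,591099],[544367]]],
    [[],[[],[414691,251304]],[[],[448298,149626],[608107,362277]],[[],[327524,195323],[339232]]],
    [[],[[],[87006]],[[],[122041]]]]"

definition val4 :: "table \<Rightarrow> int \<Rightarrow> int \<Rightarrow> int \<Rightarrow> int \<Rightarrow> int \<Rightarrow> int" where
  "val4 T R a b c d = (if a \<le> 0 \<or> b \<le> 0 \<or> c \<le> 0 \<or> d \<le> 0 \<or> R < nrm a b c d then 0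
     else entry_list T (ins a (ins b (ins c (ins d [])))))"

text \<open>With three reflections the last coordinate stays free, so only the first three are
  sorted and the last enters through its absolute value, in its own place.\<close>

definition val3 :: "table \<Rightarrow> int \<Rightarrow> int \<Rightarrow> int \<Rightarrow> int \<Rightarrow> int \<Rightarrow> int" where
  "val3 T R a b c d = (if a \<le> 0 \<or> b \<le> 0 \<or> c \<le> 0 \<or> R < nrm a b c d then 0
     else entry_list T (ins a (ins b (ins c [])) @ [\<bar>d\<bar>]))"

definition sorted3_all :: "(int \<Rightarrow> int \<Rightarrow> int \<Rightarrow> int \<Rightarrow> bool)
    \<Rightarrow> int \<Rightarrow> int \<Rightarrow> int \<Rightarrow> bool" where
  "sorted3_all P m N r = list_all (\<lambda>a. list_all (\<lambda>b. list_all (\<lambda>c. list_all (\<lambda>d.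
      N < nrm a b c d \<or> (a + b + c + d) mod 2 \<noteq> r \<or> P a b c d) [0..m]) [1..b]) [1..a]) [1..m]"

lemma sorted3_allD:
  assumes "sorted3_all P m N r" "0 \<le> d" "1 \<le> c" "c \<le> b" "b \<le> a" "nrm a b c d \<le> N"
    "(a + b + c + d) mod 2 = r" "N < (m + 1) * (m + 1)" "0 \<le> m"
  shows "P a b c d"
proof -
  have le: "t \<le> m" if "t * t \<le> nrm a b c d" "0 \<le> t" for t
  proof (rule ccontr)
    assume "\<not> t \<le> m"
    then have "(m + 1) * (m + 1) \<le> t * t" using assms(9) by (intro mult_mono) auto
    then show False using assms(6,8) that by linarith
  qed
  have "a \<le> m" by (rule le) (use assms in \<open>simp_all add: nrm_def\<close>)
  moreover have "d \<le> m" by (rule le) (use assms in \<open>simp_all add: nrm_def\<close>)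
  ultimately have mem: "a \<in> set [1..m]" "b \<in> set [1..a]" "c \<in> set [1..b]" "d \<in> set [0..m]"
    using assms(2-5) by simp_all
  have "N < nrm a b c d \<or> (a + b + c + d) mod 2 \<noteq> r \<or> P a b c d"
    using assms(1)[unfolded sorted3_all_def list_all_iff, THEN bspec, OF mem(1), THEN bspec, OF mem(2),
      THEN bspec, OF mem(3), THEN bspec, OF mem(4)] .
  then show ?thesis using assms(6,7) by linarith
qed

text \<open>In sorted order with \<open>d\<close> positive, \<open>a = 1\<close> is the pole. The
  check stops at the radius of the ball, because beyond it the tabulated functions vanish and
  satisfy the inequalities for free by \<open>lap_fun_zero\<close>.\<close>

lemma check4:
  "sorted_all (\<lambda>a b c d. d \<le> 0 \<or>
     24 * val4 tF4 40 a b c d \<le> nsum (val4 tF4 40) a b c d + (if a = 1 then 10000000000 else 0) \<and>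
     24 * val4 tL4 40 a b c d \<le> nsum (val4 tL4 40) a b c d + val4 tF4 40 a b c d) 6 40"
  by code_simp

text \<open>Translating along the last coordinate, the pole is put at \<open>(1, 1, 1, 0)\<close>, on the odd points, where
  the table is symmetric under the sign change of that coordinate.\<close>

lemma check3:
  "sorted3_all (\<lambda>a b c d.
     24 * val3 tF3 52 a b c d \<le> nsum (val3 tF3 52) a b c d + (if a = 1 \<and> d = 0 then 10000000000 else 0) \<and>
     24 * val3 tL3 52 a b c d \<le> nsum (val3 tL3 52) a b c d + val3 tF3 52 a b c d) 7 52 1"
  by code_simp

text \<open>The two poles \<open>(1, 1, 1, 1)\<close> and \<open>(1, 1, 1, -1)\<close> are even
  points exchanged by the last sign change, so after folding they are the single entry
  \<open>d = 1\<close> in parity class 0.\<close>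

lemma checkM:
  "sorted3_all (\<lambda>a b c d.
     24 * val3 tFM 32 a b c d \<le> nsum (val3 tFM 32) a b c d + (if a = 1 \<and> d = 1 then 10000000000 else 0) \<and>
     24 * val3 tLM 32 a b c d \<le> nsum (val3 tLM 32) a b c d + val3 tFM 32 a b c d) 5 32 0"
  by code_simp

lemma nonneg_tabs2:
  "nonneg_table tF4" "nonneg_table tL4" "nonneg_table tF3" "nonneg_table tL3" "nonneg_table tFM" "nonneg_table tLM"
  by code_simp+

lemma table_values:
  "val4 tL4 40 1 1 1 1 = 18168767" "val3 tL3 52 1 1 1 0 = 18734493" "val3 tLM 32 1 1 1 1 = 19279266"
  by code_simp+

section \<open>From the table checks to subsolutions in the chambers\<close>

lemma sort3_domain:
  assumes inv: "\<And>x. Q (swap12 x) \<Longrightarrow> Q x" "\<And>x. Q (swap23 x) \<Longrightarrow> Q x"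
    and Q: "\<And>a b c d. a \<ge> b \<Longrightarrow> b \<ge> c \<Longrightarrow> Q (a, b, c, d)"
  shows "Q (a, b, c, d)"
proof -
  have s12: "Q (b, a, c, d) \<Longrightarrow> Q (a, b, c, d)" for a b c d using inv(1)[of "(a,b,c,d)"] by (simp add: swap12_def)
  have s23: "Q (a, c, b, d) \<Longrightarrow> Q (a, b, c, d)" for a b c d using inv(2)[of "(a,b,c,d)"] by (simp add: swap23_def)
  have o2: "Q (a, b, c, d)" if "b \<ge> c" for a b c d
  proof -
    consider "a \<ge> b" | "b \<ge> a" "a \<ge> c" | "c \<ge> a" by linarith
    then show ?thesis
    proof cases
      case 1 then show ?thesis using that by (intro Q)
    next
      case 2 then show ?thesis using that by (intro s12[OF Q])
    next
      case 3 then show ?thesis using that by (intro s12[OF s23[OF Q]])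
    qed
  qed
  show ?thesis using o2[of c b a d] s23[OF o2[of b c a d]] by (cases "b \<ge> c") auto
qed

lemma sort4_domain:
  assumes inv: "\<And>x. Q (swap12 x) \<Longrightarrow> Q x" "\<And>x. Q (swap23 x) \<Longrightarrow> Q x"
      "\<And>x. Q (swap34 x) \<Longrightarrow> Q x"
    and Q: "\<And>a b c d. a \<ge> b \<Longrightarrow> b \<ge> c \<Longrightarrow> c \<ge> d \<Longrightarrow> Q (a, b, c, d)"
  shows "Q (a, b, c, d)"
proof -
  have s12: "Q (b, a, c, d) \<Longrightarrow> Q (a, b, c, d)" for a b c d using inv(1)[of "(a,b,c,d)"] by (simp add: swap12_def)
  have s23: "Q (a, c, b, d) \<Longrightarrow> Q (a, b, c, d)" for a b c d using inv(2)[of "(a,b,c,d)"] by (simp add: swap23_def)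
  have s34: "Q (a, b, d, c) \<Longrightarrow> Q (a, b, c, d)" for a b c d using inv(3)[of "(a,b,c,d)"] by (simp add: swap34_def)
  have o2: "Q (a, b, c, d)" if "b \<ge> c" "c \<ge> d" for a b c d
  proof -
    consider "a \<ge> b" | "b \<ge> a" "a \<ge> c" | "c \<ge> a" "a \<ge> d" | "d \<ge> a" by linarith
    then show ?thesis
    proof cases
      case 1 then show ?thesis using that by (intro Q)
    next
      case 2 then show ?thesis using that by (intro s12[OF Q])
    next
      case 3 then show ?thesis using that by (intro s12[OF s23[OF Q]])
    next
      case 4 then show ?thesis using that by (intro s12[OF s23[OF s34[OF Q]]])
    qed
  qed
  have o3: "Q (a, b, c, d)" if "c \<ge> d" for a b c d
  proof -
    consider "b \<ge> c" | "c \<ge> b" "b \<ge> d" | "d \<ge> b" by linarith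
    then show ?thesis
    proof cases
      case 1 then show ?thesis using that by (intro o2)
    next
      case 2 then show ?thesis using that by (intro s23[OF o2])
    next
      case 3 then show ?thesis using that by (intro s23[OF s34[OF o2]])
    qed
  qed
  show ?thesis using o3[of d c a b] s34[OF o3[of c d a b]] by (cases "c \<ge> d") auto
qed

definition fun4 :: "table \<Rightarrow> int \<Rightarrow> pt \<Rightarrow> real" where
  "fun4 T R = (\<lambda>(a, b, c, d). if even (a + b + c + d) then real_of_int (val4 T R a b c d) / 10^10 else 0)"

definition fun3 :: "table \<Rightarrow> int \<Rightarrow> int \<Rightarrow> pt \<Rightarrow> real" where
  "fun3 T R r = (\<lambda>(a, b, c, d). if even (a + b + c + d + r) then real_of_int (val3 T R a b c d) / 10^10 else 0)"

lemma fun4_sym: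
  "fun4 T R (swap12 x) = fun4 T R x" "fun4 T R (swap23 x) = fun4 T R x" "fun4 T R (swap34 x) = fun4 T R x"
proof -
  obtain a b c d where x: "x = (a, b, c, d)" by (cases x)
  have e: "b + a + c + d = a + b + c + d" "a + c + b + d = a + b + c + d" "a + b + d + c = a + b + c + d"
    by simp_all
  have n: "nrm b a c d = nrm a b c d" "nrm a c b d = nrm a b c d" "nrm a b d c = nrm a b c d"
    by (simp_all add: nrm_def)
  have v: "val4 T R b a c d = val4 T R a b c d" "val4 T R a c b d = val4 T R a b c d"
    "val4 T R a b d c = val4 T R a b c d"
  proof -
    have "(b \<le> 0 \<or> a \<le> 0 \<or> Z) = (a \<le> 0 \<or> b \<le> 0 \<or> Z)"
      "(a \<le> 0 \<or> c \<le> 0 \<or> b \<le> 0 \<or> Z) = (a \<le> 0 \<or> b \<le> 0 \<or> c \<le> 0 \<or> Z)"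
      "(a \<le> 0 \<or> b \<le> 0 \<or> d \<le> 0 \<or> c \<le> 0 \<or> Z) = (a \<le> 0 \<or> b \<le> 0 \<or>
          c \<le> 0 \<or> d \<le> 0 \<or> Z)" for Z
      by blast+
    then show "val4 T R b a c d = val4 T R a b c d" "val4 T R a c b d = val4 T R a b c d"
      "val4 T R a b d c = val4 T R a b c d"
      by (simp_all only: val4_def n ins_commute[of b a] ins_commute[of c b] ins_commute[of d c])
  qed
  show "fun4 T R (swap12 x) = fun4 T R x" "fun4 T R (swap23 x) = fun4 T R x" "fun4 T R (swap34 x) = fun4 T R x"
    by (simp_all only: x fun4_def swap12_def swap23_def swap34_def prod.case e v)
qed

lemma fun3_sym:
  "fun3 T R r (swap12 x) = fun3 T R r x" "fun3 T R r (swap23 x) = fun3 T R r x" "fun3 T R r (neg4 x) = fun3 T R r x"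
proof -
  obtain a b c d where x: "x = (a, b, c, d)" by (cases x)
  have e: "b + a + c + d = a + b + c + d" "a + c + b + d = a + b + c + d" by simp_all
  have m: "even (a + b + c + - d + r) = even (a + b + c + d + r)" by simp
  have n: "nrm b a c d = nrm a b c d" "nrm a c b d = nrm a b c d" "nrm a b c (- d) = nrm a b c d"
    by (simp_all add: nrm_def)
  have v: "val3 T R b a c d = val3 T R a b c d" "val3 T R a c b d = val3 T R a b c d"
    "val3 T R a b c (- d) = val3 T R a b c d"
  proof -
    have "(b \<le> 0 \<or> a \<le> 0 \<or> Z) = (a \<le> 0 \<or> b \<le> 0 \<or> Z)"
      "(a \<le> 0 \<or> c \<le> 0 \<or> b \<le> 0 \<or> Z) = (a \<le> 0 \<or> b \<le> 0 \<or> c \<le> 0 \<or> Z)" for Z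
      by blast+
    then show "val3 T R b a c d = val3 T R a b c d" "val3 T R a c b d = val3 T R a b c d"
      "val3 T R a b c (- d) = val3 T R a b c d"
      by (simp_all only: val3_def n ins_commute[of b a] ins_commute[of c b] abs_minus_cancel)
  qed
  show "fun3 T R r (swap12 x) = fun3 T R r x" "fun3 T R r (swap23 x) = fun3 T R r x"
    by (simp_all only: x fun3_def swap12_def swap23_def prod.case e v)
  show "fun3 T R r (neg4 x) = fun3 T R r x"
    by (simp only: x fun3_def neg4_def prod.case m v)
qed

lemma val_nonneg: "nonneg_table T \<Longrightarrow> 0 \<le> val4 T R a b c d" "nonneg_table T \<Longrightarrow> 0 \<le> val3 T R a b c d"
  by (simp_all add: val4_def val3_def entry_list_nonneg)

lemma fun_nonneg: "nonneg_table T \<Longrightarrow> 0 \<le> fun4 T R x" "nonneg_table T \<Longrightarrow> 0 \<le> fun3 T R r x"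
  by (cases x; simp add: fun4_def fun3_def val_nonneg)+

lemma chamber_eq:
  "chamber 1 = {(a, b, c, d). 0 < a}"
  "chamber 2 = {(a, b, c, d). 0 < a \<and> 0 < b}"
  "chamber 3 = {(a, b, c, d). 0 < a \<and> 0 < b \<and> 0 < c}"
  "chamber 4 = {(a, b, c, d). 0 < a \<and> 0 < b \<and> 0 < c \<and> 0 < d}"
  by (auto simp: chamber_def coord_def less_Suc_eq eval_nat_numeral)

lemma fun4_zero:
  assumes "x \<notin> chamber 4 \<or> R < nr x" shows "fun4 T R x = 0"
proof -
  obtain a b c d where x: "x = (a, b, c, d)" by (cases x)
  have "a \<le> 0 \<or> b \<le> 0 \<or> c \<le> 0 \<or> d \<le> 0 \<or> R < nrm a b c d"
    using assms unfolding x chamber_eq nr_nrm mem_Collect_eq prod.case by linarith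
  then have "val4 T R a b c d = 0" unfolding val4_def by (rule if_P)
  then show ?thesis by (simp add: x fun4_def)
qed

lemma fun3_zero:
  assumes "x \<notin> chamber 3 \<or> R < nr x" shows "fun3 T R r x = 0"
proof -
  obtain a b c d where x: "x = (a, b, c, d)" by (cases x)
  have "a \<le> 0 \<or> b \<le> 0 \<or> c \<le> 0 \<or> R < nrm a b c d"
    using assms unfolding x chamber_eq nr_nrm mem_Collect_eq prod.case by linarith
  then have "val3 T R a b c d = 0" unfolding val3_def by (rule if_P)
  then show ?thesis by (simp add: x fun3_def)
qed

lemma fun_fs: "fs (fun4 T R)" "fs (fun3 T R r)"
proof -
  have "{x. fun4 T R x \<noteq> 0} \<subseteq> {x. nr x \<le> R}" "{x. fun3 T R r x \<noteq> 0} \<subseteq> {x. nr x \<le> R}"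
    using fun4_zero[of _ R T] fun3_zero[of _ R T r] not_less by blast+
  then show "fs (fun4 T R)" "fs (fun3 T R r)"
    unfolding fs_def by (blast intro: finite_subset[OF _ finite_nr])+
qed

lemma fun_supp: "supp_in (chamber 4) (fun4 T R)" "supp_in (chamber 3) (fun3 T R r)"
  unfolding supp_in_def using fun4_zero fun3_zero by blast+

lemma nsum_cong_parity:
  fixes F :: "int \<Rightarrow> int \<Rightarrow> int \<Rightarrow> int \<Rightarrow> real"
  assumes "\<And>a b c d. even (a + b + c + d + r) \<Longrightarrow> F a b c d = H a b c d" "even (a + b + c + d + r)"
  shows "nsum F a b c d = nsum H a b c d"
  unfolding nsum_def by (intro arg_cong2[where f = plus] assms(1)) (use assms(2) in presburger)+

lemma nsum_scale: "nsum (\<lambda>a b c d. real_of_int (F a b c d) / 10^10) a b c d = real_of_int (nsum F a b c d) / 10^10"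
  by (simp add: nsum_def add_divide_distrib)

lemma nbr_fun4:
  assumes "even (a + b + c + d)"
  shows "nbr (fun4 T R) (a, b, c, d) = real_of_int (nsum (val4 T R) a b c d) / 10^10"
  unfolding nbr_nsum nsum_scale[symmetric]
  by (rule nsum_cong_parity[where r = 0]) (use assms in \<open>auto simp: fun4_def\<close>)

lemma nbr_fun3:
  assumes "even (a + b + c + d + r)"
  shows "nbr (fun3 T R r) (a, b, c, d) = real_of_int (nsum (val3 T R) a b c d) / 10^10"
  unfolding nbr_nsum nsum_scale[symmetric]
  by (rule nsum_cong_parity[where r = r]) (use assms in \<open>auto simp: fun3_def\<close>)

text \<open>A nonnegative function has nonpositive Laplacian wherever it vanishes. So cutting the
  tables off to zero at the walls and at a radius preserves the subsolution property.\<close>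

lemma lap_fun_zero:
  assumes "nonneg_table T"
  shows "fun4 T R x = 0 \<Longrightarrow> lap (fun4 T R) x \<le> 0" "fun3 T R r x = 0 \<Longrightarrow> lap (fun3 T R r) x \<le> 0"
  using nbr_nonneg[of "fun4 T R" x] nbr_nonneg[of "fun3 T R r" x] fun_nonneg[OF assms]
  by (auto simp: lap_def)

lemma sub4:
  "lap (fun4 tF4 40) x \<le> pt_mass (1,1,1,1) x" "lap (fun4 tL4 40) x \<le> fun4 tF4 40 x"
proof -
  let ?F = "fun4 tF4 40" and ?L = "fun4 tL4 40"
  let ?Q = "\<lambda>x. lap ?F x \<le> pt_mass (1,1,1,1) x \<and> lap ?L x \<le> ?F x"
  have pm: "pt_mass (1,1,1,1) (swap12 x) = pt_mass (1,1,1,1) x" "pt_mass (1,1,1,1) (swap23 x) = pt_mass (1,1,1,1) x"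
    "pt_mass (1,1,1,1) (swap34 x) = pt_mass (1,1,1,1) x" for x
    by (cases x; auto simp: pt_mass_def swap12_def swap23_def swap34_def)+
  obtain a b c d where x: "x = (a, b, c, d)" by (cases x)
  have "?Q (a, b, c, d)"
  proof (rule sort4_domain[where Q = ?Q])
    fix a b c d :: int assume o: "a \<ge> b" "b \<ge> c" "c \<ge> d"
    let ?x = "(a, b, c, d)"
    have pm0: "0 \<le> pt_mass (1,1,1,1) ?x" by (rule pt_mass_nonneg)
    show "?Q ?x"
    proof (cases "0 < d \<and> even (a + b + c + d) \<and> nrm a b c d \<le> 40")
      case False
      have z: "fun4 T 40 ?x = 0" for T
      proof (cases "even (a + b + c + d)")
        case True
        then have "?x \<notin> chamber 4 \<or> 40 < nr ?x"
          using False o unfolding chamber_eq nr_nrm mem_Collect_eq prod.case by linarith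
        then show ?thesis by (rule fun4_zero)
      qed (simp only: fun4_def prod.case if_False)
      show ?thesis
        using lap_fun_zero(1)[OF nonneg_tabs2(1) z] lap_fun_zero(1)[OF nonneg_tabs2(2) z] pm0
          fun_nonneg(1)[OF nonneg_tabs2(1)] order_trans by (metis (no_types, lifting))
    next
      case True
      then have ev: "even (a + b + c + d)" by blast
      have chk: "24 * val4 tF4 40 a b c d \<le> nsum (val4 tF4 40) a b c d + (if a = 1 then 10000000000 else 0)"
        "24 * val4 tL4 40 a b c d \<le> nsum (val4 tL4 40) a b c d + val4 tF4 40 a b c d"
        using sorted_allD[OF check4 _ o(3) o(2) o(1), of] True by auto
      have pmx: "pt_mass (1,1,1,1) ?x = (if a = 1 then 1 else 0)"
        using True o by (auto simp: pt_mass_def)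
      have r: "real_of_int (24 * val4 tF4 40 a b c d) \<le> real_of_int (nsum (val4 tF4 40) a b c d + (if a = 1 then 10000000000 else 0))"
        "real_of_int (24 * val4 tL4 40 a b c d) \<le> real_of_int (nsum (val4 tL4 40) a b c d + val4 tF4 40 a b c d)"
        using chk by (simp_all only: of_int_le_iff)
      have v: "fun4 T 40 ?x = real_of_int (val4 T 40 a b c d) / 10^10" for T
        by (simp only: fun4_def prod.case ev if_True)
      have "lap ?F ?x \<le> pt_mass (1,1,1,1) ?x"
        using r(1) unfolding lap_def nbr_fun4[OF ev] v pmx by (simp split: if_splits)
      moreover have "lap ?L ?x \<le> ?F ?x"
        using r(2) unfolding lap_def nbr_fun4[OF ev] v by simp
      ultimately show ?thesis by blast
    qed
  qed (simp_all only: swap12.lap_sym swap23.lap_sym swap34.lap_sym fun4_sym pm)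
  then show "lap ?F x \<le> pt_mass (1,1,1,1) x" "lap ?L x \<le> ?F x" by (auto simp: x)
qed

text \<open>Covers both sources in the third chamber: the pole \<open>(1, 1, 1, 0)\<close> on the
  odd points (\<open>r = 1\<close>, \<open>e = 0\<close>) and the symmetric pair on the even points
  (\<open>r = 0\<close>, \<open>e = 1\<close>). Everything is even in the last coordinate, so
  nonnegative \<open>d\<close> suffices.\<close>

lemma sub3_gen:
  fixes s :: "pt \<Rightarrow> real"
  assumes chk: "sorted3_all (\<lambda>a b c d.
     24 * val3 tF R a b c d \<le> nsum (val3 tF R) a b c d + (if a = 1 \<and> d = e then 10000000000 else 0) \<and>
     24 * val3 tL R a b c d \<le> nsum (val3 tL R) a b c d + val3 tF R a b c d) m R r"
    and nn: "nonneg_table tF" "nonneg_table tL" and m: "R < (m + 1) * (m + 1)" "0 \<le> m"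
    and r01: "r = 0 \<or> r = 1"
    and s: "\<And>x. s (swap12 x) = s x" "\<And>x. s (swap23 x) = s x" "\<And>x. s (neg4 x) = s x" "\<And>x. 0 \<le> s x"
      "s (1, 1, 1, e) = 1"
  shows "lap (fun3 tF R r) x \<le> s x" "lap (fun3 tL R r) x \<le> fun3 tF R r x"
proof -
  let ?F = "fun3 tF R r" and ?L = "fun3 tL R r"
  let ?Q = "\<lambda>x. lap ?F x \<le> s x \<and> lap ?L x \<le> ?F x"
  have main: "?Q (a, b, c, d)" if o: "a \<ge> b" "b \<ge> c" "d \<ge> 0" for a b c d
  proof -
    let ?x = "(a, b, c, d)"
    show "?Q ?x"
    proof (cases "0 < c \<and> even (a + b + c + d + r) \<and> nrm a b c d \<le> R")
      case False
      have z: "fun3 T R r ?x = 0" for T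
      proof (cases "even (a + b + c + d + r)")
        case True
        then have "?x \<notin> chamber 3 \<or> R < nr ?x"
          using False o unfolding chamber_eq nr_nrm mem_Collect_eq prod.case by linarith
        then show ?thesis by (rule fun3_zero)
      qed (simp only: fun3_def prod.case if_False)
      show ?thesis
        using lap_fun_zero(2)[OF nn(1) z] lap_fun_zero(2)[OF nn(2) z] s(4)[of ?x]
          fun_nonneg(2)[OF nn(1)] order_trans by (metis (no_types, lifting))
    next
      case True
      then have ev: "even (a + b + c + d + r)" by blast
      then have md: "(a + b + c + d) mod 2 = r" using r01 by presburger
      have c: "24 * val3 tF R a b c d \<le> nsum (val3 tF R) a b c d + (if a = 1 \<and> d = e then 10000000000 else 0)"
        "24 * val3 tL R a b c d \<le> nsum (val3 tL R) a b c d + val3 tF R a b c d"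
        using sorted3_allD[OF chk o(3) _ o(2) o(1) _ md m] True by auto
      have "s ?x = 1" if "a = 1 \<and> d = e"
      proof -
        have "b = 1" "c = 1" using that o True by linarith+
        then show ?thesis using that s(5) by simp
      qed
      then have sx: "(if a = 1 \<and> d = e then 1 else 0) \<le> s ?x" using s(4) by auto
      have r: "real_of_int (24 * val3 tF R a b c d) \<le> real_of_int (nsum (val3 tF R) a b c d + (if a = 1
          \<and> d = e then 10000000000 else 0))"
        "real_of_int (24 * val3 tL R a b c d) \<le> real_of_int (nsum (val3 tL R) a b c d + val3 tF R a b c d)"
        using c by (simp_all only: of_int_le_iff)
      have v: "fun3 T R r ?x = real_of_int (val3 T R a b c d) / 10^10" for T
        by (simp only: fun3_def prod.case ev if_True)
      have "lap ?F ?x \<le> (if a = 1 \<and> d = e then 1 else 0)"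
        using r(1) unfolding lap_def nbr_fun3[OF ev] v
        by (cases "a = 1 \<and> d = e") (simp_all only: if_True if_False, simp_all)
      moreover have "lap ?L ?x \<le> ?F ?x"
        using r(2) unfolding lap_def nbr_fun3[OF ev] v by simp
      ultimately show ?thesis using sx by linarith
    qed
  qed
  obtain a b c d where x: "x = (a, b, c, d)" by (cases x)
  have "?Q (a, b, c, d)"
  proof (rule sort3_domain[where Q = ?Q])
    fix a b c d :: int assume o: "a \<ge> b" "b \<ge> c"
    have "?Q (neg4 (a, b, c, d)) \<Longrightarrow> ?Q (a, b, c, d)"
      by (simp only: neg4.lap_sym fun3_sym s)
    then show "?Q (a, b, c, d)"
      using main[OF o, of d] main[OF o, of "- d"] by (cases "d \<ge> 0") (auto simp: neg4_def)
  qed (simp_all only: swap12.lap_sym swap23.lap_sym fun3_sym s)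
  then show "lap ?F x \<le> s x" "lap ?L x \<le> ?F x" by (auto simp: x)
qed

section \<open>Squared norms of the extremal functions\<close>

lemma look_values: "look4 tabh 0 0 0 0 = 460778957" "look4 tabl 0 0 0 0 = 460764050" "look4 tabh 1 1 0 0 =
    44112288" "look4 tabl 1 1 0 0 = 44097385" "look4 tabh 2 0 0 0 = 20192978" "look4 tabl 2 0 0 0 = 20178081"
    "look4 tabh 1 1 1 1 = 20192978" "look4 tabl 1 1 1 1 = 20178081" "look4 tabh 2 1 1 0 = 14124227" "look4
    tabl 2 1 1 0 = 14109335" "look4 tabh 2 2 0 0 = 10865903" "look4 tabl 2 2 0 0 = 10851018" "look4 tabh 2 2
    2 0 = 7038006" "look4 tabl 2 2 2 0 = 7023128" "look4 tabh 2 2 2 2 = 5263338" "look4 tabl 2 2 2 2 = 5248449"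
  by code_simp+

lemma G_bounds:
  "460764050 / 10^10 \<le> G (0,0,0,0)" "G (0,0,0,0) \<le> 460778957 / 10^10"
  "44097385 / 10^10 \<le> G (1,1,0,0)" "G (1,1,0,0) \<le> 44112288 / 10^10"
  "20178081 / 10^10 \<le> G (2,0,0,0)" "G (2,0,0,0) \<le> 20192978 / 10^10"
  "20178081 / 10^10 \<le> G (1,1,1,1)" "G (1,1,1,1) \<le> 20192978 / 10^10"
  "14109335 / 10^10 \<le> G (2,1,1,0)" "G (2,1,1,0) \<le> 14124227 / 10^10"
  "10851018 / 10^10 \<le> G (2,2,0,0)" "G (2,2,0,0) \<le> 10865903 / 10^10"
  "7023128 / 10^10 \<le> G (2,2,2,0)" "G (2,2,2,0) \<le> 7038006 / 10^10"
  "5248449 / 10^10 \<le> G (2,2,2,2)" "G (2,2,2,2) \<le> 5263338 / 10^10"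
  using l_le_G[of "(0,0,0,0)"] G_le_h[of "(0,0,0,0)"] l_le_G[of "(1,1,0,0)"] G_le_h[of "(1,1,0,0)"]
    l_le_G[of "(2,0,0,0)"] G_le_h[of "(2,0,0,0)"] l_le_G[of "(1,1,1,1)"] G_le_h[of "(1,1,1,1)"]
    l_le_G[of "(2,1,1,0)"] G_le_h[of "(2,1,1,0)"] l_le_G[of "(2,2,0,0)"] G_le_h[of "(2,2,0,0)"]
    l_le_G[of "(2,2,2,0)"] G_le_h[of "(2,2,2,0)"] l_le_G[of "(2,2,2,2)"] G_le_h[of "(2,2,2,2)"]
  by (simp_all add: gfun_def look_values nrm_def)

text \<open>The Laplace equation at the origin. This exact relation removes
  \<open>G (1,1,0,0)\<close>, which carries the largest coefficients in \<open>kap2\<close> and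
  \<open>kap3\<close>, from the interval estimates.\<close>

lemma G_root: "G (1,1,0,0) = G (0,0,0,0) - 1/24"
proof -
  have "lap G (0,0,0,0) = 1" unfolding lap_G by (simp add: pt_mass_def zero_prod_def)
  moreover have "nbr G (0,0,0,0) = 24 * sl G [1,1,0,0]"
    by (simp add: nbr_nsum nsum_def symm_sl[OF symm_G])
  ultimately show ?thesis by (simp add: lap_def sl.simps)
qed

lemma walk_nn: "0 \<le> walk D (pt_mass y) n x"
  by (intro walk_nonneg pt_mass_nonneg)

lemma chamber_return:
  "walk (chamber 1) (pt_mass (1,b,c,d)) n (1,b,c,d) = p n (0,0,0,0) - p n (2,0,0,0)"
  "walk (chamber 2) (pt_mass (1,1,c,d)) n (1,1,c,d) = p n (0,0,0,0) - 2 * p n (2,0,0,0) + p n (2,2,0,0)"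
  "walk (chamber 3) (pt_mass (1,1,1,d)) n (1,1,1,d)
    = p n (0,0,0,0) - 3 * p n (2,0,0,0) + 3 * p n (2,2,0,0) - p n (2,2,2,0)"
proof -
  have y: "(1,b,c,d) \<in> chamber 1" "(1,1,c,d) \<in> chamber 2" "(1,1,1,d) \<in> chamber 3"
    unfolding chamber_eq by simp_all
  show "walk (chamber 1) (pt_mass (1,b,c,d)) n (1,b,c,d) = p n (0,0,0,0) - p n (2,0,0,0)"
    by (rule trans[OF walk_chamber[OF _ y(1) y(1)] ws_return(1)[OF symm_p]]) simp
  show "walk (chamber 2) (pt_mass (1,1,c,d)) n (1,1,c,d) = p n (0,0,0,0) - 2 * p n (2,0,0,0) + p n (2,2,0,0)"
    by (rule trans[OF walk_chamber[OF _ y(2) y(2)] ws_return(2)[OF symm_p]]) simp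
  show "walk (chamber 3) (pt_mass (1,1,1,d)) n (1,1,1,d)
    = p n (0,0,0,0) - 3 * p n (2,0,0,0) + 3 * p n (2,2,0,0) - p n (2,2,2,0)"
    by (rule trans[OF walk_chamber[OF _ y(3) y(3)] ws_return(3)[OF symm_p]]) simp
qed

definition kap1 :: real where "kap1 = (8/7 * G (0,0,0,0) + 6/7 * G (2,0,0,0) - 2/7 * G (1,1,1,1)) / 24"
definition kap2 :: real where
  "kap2 = (24/7 * G (0,0,0,0) - 24 * G (1,1,0,0) + 4/7 * G (2,0,0,0) - 20/7 * G (1,1,1,1)) / 24"
definition kap3 :: real where
  "kap3 = (16 * G (0,0,0,0) - 120 * G (1,1,0,0) - 8 * G (2,0,0,0) - 56 * G (1,1,1,1) - 24 * G (2,1,1,0)) / 24"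

lemma kap1_sums:
  "(\<lambda>n. (real n + 1) * walk (chamber 1) (pt_mass (1,b,c,d)) n (1,b,c,d)) sums (576 * kap1)"
proof (rule sums_of_identity)
  show "0 \<le> (real n + 1) * walk (chamber 1) (pt_mass (1,b,c,d)) n (1,b,c,d)" for n
    by (intro mult_nonneg_nonneg walk_nn) simp
  have "(\<lambda>N. 8/7 * gg N (0,0,0,0) + 6/7 * gg N (2,0,0,0) - 2/7 * gg N (1,1,1,1)) \<longlonglongrightarrow>
      8/7 * (24 * G (0,0,0,0)) + 6/7 * (24 * G (2,0,0,0)) - 2/7 * (24 * G (1,1,1,1))"
    by (intro tendsto_add tendsto_diff tendsto_mult tendsto_const gg_tendsto)
  moreover have "8/7 * (24 * G (0,0,0,0)) + 6/7 * (24 * G (2,0,0,0)) - 2/7 * (24 * G (1,1,1,1)) = 576 * kap1"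
      by (simp add: kap1_def add_divide_distrib diff_divide_distrib)
  ultimately show "(\<lambda>N. 8/7 * gg N (0,0,0,0) + 6/7 * gg N (2,0,0,0) - 2/7 * gg N (1,1,1,1)) \<longlonglongrightarrow> 576 * kap1"
    by simp
  fix N
  have "(\<Sum>n<N. (real n + 1) * walk (chamber 1) (pt_mass (1,b,c,d)) n (1,b,c,d))
      = TT N (0,0,0,0) - TT N (2,0,0,0)"
    unfolding chamber_return TT_def by (simp add: right_diff_distrib sum_subtractf del: walk.simps)
  then show "\<bar>(\<Sum>n<N. (real n + 1) * walk (chamber 1) (pt_mass (1,b,c,d)) n (1,b,c,d))
      - (8/7 * gg N (0,0,0,0) + 6/7 * gg N (2,0,0,0) - 2/7 * gg N (1,1,1,1))\<bar> \<le> 500 * err N"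
    using TT_identities(1)[of N] by simp
qed

lemma kap2_sums:
  "(\<lambda>n. (real n + 1) * walk (chamber 2) (pt_mass (1,1,c,d)) n (1,1,c,d)) sums (576 * kap2)"
proof (rule sums_of_identity)
  show "0 \<le> (real n + 1) * walk (chamber 2) (pt_mass (1,1,c,d)) n (1,1,c,d)" for n
    by (intro mult_nonneg_nonneg walk_nn) simp
  have "(\<lambda>N. 24/7 * gg N (0,0,0,0) - 24 * gg N (1,1,0,0) + 4/7 * gg N (2,0,0,0) - 20/7 * gg N (1,1,1,1)) \<longlonglongrightarrow>
      24/7 * (24 * G (0,0,0,0)) - 24 * (24 * G (1,1,0,0)) + 4/7 * (24 * G (2,0,0,0)) - 20/7 * (24 * G (1,1,1,1))"
    by (intro tendsto_add tendsto_diff tendsto_mult tendsto_const gg_tendsto)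
  moreover have "24/7 * (24 * G (0,0,0,0)) - 24 * (24 * G (1,1,0,0)) + 4/7 * (24 * G (2,0,0,0)) - 20/7 * (24
      * G (1,1,1,1)) = 576 * kap2" by (simp add: kap2_def add_divide_distrib diff_divide_distrib)
  ultimately show "(\<lambda>N. 24/7 * gg N (0,0,0,0) - 24 * gg N (1,1,0,0) + 4/7 * gg N (2,0,0,0) - 20/7 *
      gg N (1,1,1,1)) \<longlonglongrightarrow> 576 * kap2"
    by simp
  fix N
  have "(\<Sum>n<N. (real n + 1) * walk (chamber 2) (pt_mass (1,1,c,d)) n (1,1,c,d))
      = TT N (0,0,0,0) - 2 * TT N (2,0,0,0) + TT N (2,2,0,0)"
    unfolding chamber_return TT_def
    by (simp add: algebra_simps sum.distrib sum_subtractf sum_distrib_left del: walk.simps)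
  then show "\<bar>(\<Sum>n<N. (real n + 1) * walk (chamber 2) (pt_mass (1,1,c,d)) n (1,1,c,d))
      - (24/7 * gg N (0,0,0,0) - 24 * gg N (1,1,0,0) + 4/7 * gg N (2,0,0,0) - 20/7 * gg N (1,1,1,1))\<bar> \<le> 500 * err N"
    using TT_identities(2)[of N] by simp
qed

lemma kap3_sums:
  "(\<lambda>n. (real n + 1) * walk (chamber 3) (pt_mass (1,1,1,d)) n (1,1,1,d)) sums (576 * kap3)"
proof (rule sums_of_identity)
  show "0 \<le> (real n + 1) * walk (chamber 3) (pt_mass (1,1,1,d)) n (1,1,1,d)" for n
    by (intro mult_nonneg_nonneg walk_nn) simp
  have "(\<lambda>N. 16 * gg N (0,0,0,0) - 120 * gg N (1,1,0,0) - 8 * gg N (2,0,0,0) - 56 * gg N (1,1,1,1) -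
      24 * gg N (2,1,1,0)) \<longlonglongrightarrow>
      16 * (24 * G (0,0,0,0)) - 120 * (24 * G (1,1,0,0)) - 8 * (24 * G (2,0,0,0)) - 56 * (24 * G (1,1,1,1)) - 24 * (24 * G (2,1,1,0))"
    by (intro tendsto_add tendsto_diff tendsto_mult tendsto_const gg_tendsto)
  moreover have "16 * (24 * G (0,0,0,0)) - 120 * (24 * G (1,1,0,0)) - 8 * (24 * G (2,0,0,0)) - 56 * (24 * G
      (1,1,1,1)) - 24 * (24 * G (2,1,1,0)) = 576 * kap3" by (simp add: kap3_def add_divide_distrib diff_divide_distrib)
  ultimately show "(\<lambda>N. 16 * gg N (0,0,0,0) - 120 * gg N (1,1,0,0) - 8 * gg N (2,0,0,0) - 56 * gg N
      (1,1,1,1) - 24 * gg N (2,1,1,0)) \<longlonglongrightarrow> 576 * kap3"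
    by simp
  fix N
  have "(\<Sum>n<N. (real n + 1) * walk (chamber 3) (pt_mass (1,1,1,d)) n (1,1,1,d))
      = TT N (0,0,0,0) - 3 * TT N (2,0,0,0) + 3 * TT N (2,2,0,0) - TT N (2,2,2,0)"
    unfolding chamber_return TT_def
    by (simp add: algebra_simps sum.distrib sum_subtractf sum_distrib_left del: walk.simps)
  then show "\<bar>(\<Sum>n<N. (real n + 1) * walk (chamber 3) (pt_mass (1,1,1,d)) n (1,1,1,d))
      - (16 * gg N (0,0,0,0) - 120 * gg N (1,1,0,0) - 8 * gg N (2,0,0,0) - 56 * gg N (1,1,1,1) - 24 * gg N
          (2,1,1,0))\<bar> \<le> 500 * err N"
    using TT_identities(3)[of N] by simp
qed

lemma kap1_bounds: "22421398/10^10 \<le> kap1" "kap1 \<le> 22422818/10^10"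
  using G_bounds unfolding kap1_def by simp_all

lemma kap2_bounds: "19789779/10^10 \<le> kap2" "kap2 \<le> 19804686/10^10"
  using G_bounds unfolding kap2_def G_root by simp_all

lemma kap3_upper: "kap3 \<le> 18771566/10^10"
  using G_bounds unfolding kap3_def G_root by simp_all

lemma walk_vanish:
  assumes "k \<le> 4" "y \<in> chamber k"
  shows "(\<lambda>n. walk (chamber k) (pt_mass y) n x) \<longlonglongrightarrow> 0"
proof (cases "x \<in> chamber k")
  case True
  then show ?thesis using walk_chamber_sums[OF assms True] sums_summable summable_LIMSEQ_zero by blast
next
  case False
  have "supp_in (chamber k) (pt_mass y)" using assms(2) by (auto simp: supp_in_def pt_mass_def)
  then show ?thesis using supp_inD[OF walk_supp False] by simp
qed

lemma subsolution_chamber: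
  assumes k: "k \<le> 4" and y: "y \<in> chamber k"
    and F: "fs F" "supp_in (chamber k) F" and L: "fs L" "supp_in (chamber k) L"
    and FL: "\<And>x. lap F x \<le> pt_mass y x" "\<And>x. lap L x \<le> F x"
    and K: "(\<lambda>n. (real n + 1) * walk (chamber k) (pt_mass y) n y) sums (576 * \<kappa>)"
  shows "L y \<le> \<kappa>"
proof -
  have ipy: "ip (walk (chamber k) (pt_mass y) n) (pt_mass y) = walk (chamber k) (pt_mass y) n y" for n
    by (subst ip_commute) (rule ip_pt_mass)
  have sup: "supp_in (chamber k) (pt_mass y)" using y by (auto simp: supp_in_def pt_mass_def)
  have "ip (pt_mass y) L \<le> (\<Sum>n. (real n + 1) * ip (walk (chamber k) (pt_mass y) n) (pt_mass y)) / 576"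
  proof (rule subsolution_pair[OF fs_pt_mass sup pt_mass_nonneg F L FL walk_vanish[OF k y]])
    show "summable (\<lambda>n. (real n + 1) * ip (walk (chamber k) (pt_mass y) n) (pt_mass y))"
      unfolding ipy by (rule sums_summable[OF K])
  qed
  then show ?thesis unfolding ipy ip_pt_mass sums_unique[OF K, symmetric] by simp
qed

text \<open>The formula for \<open>kap3\<close> magnifies the table errors about eightfold. From
  below this loss would exceed the claimed tolerance, so the subsolution table replaces it.\<close>

lemma kap3_lower: "18734493/10^10 \<le> kap3"
proof -
  let ?y = "(1,1,1,0) :: pt"
  have sub: "lap (fun3 tF3 52 1) x \<le> pt_mass ?y x" "lap (fun3 tL3 52 1) x \<le> fun3 tF3 52 1 x" for x
    by (rule sub3_gen[OF check3 nonneg_tabs2(3,4), where s = "pt_mass ?y"];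
        (cases x rule: prod_cases4)?; force simp: pt_mass_def swap12_def swap23_def neg4_def)+
  have "fun3 tL3 52 1 ?y \<le> kap3"
    by (rule subsolution_chamber[OF _ _ fun_fs(2) fun_supp(2) fun_fs(2) fun_supp(2) sub kap3_sums[of 0]])
      (simp_all add: chamber_eq)
  then show ?thesis by (simp add: fun3_def table_values)
qed

definition y4 :: pt where "y4 = (1,1,1,1)"
definition y4' :: pt where "y4' = (1,1,1,-1)"

lemma y4_in: "y4 \<in> chamber 4" "y4 \<in> chamber 3" "y4' \<in> chamber 3"
  by (simp_all add: chamber_eq y4_def y4'_def)

lemma walk4_le: "walk (chamber 4) (pt_mass y4) n x \<le> walk (chamber 3) (pt_mass y4) n x"
  by (rule walk_mono_dom) (auto simp: chamber_eq pt_mass_nonneg)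

definition kap4 :: real where
  "kap4 = (\<Sum>n. (real n + 1) * walk (chamber 4) (pt_mass y4) n y4) / 576"

lemma kap3_sums': "(\<lambda>n. (real n + 1) * walk (chamber 3) (pt_mass y4) n y4) sums (576 * kap3)"
  "(\<lambda>n. (real n + 1) * walk (chamber 3) (pt_mass y4') n y4') sums (576 * kap3)"
  unfolding y4_def y4'_def by (rule kap3_sums)+

lemma kap4_sums: "(\<lambda>n. (real n + 1) * walk (chamber 4) (pt_mass y4) n y4) sums (576 * kap4)"
proof -
  have "summable (\<lambda>n. (real n + 1) * walk (chamber 4) (pt_mass y4) n y4)"
  proof (rule summable_comparison_test'[OF sums_summable[OF kap3_sums'(1)]])
    fix n
    show "norm ((real n + 1) * walk (chamber 4) (pt_mass y4) n y4) \<le> (real n + 1) * walk (chamber 3) (pt_mass y4) n y4"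
      using walk4_le[of n y4] walk_nn[of "chamber 4" y4 n y4] by (simp add: abs_mult mult_left_mono)
  qed
  then show ?thesis using summable_sums by (simp add: kap4_def)
qed

lemma kap4_lower: "18168767/10^10 \<le> kap4"
proof -
  have "fun4 tL4 40 y4 \<le> kap4"
    by (rule subsolution_chamber[OF _ y4_in(1) fun_fs(1) fun_supp(1) fun_fs(1) fun_supp(1) _ _ kap4_sums])
      (use sub4 in \<open>simp_all add: y4_def\<close>)
  then show ?thesis by (simp add: fun4_def table_values y4_def)
qed

text \<open>Symmetrising and antisymmetrising the Green function of the third chamber in the last
  coordinate: the antisymmetric part is the Green function of the fourth chamber, so a lower bound
  for the symmetric part is an upper bound for \<open>kap4\<close>.\<close>

lemma kap4_upper: "kap4 \<le> 2 * kap3 - 19279266/10^10"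
proof -
  let ?C = "chamber 3"
  let ?a = "\<lambda>n. walk ?C (pt_mass y4) n y4" and ?b = "\<lambda>n. walk ?C (pt_mass y4) n y4'"
  define s where "s x = pt_mass y4 x + pt_mass y4' x" for x
  have refl: "walk (chamber 4) (pt_mass y4) n y4 = ?a n - ?b n" for n
  proof -
    have "walk (chamber (Suc 3)) (pt_mass y4) n y4 = ws (Suc 3) (\<lambda>x. p n (x - y4)) y4"
      by (rule walk_chamber) (use y4_in in simp_all)
    also have "\<dots> = ws 3 (\<lambda>x. p n (x - y4)) y4 - ws 3 (\<lambda>x. p n (x - y4)) y4'"
      unfolding ws.simps by (simp add: negs_def neg4_def y4_def y4'_def)
    also have "\<dots> = ?a n - ?b n"
      using walk_chamber[OF _ y4_in(2) y4_in(2), of n] walk_chamber[OF _ y4_in(2) y4_in(3), of n] by simp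
    finally show ?thesis by simp
  qed
  have b_sums: "(\<lambda>n. (real n + 1) * ?b n) sums (576 * kap3 - 576 * kap4)"
    using sums_diff[OF kap3_sums'(1) kap4_sums] unfolding refl by (simp add: algebra_simps)
  have ip_s: "ip (walk ?C s n) s = 2 * ?a n + 2 * ?b n" for n
  proof -
    have "ip (walk ?C s n) s = ip s (walk ?C s n)" by (rule ip_commute)
    also have "\<dots> = walk ?C s n y4 + walk ?C s n y4'"
    proof -
      have "ip s f = f y4 + f y4'" for f
        by (subst ip_finite[of "{y4, y4'}"]) (auto simp: s_def pt_mass_def y4_def y4'_def)
      then show ?thesis .
    qed
    also have "\<dots> = (?a n + walk ?C (pt_mass y4') n y4) + (?b n + walk ?C (pt_mass y4') n y4')"
      unfolding s_def walk_add ..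
    also have "walk ?C (pt_mass y4') n y4 = ?b n" by (rule walk_commute[OF y4_in(3,2)])
    also have "walk ?C (pt_mass y4') n y4' = ?a n"
      unfolding y4_def y4'_def chamber_return ..
    finally show ?thesis by simp
  qed
  \<comment> \<open>The two poles have equal return terms \<open>?a\<close> and equal cross terms
    \<open>?b\<close>. By \<open>refl\<close> the weighted sum of \<open>?b\<close> is that of the
    third chamber minus that of the fourth, so the symmetric potential has squared norm
    \<open>2 * kap3 + 2 * (kap3 - kap4)\<close>.\<close>
  have sums: "(\<lambda>n. (real n + 1) * ip (walk ?C s n) s) sums (2 * (576 * kap3) + 2 * (576 * kap3 - 576 * kap4))"
    unfolding ip_s using sums_add[OF sums_mult[OF kap3_sums'(1), of 2] sums_mult[OF b_sums, of 2]]
    by (simp add: algebra_simps)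
  have s_sym: "s (swap12 x) = s x" "s (swap23 x) = s x" "s (neg4 x) = s x" for x
    by (cases x rule: prod_cases4; auto simp: s_def pt_mass_def swap12_def swap23_def neg4_def y4_def y4'_def)+
  have s0: "0 \<le> s x" for x by (simp add: s_def pt_mass_nonneg)
  have sub: "lap (fun3 tFM 32 0) x \<le> s x" "lap (fun3 tLM 32 0) x \<le> fun3 tFM 32 0 x" for x
    by (rule sub3_gen[OF checkM nonneg_tabs2(5,6)]; (rule s_sym s0)?;
        simp add: s_def pt_mass_def y4_def y4'_def)+
  have "ip s (fun3 tLM 32 0) \<le> (\<Sum>n. (real n + 1) * ip (walk ?C s n) s) / 576"
  proof (rule subsolution_pair[where F = "fun3 tFM 32 0"])
    show "fs s" unfolding s_def by (intro fs_add fs_pt_mass)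
    show "supp_in ?C s" using y4_in by (auto simp: supp_in_def s_def pt_mass_def)
    show "(\<lambda>n. walk ?C s n x) \<longlonglongrightarrow> 0" for x
    proof -
      have "(\<lambda>n. walk ?C (pt_mass y4) n x + walk ?C (pt_mass y4') n x) \<longlonglongrightarrow> 0 + 0"
        by (intro tendsto_add walk_vanish y4_in) simp_all
      then show ?thesis unfolding s_def walk_add by simp
    qed
    show "summable (\<lambda>n. (real n + 1) * ip (walk ?C s n) s)" by (rule sums_summable[OF sums])
  qed (rule fun_fs fun_supp sub s0)+
  also have "\<dots> = (2 * (576 * kap3) + 2 * (576 * kap3 - 576 * kap4)) / 576"
    unfolding sums_unique[OF sums, symmetric] ..
  also have "ip s (fun3 tLM 32 0) = 2 * (19279266 / 10^10)"
    by (subst ip_finite[of "{y4, y4'}"])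
      (auto simp: s_def pt_mass_def y4_def y4'_def fun3_def table_values val3_def nrm_def
        simp flip: table_values(3))
  finally show ?thesis by simp
qed

section \<open>The functional\<close>

lemma has_sum_diff:
  fixes f g :: "'a \<Rightarrow> real"
  assumes "(f has_sum a) A" "(g has_sum b) A"
  shows "((\<lambda>x. f x - g x) has_sum (a - b)) A"
  using has_sum_add[OF assms(1) has_sum_uminusI[OF assms(2)]] by simp

lemma summable_on_diff:
  fixes f g :: "'a \<Rightarrow> real"
  shows "f summable_on A \<Longrightarrow> g summable_on A \<Longrightarrow> (\<lambda>x. f x - g x) summable_on A"
  unfolding summable_on_def using has_sum_diff by blast

definition phi :: "real \<Rightarrow> real" where
  "phi t = 1 - cos (2 * pi * t)"

lemma cos_taylor:
  fixes x :: real
  shows "1 - x\<^sup>2 / 2 \<le> cos x" "cos x \<le> 1 - x\<^sup>2 / 2 + x^4 / 24"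
    "1 - x\<^sup>2 / 2 + x^4 / 24 - x^6 / 720 \<le> cos x"
proof -
  obtain t where t: "cos x = (\<Sum>m<2. cos_coeff m * x ^ m) + (cos (t + 1/2 * real 2 * pi) / fact 2) * x ^ 2"
    using Maclaurin_cos_expansion[of x 2] by auto
  have "cos x = 1 - cos t * (x\<^sup>2 / 2)"
    unfolding t by (simp add: lessThan_nat_numeral lessThan_Suc cos_coeff_def fact_numeral)
  moreover have "cos t * (x\<^sup>2 / 2) \<le> 1 * (x\<^sup>2 / 2)" by (intro mult_right_mono) auto
  ultimately show "1 - x\<^sup>2 / 2 \<le> cos x" by simp
  obtain t where t: "cos x = (\<Sum>m<4. cos_coeff m * x ^ m) + (cos (t + 1/2 * real 4 * pi) / fact 4) * x ^ 4"
    using Maclaurin_cos_expansion[of x 4] by auto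
  have "cos (t + 2 * pi) = cos t" by (rule cos_periodic)
  then have "cos x = 1 - x\<^sup>2 / 2 + cos t * (x^4 / 24)"
    unfolding t by (simp add: lessThan_nat_numeral lessThan_Suc cos_coeff_def fact_numeral)
  moreover have "cos t * (x^4 / 24) \<le> 1 * (x^4 / 24)" by (intro mult_right_mono) auto
  ultimately show "cos x \<le> 1 - x\<^sup>2 / 2 + x^4 / 24" by simp
  obtain t where t: "cos x = (\<Sum>m<6. cos_coeff m * x ^ m) + (cos (t + 1/2 * real 6 * pi) / fact 6) * x ^ 6"
    using Maclaurin_cos_expansion[of x 6] by auto
  have "t + 3 * pi = t + pi + 2 * pi" by simp
  then have "cos (t + 3 * pi) = cos (t + pi)" by (simp only: cos_periodic)
  then have "cos (t + 3 * pi) = - cos t" by simp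
  then have "cos x = 1 - x\<^sup>2 / 2 + x^4 / 24 - cos t * (x^6 / 720)"
    unfolding t by (simp add: lessThan_nat_numeral lessThan_Suc cos_coeff_def fact_numeral)
  moreover have "cos t * (x^6 / 720) \<le> 1 * (x^6 / 720)" by (intro mult_right_mono) auto
  ultimately show "1 - x\<^sup>2 / 2 + x^4 / 24 - x^6 / 720 \<le> cos x" by simp
qed

lemma phi_nonneg: "0 \<le> phi t"
  by (simp add: phi_def)

lemma phi_minus: "phi (- t) = phi t"
  by (simp add: phi_def)

lemma phi_upper: "phi t \<le> 2 * pi\<^sup>2 * t\<^sup>2"
  using cos_taylor(1)[of "2 * pi * t"] by (simp add: phi_def power_mult_distrib)

lemma phi_lower: "2 * pi\<^sup>2 * t\<^sup>2 - 2/3 * pi^4 * t^4 \<le> phi t"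
  using cos_taylor(2)[of "2 * pi * t"] by (simp add: phi_def power_mult_distrib)

lemma phi_upper6: "phi t \<le> 2 * pi\<^sup>2 * t\<^sup>2 - 2/3 * pi^4 * t^4 + 4/45 * pi^6 * t^6"
  using cos_taylor(3)[of "2 * pi * t"] by (simp add: phi_def power_mult_distrib)

lemma phi_mono: "0 \<le> s \<Longrightarrow> s \<le> t \<Longrightarrow> t \<le> 1/2 \<Longrightarrow> phi s \<le> phi t"
  unfolding phi_def using cos_monotone_0_pi_le[of "2 * pi * s" "2 * pi * t"]
  by (simp add: mult_left_mono)

lemma pi2_bounds: "9.8696044 \<le> pi\<^sup>2" "pi\<^sup>2 \<le> 9.8696045"
proof -
  have "3.141592653588\<^sup>2 \<le> pi\<^sup>2" using pi_approx by (intro power_mono) auto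
  then show "9.8696044 \<le> pi\<^sup>2" by (simp add: power2_eq_square)
  have "pi\<^sup>2 \<le> 3.1415926535899\<^sup>2" using pi_approx by (intro power_mono) auto
  then show "pi\<^sup>2 \<le> 9.8696045" by (simp add: power2_eq_square)
qed

lemma pi4_bounds: "97.40909 \<le> pi^4" "pi^4 \<le> 97.409094"
proof -
  have eq: "pi^4 = (pi\<^sup>2)\<^sup>2" by simp
  have "9.8696044\<^sup>2 \<le> (pi\<^sup>2)\<^sup>2" using pi2_bounds by (intro power_mono) auto
  then show "97.40909 \<le> pi^4" unfolding eq by (simp add: power2_eq_square)
  have "(pi\<^sup>2)\<^sup>2 \<le> 9.8696045\<^sup>2" using pi2_bounds by (intro power_mono) auto
  then show "pi^4 \<le> 97.409094" unfolding eq by (simp add: power2_eq_square)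
qed

text \<open>The leading coefficient \<open>2 * pi^2\<close> is about 19.74, and in this range the
  quartic term costs less than \<open>0.3 * t^2\<close>.\<close>

lemma phi_quad: assumes "\<bar>t\<bar> \<le> 1/16" shows "19 * t\<^sup>2 \<le> phi t"
proof -
  have "t\<^sup>2 \<le> (1/16)\<^sup>2" using assms by (metis abs_ge_zero power2_abs power_mono)
  then have t2: "t\<^sup>2 \<le> 1/256" by (simp add: power2_eq_square)
  have "2/3 * pi^4 * t^4 = (2/3 * pi^4) * t\<^sup>2 * t\<^sup>2" by (simp add: power2_eq_square eval_nat_numeral)
  also have "\<dots> \<le> (2/3 * pi^4) * (1/256) * t\<^sup>2"
    using t2 by (intro mult_right_mono mult_left_mono) auto
  also have "\<dots> \<le> 0.3 * t\<^sup>2" using pi4_bounds by (intro mult_right_mono) auto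
  finally have a: "2/3 * pi^4 * t^4 \<le> 0.3 * t\<^sup>2" .
  have "19.3 * t\<^sup>2 \<le> 2 * pi\<^sup>2 * t\<^sup>2" using pi2_bounds by (intro mult_right_mono) auto
  then show ?thesis using a phi_lower[of t] by simp
qed

text \<open>The finite set \<open>X\<close> collects the points where the quartic correction matters.\<close>

lemma phi_sum:
  fixes f :: "pt \<Rightarrow> real"
  assumes K: "((\<lambda>x. (f x)\<^sup>2) has_sum \<kappa>) A" and X: "finite X" "X \<subseteq> A"
  shows "(\<lambda>x. phi (f x)) summable_on A"
    and "(\<Sum>\<^sub>\<infinity>x\<in>A. phi (f x)) \<le> 2 * pi\<^sup>2 * \<kappa> - (\<Sum>x\<in>X. 2/3 *
        pi^4 * (f x)^4 - 4/45 * pi^6 * (f x)^6)"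
    and "2 * pi\<^sup>2 * \<kappa> - 2/3 * pi^4 * ((\<Sum>x\<in>X. (f x)^4) + (\<kappa> - (\<Sum>x\<in>X. (f x)\<^sup>2))\<^sup>2)
      \<le> (\<Sum>\<^sub>\<infinity>x\<in>A. phi (f x))"
proof -
  have sq: "((\<lambda>x. 2 * pi\<^sup>2 * (f x)\<^sup>2) has_sum (2 * pi\<^sup>2 * \<kappa>)) A"
    by (rule has_sum_cmult_right[OF K])
  show sm: "(\<lambda>x. phi (f x)) summable_on A"
    by (rule summable_on_comparison_test[OF has_sum_imp_summable[OF sq]])
      (use phi_upper phi_nonneg in auto)
  have split: "A = X \<union> (A - X)" using X by auto
  have smR: "(\<lambda>x. phi (f x)) summable_on (A - X)" by (rule summable_on_subset[OF sm]) auto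
  have sqR: "(\<lambda>x. (f x)\<^sup>2) summable_on (A - X)"
    by (rule summable_on_subset[OF has_sum_imp_summable[OF K]]) auto
  define s where "s = (\<Sum>\<^sub>\<infinity>x\<in>A - X. (f x)\<^sup>2)"
  have kap: "\<kappa> = (\<Sum>x\<in>X. (f x)\<^sup>2) + s"
  proof -
    have "\<kappa> = (\<Sum>\<^sub>\<infinity>x\<in>A. (f x)\<^sup>2)" using K by (simp add: infsumI)
    also have "\<dots> = (\<Sum>\<^sub>\<infinity>x\<in>X. (f x)\<^sup>2) + s"
      unfolding s_def by (subst split, rule infsum_Un_disjoint) (use X sqR in auto)
    finally show ?thesis using X by simp
  qed
  have tot: "(\<Sum>\<^sub>\<infinity>x\<in>A. phi (f x)) = (\<Sum>x\<in>X. phi (f x)) + (\<Sum>\<^sub>\<infinity>x\<in>A - X. phi (f x))"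
    by (subst split, subst infsum_Un_disjoint) (use X smR in auto)
  have sq2R: "(\<lambda>x. 2 * pi\<^sup>2 * (f x)\<^sup>2) summable_on (A - X)"
    by (rule summable_on_cmult_right[OF sqR])
  have "(\<Sum>\<^sub>\<infinity>x\<in>A - X. phi (f x)) \<le> (\<Sum>\<^sub>\<infinity>x\<in>A - X. 2 * pi\<^sup>2 * (f x)\<^sup>2)"
    by (rule infsum_mono[OF smR sq2R]) (rule phi_upper)
  also have "\<dots> = 2 * pi\<^sup>2 * s" unfolding s_def by (rule infsum_cmult_right') 
  finally have R_up: "(\<Sum>\<^sub>\<infinity>x\<in>A - X. phi (f x)) \<le> 2 * pi\<^sup>2 * s" .
  have "(\<Sum>x\<in>X. phi (f x)) \<le> (\<Sum>x\<in>X. 2 * pi\<^sup>2 * (f x)\<^sup>2 - (2/3 * pi^4 * (f x)^4 - 4/45 * pi^6 * (f x)^6))"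
  proof (rule sum_mono)
    show "phi (f x) \<le> 2 * pi\<^sup>2 * (f x)\<^sup>2 - (2/3 * pi^4 * (f x)^4 - 4/45 * pi^6 * (f x)^6)" for x
      using phi_upper6[of "f x"] by linarith
  qed
  then show "(\<Sum>\<^sub>\<infinity>x\<in>A. phi (f x)) \<le> 2 * pi\<^sup>2 * \<kappa> - (\<Sum>x\<in>X.
      2/3 * pi^4 * (f x)^4 - 4/45 * pi^6 * (f x)^6)"
    unfolding tot kap using R_up by (simp add: sum_subtractf sum_distrib_left sum.distrib algebra_simps)
  \<comment> \<open>Each remaining square is at most the remaining total \<open>s\<close>, so the
    fourth powers off \<open>X\<close> add up to at most \<open>s * s\<close>, a correction of
    second order.\<close>
  have fs: "(f x)\<^sup>2 \<le> s" if "x \<in> A - X" for x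
    unfolding s_def using finite_sum_le_infsum[OF sqR, of "{x}"] that by simp
  have "2 * pi\<^sup>2 * s - 2/3 * pi^4 * (s * s) = (\<Sum>\<^sub>\<infinity>x\<in>A - X. (2 * pi\<^sup>2 -
      2/3 * pi^4 * s) * (f x)\<^sup>2)"
    unfolding infsum_cmult_right' s_def[symmetric] by (simp add: algebra_simps)
  also have "\<dots> \<le> (\<Sum>\<^sub>\<infinity>x\<in>A - X. phi (f x))"
  proof (rule infsum_mono[OF summable_on_cmult_right[OF sqR] smR])
    fix x assume x: "x \<in> A - X"
    have "(f x)^4 = (f x)\<^sup>2 * (f x)\<^sup>2" by (simp add: power2_eq_square eval_nat_numeral)
    also have "\<dots> \<le> s * (f x)\<^sup>2" using fs[OF x] by (intro mult_right_mono) auto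
    finally have "2/3 * pi^4 * (f x)^4 \<le> 2/3 * pi^4 * (s * (f x)\<^sup>2)"
      by (intro mult_left_mono) auto
    then have "2 * pi\<^sup>2 * (f x)\<^sup>2 - 2/3 * pi^4 * (s * (f x)\<^sup>2) \<le> phi (f x)"
      using phi_lower[of "f x"] by linarith
    then show "(2 * pi\<^sup>2 - 2/3 * pi^4 * s) * (f x)\<^sup>2 \<le> phi (f x)"
      by (simp only: left_diff_distrib mult.assoc)
  qed
  finally have R_lo: "2 * pi\<^sup>2 * s - 2/3 * pi^4 * (s * s) \<le> (\<Sum>\<^sub>\<infinity>x\<in>A - X. phi (f x))" .
  have "(\<Sum>x\<in>X. 2 * pi\<^sup>2 * (f x)\<^sup>2 - 2/3 * pi^4 * (f x)^4) \<le> (\<Sum>x\<in>X. phi (f x))"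
    by (intro sum_mono phi_lower)
  then have "2 * pi\<^sup>2 * (\<Sum>x\<in>X. (f x)\<^sup>2) - 2/3 * pi^4 * (\<Sum>x\<in>X. (f x)^4) \<le> (\<Sum>x\<in>X. phi (f x))"
    by (simp only: sum_subtractf sum_distrib_left)
  then show "2 * pi\<^sup>2 * \<kappa> - 2/3 * pi^4 * ((\<Sum>x\<in>X. (f x)^4) + (\<kappa> - (\<Sum>x\<in>X. (f x)\<^sup>2))\<^sup>2)
      \<le> (\<Sum>\<^sub>\<infinity>x\<in>A. phi (f x))"
    unfolding tot kap using R_lo by (simp add: algebra_simps power2_eq_square add_divide_distrib)
qed

lemma p_root:
  assumes "u \<in> roots" shows "p n u = p (Suc n) 0"
proof -
  have all: "p n v = sl (p n) [1,1,0,0]" if "v \<in> roots" for v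
    using that unfolding roots_eq root_list_def
    by (auto simp: symm_sl[OF symm_p] simp del: walk.simps)
  have "nbr (p n) 0 = (\<Sum>v\<in>roots. sl (p n) [1,1,0,0])"
    unfolding nbr_def by (intro sum.cong) (auto simp: all simp del: walk.simps)
  then have "p (Suc n) 0 = sl (p n) [1,1,0,0]" by (simp add: card_roots)
  then show ?thesis using all[OF assms] by simp
qed

text \<open>The Dirichlet energy of \<open>G\<close> is \<open>2 * G 0\<close>, and by symmetry all 24 roots contribute equally.\<close>

lemma energy:
  assumes u: "u \<in> roots"
  shows "((\<lambda>x. (G x - G (x - u))\<^sup>2) has_sum (G 0 / 12)) UNIV"
proof -
  define d where "d n x = walk UNIV (pt_mass 0) n x - walk UNIV (pt_mass u) n x" for n x
  define S where "S N x = (\<Sum>n<N. d n x)" for N x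
  let ?z = "\<lambda>x. 24 * (G x - G (x - u))"
  have fsd: "fs (d n)" for n
  proof -
    have "finite ({x. walk UNIV (pt_mass 0) n x \<noteq> 0} \<union> {x. walk UNIV (pt_mass u) n x \<noteq> 0})"
      using fs_walk[OF fs_pt_mass] by (simp add: fs_def)
    then show ?thesis unfolding fs_def by (rule rev_finite_subset) (use d_def in force)
  qed
  have fsS: "fs (S N)" for N unfolding S_def by (intro fs_sum fsd) auto
  have ipd: "ip (d m) (d n) = 2 * (p (m + n) 0 - p (Suc (m + n)) 0)" for m n
  proof -
    let ?w = "\<lambda>y n. walk UNIV (pt_mass y) n"
    have w: "ip (?w y m) (?w z n) = p (m + n) (y - z)" for y z
      unfolding ip_walk_pt[OF UNIV_I UNIV_I] by (rule walk_shift)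
    have sm: "(\<lambda>x. ?w y m x * ?w z n x) summable_on UNIV" for y z
      by (intro sqs_prod fs_sqs fs_walk fs_pt_mass)
    have "ip (d m) (d n) = (\<Sum>\<^sub>\<infinity>x. (?w 0 m x * ?w 0 n x - ?w 0 m x * ?w u n x)
        - (?w u m x * ?w 0 n x - ?w u m x * ?w u n x))"
      unfolding ip_def d_def by (simp add: algebra_simps)
    also have "\<dots> = (ip (?w 0 m) (?w 0 n) - ip (?w 0 m) (?w u n)) - (ip (?w u m) (?w 0 n) - ip (?w u m) (?w u n))"
      unfolding ip_def by (intro infsumI has_sum_diff has_sum_infsum sm)
    also have "\<dots> = 2 * (p (m + n) 0 - p (Suc (m + n)) 0)"
      unfolding w using p_root[OF u, of "m + n"] p_root[OF uminus_roots[OF u], of "m + n"]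
      by (simp del: walk.simps)
    finally show ?thesis .
  qed
  have ipS: "ip (S M) (S N) = 2 * ((\<Sum>n<N. p n 0) - (\<Sum>n<N. p (n + M) 0))" for M N
  proof -
    have tel: "(\<Sum>m<M. p (m + n) 0 - p (Suc (m + n)) 0) = p n 0 - p (n + M) 0" for n
      by (induction M) (simp_all add: add.commute del: walk.simps)
    have "ip (S M) (S N) = (\<Sum>m<M. \<Sum>n<N. 2 * (p (m + n) 0 - p (Suc (m + n)) 0))"
      unfolding S_def ipd[symmetric] by (intro ip_sum_sum fsd) auto
    also have "\<dots> = (\<Sum>n<N. 2 * (p n 0 - p (n + M) 0))"
      unfolding tel[symmetric] sum_distrib_left by (rule sum.swap)
    finally show ?thesis by (simp add: sum_distrib_left sum_subtractf del: walk.simps)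
  qed
  have gg0: "(\<Sum>n<N. p n 0) \<le> 24 * G 0" for N
    using sum_le_suminf[OF summable_p, of "{..<N}" 0] p_nonneg by (simp add: G_def del: walk.simps)
  have S_up: "ip (S N) (S N) \<le> 2 * (\<Sum>n<N. p n 0)" for N
  proof -
    have "0 \<le> (\<Sum>n<N. p (n + N) 0)" by (intro sum_nonneg p_nonneg)
    then show ?thesis unfolding ipS by simp
  qed
  have S_lim: "(\<lambda>N. S N x) \<longlonglongrightarrow> ?z x" for x
  proof -
    have "(\<lambda>N. gg N x - gg N (x - u)) \<longlonglongrightarrow> 24 * G x - 24 * G (x - u)"
      by (intro tendsto_diff gg_tendsto)
    moreover have "(\<lambda>N. S N x) = (\<lambda>N. gg N x - gg N (x - u))"
      unfolding S_def d_def gg_def walk_shift[of u] by (intro ext sum_subtractf)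
    ultimately show ?thesis by (simp only: right_diff_distrib)
  qed
  have bnd: "(\<Sum>x\<in>X. (?z x)\<^sup>2) \<le> 48 * G 0" if "finite X" for X
  proof (rule LIMSEQ_le_const2)
    show "(\<lambda>N. \<Sum>x\<in>X. (S N x)\<^sup>2) \<longlonglongrightarrow> (\<Sum>x\<in>X. (?z x)\<^sup>2)"
      by (intro tendsto_sum tendsto_power S_lim)
    have "(\<Sum>x\<in>X. (S N x)\<^sup>2) \<le> 48 * G 0" for N
    proof -
      have "(\<Sum>x\<in>X. (S N x)\<^sup>2) \<le> ip (S N) (S N)"
        unfolding ip_def power2_eq_square
        by (rule finite_sum_le_infsum) (use that sqs_prod[OF fs_sqs[OF fsS] fs_sqs[OF fsS]] in auto)
      then show ?thesis using S_up[of N] gg0[of N] by simp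
    qed
    then show "\<exists>M. \<forall>N\<ge>M. (\<Sum>x\<in>X. (S N x)\<^sup>2) \<le> 48 * G 0" by blast
  qed
  have sz: "sqs ?z" "ip ?z ?z \<le> 48 * G 0" using sqs_bounded[of ?z "48 * G 0"] bnd by blast+
  \<comment> \<open>\<open>d n\<close> takes both signs, so these truncations are not monotone in
    \<open>N\<close>. The lower bound comes instead from expanding the square of
    \<open>?z - S N\<close>, whose cross term is known exactly.\<close>
  have lo: "2 * (\<Sum>n<N. p n 0) \<le> ip ?z ?z" for N
  proof -
    have cross: "ip (S N) ?z = 2 * (\<Sum>n<N. p n 0)"
    proof (rule LIMSEQ_unique)
      have "(\<lambda>M. \<Sum>x\<in>{x. S N x \<noteq> 0}. S N x * S M x) \<longlonglongrightarrow>
          (\<Sum>x\<in>{x. S N x \<noteq> 0}. S N x * ?z x)"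
        by (intro tendsto_sum tendsto_mult tendsto_const S_lim)
      then show "(\<lambda>M. ip (S N) (S M)) \<longlonglongrightarrow> ip (S N) ?z" by (simp add: fs_ip[OF fsS])
      have "(\<lambda>M. 2 * ((\<Sum>n<N. p n 0) - (\<Sum>n<N. p (n + M) 0))) \<longlonglongrightarrow> 2 *
          ((\<Sum>n<N. p n 0) - (\<Sum>n<N. 0))"
      proof (intro tendsto_mult tendsto_diff tendsto_sum tendsto_const)
        fix n show "(\<lambda>M. p (n + M) 0) \<longlonglongrightarrow> 0"
          using LIMSEQ_ignore_initial_segment[OF p_tendsto[of 0], of n] by (simp add: add.commute)
      qed
      then have "(\<lambda>M. ip (S M) (S N)) \<longlonglongrightarrow> 2 * (\<Sum>n<N. p n 0)" unfolding ipS by simp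
      then show "(\<lambda>M. ip (S N) (S M)) \<longlonglongrightarrow> 2 * (\<Sum>n<N. p n 0)" by (simp only: ip_commute[of "S N"])
    qed
    have sS: "sqs (S N)" by (rule fs_sqs[OF fsS])
    have "2 * ip (S N) ?z - ip (S N) (S N) = (\<Sum>\<^sub>\<infinity>x. 2 * (S N x * ?z x) - S N x * S N x)"
      unfolding ip_def
      by (intro infsumI[symmetric] has_sum_diff has_sum_cmult_right has_sum_infsum sqs_prod sS sz)
    also have "\<dots> \<le> ip ?z ?z"
      unfolding ip_def
    proof (rule infsum_mono)
      show "(\<lambda>x. 2 * (S N x * ?z x) - S N x * S N x) summable_on UNIV"
        by (intro summable_on_diff summable_on_cmult_right sqs_prod sS sz)
      show "(\<lambda>x. ?z x * ?z x) summable_on UNIV" by (intro sqs_prod sz)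
      show "2 * (S N x * ?z x) - S N x * S N x \<le> ?z x * ?z x" for x
        using zero_le_power2[of "?z x - S N x"] by (simp add: power2_eq_square algebra_simps)
    qed
    finally show ?thesis using S_up[of N] cross by simp
  qed
  have "2 * (24 * G 0) \<le> ip ?z ?z"
  proof (rule LIMSEQ_le_const2)
    show "(\<lambda>N. 2 * (\<Sum>n<N. p n 0)) \<longlonglongrightarrow> 2 * (24 * G 0)"
      using gg_tendsto[of 0] by (intro tendsto_mult tendsto_const) (simp add: gg_def)
    show "\<exists>N. \<forall>n\<ge>N. 2 * (\<Sum>n<n. p n 0) \<le> ip ?z ?z" using lo by blast
  qed
  then have "ip ?z ?z = 48 * G 0" using sz(2) by simp
  then have "((\<lambda>x. (?z x)\<^sup>2) has_sum (48 * G 0)) UNIV" by (rule has_sum_ip[OF sz(1)])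
  then have "((\<lambda>x. (1/576) * (?z x)\<^sup>2) has_sum ((1/576) * (48 * G 0))) UNIV" by (rule has_sum_cmult_right)
  moreover have "(1/576) * (?z x)\<^sup>2 = (G x - G (x - u))\<^sup>2" for x
    by (simp only: power_mult_distrib) simp
  ultimately show ?thesis by simp
qed

text \<open>A root changes each coordinate by at most one, so a neighbour outside the open chamber
  lies on a wall, where \<open>f\<close> is already zero.\<close>

lemma cut_lap:
  fixes f :: "pt \<Rightarrow> real"
  assumes wall: "\<And>i x. i < k \<Longrightarrow> coord i x = 0 \<Longrightarrow> f x = 0" and x: "x \<in> chamber k"
  shows "lap (\<lambda>x. if x \<in> chamber k then f x else 0) x = lap f x"
proof -
  have "(if x + u \<in> chamber k then f (x + u) else 0) = f (x + u)" if u: "u \<in> roots" for u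
  proof (cases "x + u \<in> chamber k")
    case False
    then obtain i where i: "i < k" "\<not> 0 < coord i (x + u)" by (auto simp: chamber_def)
    have "0 < coord i x" using x i by (simp add: chamber_def)
    then have "coord i (x + u) = 0" using i coord_root[OF u, of i] by (simp add: coord_add)
    then show ?thesis using wall i False by simp
  qed simp
  then have "nbr (\<lambda>x. if x \<in> chamber k then f x else 0) x = nbr f x"
    unfolding nbr_def by (intro sum.cong) auto
  then show ?thesis using x by (simp add: lap_def)
qed

section \<open>Green functions of the chambers and numerical enclosures of the extremal
  values\<close>

definition green :: "nat \<Rightarrow> pt \<Rightarrow> pt \<Rightarrow> real" where
  "green k y x = (if x \<in> chamber k then xi k y x else 0)"

lemma green_sums:
  assumes "k \<le> 4" "y \<in> chamber k"
  shows "(\<lambda>n. walk (chamber k) (pt_mass y) n x) sums (24 * green k y x)"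
proof (cases "x \<in> chamber k")
  case True then show ?thesis using walk_chamber_sums[OF assms True] by (simp add: green_def)
next
  case False
  have "supp_in (chamber k) (pt_mass y)" using assms by (auto simp: supp_in_def pt_mass_def)
  then have "walk (chamber k) (pt_mass y) n x = 0" for n
    using walk_supp supp_inD[OF _ False] by blast
  then show ?thesis using False by (simp add: green_def)
qed

lemma green_nonneg:
  assumes "k \<le> 4" "y \<in> chamber k" shows "0 \<le> green k y x"
  using sums_le[OF walk_nn sums_zero green_sums[OF assms]] by simp

lemma green_pole:
  assumes "k \<le> 4" "y \<in> chamber k" shows "1/24 \<le> green k y y"
proof -
  note s = green_sums[OF assms, of y]
  have "walk (chamber k) (pt_mass y) 0 y \<le> 24 * green k y y"
    using sum_le_suminf[OF sums_summable[OF s], of "{0}"] walk_nn sums_unique[OF s] by simp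
  then show ?thesis by (simp add: pt_mass_def)
qed

lemma green_lap:
  assumes "k \<le> 4" "y \<in> chamber k" "x \<in> chamber k" shows "lap (green k y) x = pt_mass y x"
proof -
  note s = green_sums[OF assms(1,2)]
  have "(\<lambda>n. \<Sum>u\<in>roots. walk (chamber k) (pt_mass y) n (x + u)) sums (\<Sum>u\<in>roots. 24 * green k y (x + u))"
    by (rule sums_sum) (rule s)
  then have "(\<lambda>n. nbr (walk (chamber k) (pt_mass y) n) x) sums (24 * nbr (green k y) x)"
    by (simp add: nbr_def sum_distrib_left)
  then have "(\<lambda>n. walk (chamber k) (pt_mass y) (Suc n) x) sums (nbr (green k y) x)"
    using sums_divide[of "\<lambda>n. nbr (walk (chamber k) (pt_mass y) n) x" "24 * nbr (green k y) x" 24] assms(3) by simp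
  then have "(\<lambda>n. walk (chamber k) (pt_mass y) n x) sums (nbr (green k y) x + pt_mass y x)"
    by (subst (asm) sums_Suc_iff) simp
  then have "24 * green k y x = nbr (green k y) x + pt_mass y x" using s sums_unique2 by blast
  then show ?thesis by (simp add: lap_def)
qed

lemma quartic_gain:
  assumes "1/24 \<le> t" "t \<le> 1/16"
  shows "0.000194 \<le> 2/3 * pi^4 * t^4 - 4/45 * pi^6 * t^6"
proof -
  have t2: "t\<^sup>2 \<le> (1/16)\<^sup>2" and t4: "(1/24)^4 \<le> t^4" using assms by (auto intro!: power_mono)
  have "pi\<^sup>2 * t\<^sup>2 \<le> 9.8696045 * (1/16)\<^sup>2" using pi2_bounds t2 by (intro mult_mono) auto
  then have a: "0.663 \<le> 2/3 - 4/45 * (pi\<^sup>2 * t\<^sup>2)" by (simp add: power2_eq_square)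
  have b: "97.4 * (1/24)^4 \<le> pi^4 * t^4" using pi4_bounds t4 by (intro mult_mono) auto
  have "97.4 * (1/24)^4 * 0.663 \<le> (pi^4 * t^4) * (2/3 - 4/45 * (pi\<^sup>2 * t\<^sup>2))"
    by (rule mult_mono[OF b a]) simp_all
  moreover have "(pi^4 * t^4) * (2/3 - 4/45 * (pi\<^sup>2 * t\<^sup>2)) = 2/3 * pi^4 * t^4 - 4/45 * pi^6 * t^6"
    by (simp add: algebra_simps eval_nat_numeral)
  ultimately show ?thesis by (simp add: power_divide)
qed

text \<open>\<open>phi_sum\<close> with the pole as the only distinguished point. The pole value is
  at least 1/24, the term at time zero, so at most \<open>\<kappa>h - 1/576\<close> of the squared
  mass lies elsewhere, and the quartic gain at the pole is at least 0.000194. The decimals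
  19.7392088 and 19.739209 enclose \<open>2 * pi^2\<close>, and 64.939396 bounds
  \<open>2/3 * pi^4\<close>.\<close>

lemma phi_single:
  fixes f :: "pt \<Rightarrow> real"
  assumes K: "((\<lambda>x. (f x)\<^sup>2) has_sum \<kappa>) A" and y: "y \<in> A"
    and t: "1/24 \<le> f y" "f y \<le> \<tau>" "\<tau> \<le> 1/16" and k: "\<kappa>l \<le> \<kappa>" "\<kappa> \<le> \<kappa>h"
  shows "19.7392088 * \<kappa>l - 64.939396 * (\<tau>^4 + (\<kappa>h - 1/576)\<^sup>2) \<le> (\<Sum>\<^sub>\<infinity>x\<in>A. phi (f x))"
    and "(\<Sum>\<^sub>\<infinity>x\<in>A. phi (f x)) \<le> 19.739209 * \<kappa>h - 0.000194"
proof -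
  let ?t = "f y"
  have lo: "2 * pi\<^sup>2 * \<kappa> - 2/3 * pi^4 * (?t^4 + (\<kappa> - ?t\<^sup>2)\<^sup>2) \<le>
      (\<Sum>\<^sub>\<infinity>x\<in>A. phi (f x))"
    using phi_sum(3)[OF K, of "{y}"] y by simp
  have t2: "(1/24)\<^sup>2 \<le> ?t\<^sup>2" "?t\<^sup>2 \<le> (1/16)\<^sup>2" using t by (auto intro!: power_mono)
  have t4: "(1/24)^4 \<le> ?t^4" "?t^4 \<le> \<tau>^4" using t by (auto intro!: power_mono)
  have "?t\<^sup>2 \<le> (\<Sum>\<^sub>\<infinity>x\<in>A. (f x)\<^sup>2)"
    using finite_sum_le_infsum[OF has_sum_imp_summable[OF K], of "{y}"] y by simp
  then have tk: "?t\<^sup>2 \<le> \<kappa>" using infsumI[OF K] by simp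
  then have k0: "0 \<le> \<kappa>" using zero_le_power2[of ?t] by linarith
  have "(\<kappa> - ?t\<^sup>2)\<^sup>2 \<le> (\<kappa>h - 1/576)\<^sup>2"
    using tk t2 k by (intro power_mono) (auto simp: power2_eq_square)
  then have "2/3 * pi^4 * (?t^4 + (\<kappa> - ?t\<^sup>2)\<^sup>2) \<le> 64.939396 * (\<tau>^4 + (\<kappa>h - 1/576)\<^sup>2)"
    using pi4_bounds t4 by (intro mult_mono add_mono) auto
  moreover have "19.7392088 * \<kappa>l \<le> 2 * pi\<^sup>2 * \<kappa>"
  proof -
    have "19.7392088 * \<kappa>l \<le> 19.7392088 * \<kappa>" using k by simp
    also have "\<dots> \<le> 2 * pi\<^sup>2 * \<kappa>" using pi2_bounds k0 by (intro mult_right_mono) auto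
    finally show ?thesis .
  qed
  ultimately show "19.7392088 * \<kappa>l - 64.939396 * (\<tau>^4 + (\<kappa>h - 1/576)\<^sup>2) \<le>
      (\<Sum>\<^sub>\<infinity>x\<in>A. phi (f x))"
    using lo by linarith
  have "2 * pi\<^sup>2 * \<kappa> \<le> 19.739209 * \<kappa>h" using pi2_bounds k k0 by (intro mult_mono) auto
  moreover have "0.000194 \<le> 2/3 * pi^4 * ?t^4 - 4/45 * pi^6 * ?t^6"
    by (rule quartic_gain) (use t in auto)
  ultimately show "(\<Sum>\<^sub>\<infinity>x\<in>A. phi (f x)) \<le> 19.739209 * \<kappa>h - 0.000194"
    using phi_sum(2)[OF K, of "{y}"] y by simp
qed

text \<open>The bounds on the parameters are a little tighter than claimed where the bounds on the factors
  require it.\<close>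

definition low :: "nat \<Rightarrow> real" where
  "low k = (if k = 0 then 0.075314 else if k = 1 then 0.0439257 else if k = 2 then 0.03882796
     else if k = 3 then 0.0367592 else 0.0356504)"

definition high :: "nat \<Rightarrow> real" where
  "high k = (if k = 0 then 0.075794 else if k = 1 then 0.0442657 else if k = 2 then 0.0390859
     else if k = 3 then 0.036987 else 0.0358704)"

text \<open>An even point whose first \<open>k\<close> coordinates are all one. Being as close as
  possible to the walls is what lets every other pole be compared with it by a translation into the
  chamber.\<close>

definition pole :: "nat \<Rightarrow> pt" where
  "pole k = (if k \<le> 2 then (1, 1, 0, 0) else (1, 1, 1, 1))"

lemma pole_chamber: "k \<le> 4 \<Longrightarrow> pole k \<in> chamber k"
  by (auto simp: pole_def chamber_def coord_def)

lemma pole_coord: "i < k \<Longrightarrow> k \<le> 4 \<Longrightarrow> coord i (pole k) = 1"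
  by (auto simp: pole_def coord_def)

text \<open>Packages the numerical input of \<open>phi_single\<close>: an enclosure of the squared
  norm, and a bound \<open>\<tau>\<close> for the pole value, which is \<open>ws_return\<close> for
  \<open>G\<close> evaluated with \<open>G_bounds\<close> and rounded up.\<close>

lemma green_data:
  assumes k: "1 \<le> k" "k \<le> 4"
  shows "\<exists>\<kappa> \<kappa>l \<kappa>h \<tau>. (\<lambda>n. (real n + 1) * walk (chamber k) (pt_mass
      (pole k)) n (pole k)) sums (576 * \<kappa>) \<and>
    \<kappa>l \<le> \<kappa> \<and> \<kappa> \<le> \<kappa>h \<and> green k (pole k) (pole k) \<le> \<tau> \<and> \<tau> \<le> 1/16 \<and>
    low k \<le> 19.7392088 * \<kappa>l - 64.939396 * (\<tau>^4 + (\<kappa>h - 1/576)\<^sup>2) \<and>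
        19.739209 * \<kappa>h - 0.000194 \<le> high k"
proof -
  have green: "green k (pole k) (pole k) = ws k (\<lambda>x. G (x - pole k)) (pole k)"
    using pole_chamber[OF k(2)] by (simp add: green_def xi_def)
  consider "k = 1" | "k = 2" | "k = 3" | "k = 4" using k by linarith
  then show ?thesis
  proof cases
    case 1
    have p: "pole k = (1,1,0,0)" by (simp add: pole_def 1)
    have ret: "ws k (\<lambda>x. G (x - pole k)) (pole k) = G (0,0,0,0) - G (2,0,0,0)"
      unfolding p unfolding 1 by (rule ws_return(1)[OF symm_G])
    have g: "green k (pole k) (pole k) \<le> 0.0440601"
      unfolding green ret using G_bounds by simp
    show ?thesis unfolding p
      by (rule exI[of _ kap1], rule exI[of _ "22421398/10^10"], rule exI[of _ "22422818/10^10"], rule exI[of _ "0.0440601"])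
        (use kap1_sums[of 1 0 0] kap1_bounds g[unfolded p] in \<open>simp add: 1 low_def high_def power_divide power2_eq_square\<close>)
  next
    case 2
    have p: "pole k = (1,1,0,0)" by (simp add: pole_def 2)
    have ret: "ws k (\<lambda>x. G (x - pole k)) (pole k) = G (0,0,0,0) - 2 * G (2,0,0,0) + G (2,2,0,0)"
      unfolding p unfolding 2 by (rule ws_return(2)[OF symm_G])
    have g: "green k (pole k) (pole k) \<le> 0.0431289"
      unfolding green ret using G_bounds by simp
    show ?thesis unfolding p
      by (rule exI[of _ kap2], rule exI[of _ "19789779/10^10"], rule exI[of _ "19804686/10^10"], rule exI[of _ "0.0431289"])
        (use kap2_sums[of 0 0] kap2_bounds g[unfolded p] in \<open>simp add: 2 low_def high_def power_divide power2_eq_square\<close>)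
  next
    case 3
    have p: "pole k = (1,1,1,1)" by (simp add: pole_def 3)
    have ret: "ws k (\<lambda>x. G (x - pole k)) (pole k) = G (0,0,0,0) - 3 * G (2,0,0,0) + 3 * G (2,2,0,0) - G (2,2,2,0)"
      unfolding p unfolding 3 by (rule ws_return(3)[OF symm_G])
    have g: "green k (pole k) (pole k) \<le> 0.0425820"
      unfolding green ret using G_bounds by simp
    show ?thesis unfolding p
      by (rule exI[of _ kap3], rule exI[of _ "18734493/10^10"], rule exI[of _ "18771566/10^10"], rule exI[of _ "0.0425820"])
        (use kap3_sums[of 1] kap3_lower kap3_upper g[unfolded p] in \<open>simp add: 3 low_def high_def
            power_divide power2_eq_square\<close>)
  next
    case 4
    have p: "pole k = (1,1,1,1)" by (simp add: pole_def 4)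
    have ret: "ws k (\<lambda>x. G (x - pole k)) (pole k) = G (0,0,0,0) - 4 * G (2,0,0,0) + 6 * G (2,2,0,0) - 4 * G (2,2,2,0) + G (2,2,2,2)"
      unfolding p unfolding 4 by (rule ws_return(4)[OF symm_G])
    have g: "green k (pole k) (pole k) \<le> 0.0422433"
      unfolding green ret using G_bounds by simp
    \<comment> \<open>The upper bound is \<open>18263866 = 2 * 18771566 - 19279266\<close>, from
      \<open>kap4_upper\<close> and \<open>kap3_upper\<close>.\<close>
    show ?thesis unfolding p
      by (rule exI[of _ kap4], rule exI[of _ "18168767/10^10"], rule exI[of _ "18263866/10^10"], rule exI[of _ "0.0422433"])
        (use kap4_sums[unfolded y4_def] kap4_lower kap4_upper kap3_upper g[unfolded p] in \<open>simp add: 4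
            low_def high_def power_divide power2_eq_square\<close>)
  qed
qed

lemma green_values:
  assumes k: "1 \<le> k" "k \<le> 4"
  shows "sqs (green k (pole k))" "green k (pole k) (pole k) \<le> 1/16"
    "low k \<le> (\<Sum>\<^sub>\<infinity>x\<in>chamber k. phi (green k (pole k) x))"
    "(\<Sum>\<^sub>\<infinity>x\<in>chamber k. phi (green k (pole k) x)) \<le> high k"
proof -
  let ?q = "green k (pole k)"
  obtain \<kappa> \<kappa>l \<kappa>h \<tau> where K: "(\<lambda>n. (real n + 1) * walk (chamber k) (pt_mass
      (pole k)) n (pole k)) sums (576 * \<kappa>)"
    and kk: "\<kappa>l \<le> \<kappa>" "\<kappa> \<le> \<kappa>h" and tau: "?q (pole k) \<le> \<tau>" "\<tau> \<le> 1/16"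
    and b: "low k \<le> 19.7392088 * \<kappa>l - 64.939396 * (\<tau>^4 + (\<kappa>h - 1/576)\<^sup>2)"
      "19.739209 * \<kappa>h - 0.000194 \<le> high k"
    using green_data[OF k] by blast
  note y = pole_chamber[OF k(2)]
  have hs: "((\<lambda>x. (?q x)\<^sup>2) has_sum \<kappa>) UNIV"
    by (rule green_square_sum[OF y green_sums[OF k(2) y] K])
  then show "sqs ?q" unfolding sqs_def by (rule has_sum_imp_summable)
  show "?q (pole k) \<le> 1/16" using tau by linarith
  have hsC: "((\<lambda>x. (?q x)\<^sup>2) has_sum \<kappa>) (chamber k)"
    by (rule has_sum_cong_neutral[THEN iffD1, OF _ _ _ hs]) (auto simp: green_def)
  note ps = phi_single[OF hsC y green_pole[OF k(2) y] tau kk]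
  show "low k \<le> (\<Sum>\<^sub>\<infinity>x\<in>chamber k. phi (?q x))" using ps(1) b(1) by linarith
  show "(\<Sum>\<^sub>\<infinity>x\<in>chamber k. phi (?q x)) \<le> high k" using ps(2) b(2) by linarith
qed

lemma G_minus: "G (- x) = G x"
proof -
  obtain a b c d where "x = (a, b, c, d)" by (cases x)
  then show ?thesis by (simp add: symm_sl[OF symm_G])
qed

lemma G_root': assumes "u \<in> roots" shows "G u = G 0 - 1/24"
proof -
  have "G u = sl G [1,1,0,0]"
    using assms unfolding roots_eq root_list_def by (auto simp: symm_sl[OF symm_G])
  then show ?thesis using G_root by (simp add: sl.simps zero_prod_def)
qed

lemma G0_bounds: "460764050 / 10^10 \<le> G 0" "G 0 \<le> 460778957 / 10^10"
  using G_bounds by (simp_all add: zero_prod_def)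

text \<open>At its two poles the dipole is exactly 1/24 and -1/24 by \<open>G_root'\<close>, so
  their quartic contribution is explicit and the energy identity supplies the rest.\<close>

lemma dipole_values:
  assumes u: "u \<in> roots"
  shows "sqs (\<lambda>x. G x - G (x - u))" "low 0 \<le> (\<Sum>\<^sub>\<infinity>x. phi (G x - G (x - u)))"
    "(\<Sum>\<^sub>\<infinity>x. phi (G x - G (x - u))) \<le> high 0"
proof -
  let ?f = "\<lambda>x. G x - G (x - u)"
  note K = energy[OF u]
  show "sqs ?f" unfolding sqs_def by (rule has_sum_imp_summable[OF K])
  have u0: "u \<noteq> 0" using u by (auto simp: roots_def zero_prod_def)
  have v: "G 0 - G (- u) = 1/24" "G u - G 0 = - (1/24)"
    using G_root'[OF u] G_minus[of u] by simp_all
  have up: "(\<Sum>\<^sub>\<infinity>x. phi (?f x)) \<le> 2 * pi\<^sup>2 * (G 0 / 12) - 2 * (2/3 * pi^4 *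
      (1/24)^4 - 4/45 * pi^6 * (1/24)^6)"
    using phi_sum(2)[OF K, of "{0, u}"] u0 by (simp add: v)
  have lo: "2 * pi\<^sup>2 * (G 0 / 12) - 2/3 * pi^4 * (2 * (1/24)^4 + (G 0 / 12 - 2 *
      (1/24)\<^sup>2)\<^sup>2) \<le> (\<Sum>\<^sub>\<infinity>x. phi (?f x))"
    using phi_sum(3)[OF K, of "{0, u}"] u0 by (simp add: v)
  have "0.000194 \<le> 2/3 * pi^4 * (1/24)^4 - 4/45 * pi^6 * (1/24::real)^6"
    by (rule quartic_gain) auto
  moreover have "2 * pi\<^sup>2 * (G 0 / 12) \<le> 19.739209 * (460778957 / 10^10 / 12)"
    using pi2_bounds G0_bounds by (intro mult_mono divide_right_mono) auto
  ultimately show "(\<Sum>\<^sub>\<infinity>x. phi (?f x)) \<le> high 0" using up by (simp add: high_def)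
  have "(G 0 / 12 - 2 * (1/24)\<^sup>2)\<^sup>2 \<le> (460778957 / 10^10 / 12 - 2 * (1/24)\<^sup>2)\<^sup>2"
    using G0_bounds by (intro power_mono) (auto simp: power2_eq_square)
  then have "2/3 * pi^4 * (2 * (1/24)^4 + (G 0 / 12 - 2 * (1/24)\<^sup>2)\<^sup>2)
    \<le> 64.939396 * (2 * (1/24)^4 + (460778957 / 10^10 / 12 - 2 * (1/24)\<^sup>2)\<^sup>2)"
    using pi4_bounds by (intro mult_mono add_mono) auto
  moreover have "19.7392088 * (460764050 / 10^10 / 12) \<le> 2 * pi\<^sup>2 * (G 0 / 12)"
    using pi2_bounds G0_bounds by (intro mult_mono divide_right_mono) auto
  moreover have "low 0 \<le> 19.7392088 * (460764050 / 10^10 / 12)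
      - 64.939396 * (2 * (1/24)^4 + (460778957 / 10^10 / 12 - 2 * (1/24)\<^sup>2)\<^sup>2)"
    by (simp add: low_def power2_eq_square power_divide)
  ultimately show "low 0 \<le> (\<Sum>\<^sub>\<infinity>x. phi (?f x))" using lo by linarith
qed

section \<open>Nodes\<close>

lemma Cauchy_Schwarz_ip:
  assumes "fs w" "sqs g" shows "(ip w g)\<^sup>2 \<le> ip w w * ip g g"
proof -
  let ?X = "{x. w x \<noteq> 0}"
  have fin: "finite ?X" using assms(1) by (simp add: fs_def)
  have "(ip w g)\<^sup>2 = (\<Sum>x\<in>?X. w x * g x)\<^sup>2" by (simp add: fs_ip[OF assms(1)])
  also have "\<dots> \<le> (\<Sum>x\<in>?X. (w x)\<^sup>2) * (\<Sum>x\<in>?X. (g x)\<^sup>2)" by (rule Cauchy_Schwarz_ineq_sum)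
  also have "(\<Sum>x\<in>?X. (w x)\<^sup>2) = ip w w" by (simp add: fs_ip[OF assms(1)] power2_eq_square)
  also have "ip w w * (\<Sum>x\<in>?X. (g x)\<^sup>2) \<le> ip w w * ip g g"
  proof (rule mult_left_mono)
    show "(\<Sum>x\<in>?X. (g x)\<^sup>2) \<le> ip g g"
      unfolding ip_def power2_eq_square
      by (rule finite_sum_le_infsum) (use fin sqs_prod[OF assms(2,2)] in auto)
    show "0 \<le> ip w w" unfolding ip_def by (intro infsum_nonneg) simp
  qed
  finally show ?thesis .
qed

lemma ip_lap:
  assumes "sqs f" "sqs g" shows "ip (lap f) g = ip f (lap g)"
proof -
  have "ip (lap f) g = (\<Sum>\<^sub>\<infinity>x. 24 * (f x * g x) - nbr f x * g x)"
    by (simp add: ip_def lap_def left_diff_distrib mult.assoc)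
  also have "\<dots> = 24 * ip f g - ip (nbr f) g"
    unfolding ip_def by (intro infsumI has_sum_diff has_sum_cmult_right has_sum_infsum sqs_prod sqs_nbr assms)
  also have "\<dots> = (\<Sum>\<^sub>\<infinity>x. 24 * (f x * g x) - f x * nbr g x)"
    unfolding ip_nbr[OF assms] unfolding ip_def
    by (intro infsumI[symmetric] has_sum_diff has_sum_cmult_right has_sum_infsum sqs_prod sqs_nbr assms)
  also have "\<dots> = ip f (lap g)"
    by (simp add: ip_def lap_def algebra_simps)
  finally show ?thesis .
qed

lemma fs_lap_mass: "fs (lap (pt_mass a))"
proof -
  have "finite ({x. nbr (pt_mass a) x \<noteq> 0} \<union> {x. pt_mass a x \<noteq> 0})"
    using fs_nbr[OF fs_pt_mass] fs_pt_mass by (simp add: fs_def)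
  then show ?thesis unfolding fs_def by (rule rev_finite_subset) (use lap_def in force)
qed

lemma ip_lap_mass: "sqs g \<Longrightarrow> ip (lap (pt_mass a)) g = lap g a"
  by (simp add: ip_lap fs_sqs ip_pt_mass)

lemma lap_mass: "lap (pt_mass b) x = 24 * pt_mass b x - (if b - x \<in> roots then 1 else 0)"
proof -
  have "nbr (pt_mass b) x = (\<Sum>u\<in>roots. if u = b - x then 1 else 0)"
    unfolding nbr_def pt_mass_def by (intro sum.cong) (auto simp: algebra_simps)
  then show ?thesis by (simp add: lap_def)
qed

text \<open>Entries of the squared Laplacian. On the diagonal 600 is 24 squared plus the 24
  neighbours. Off it, the entry is the number of common neighbours, at most 24, lowered by 48 if the
  points are adjacent.\<close>

lemma lap_mass_gram:
  "lap (lap (pt_mass a)) a = 600"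
  "a \<noteq> b \<Longrightarrow> \<bar>lap (lap (pt_mass b)) a\<bar> \<le> 48"
proof -
  have z: "0 \<notin> roots" by (simp add: roots_def zero_prod_def)
  have "lap (pt_mass a) (a + u) = - 1" if "u \<in> roots" for u
    using that uminus_roots[OF that] z by (auto simp: lap_mass pt_mass_def)
  then have "nbr (lap (pt_mass a)) a = - 24" by (simp add: nbr_def card_roots)
  then show "lap (lap (pt_mass a)) a = 600"
    using z by (simp add: lap_def[of "lap (pt_mass a)"] lap_mass) (simp add: pt_mass_def)
  assume ab: "a \<noteq> b"
  have s: "(\<Sum>u\<in>roots. pt_mass b (a + u)) = (if b - a \<in> roots then 1 else 0)"
    using lap_mass[of b a] by (simp add: lap_def nbr_def)
  have n: "nbr (lap (pt_mass b)) a = 24 * (if b - a \<in> roots then 1 else 0)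
      - (\<Sum>u\<in>roots. if b - (a + u) \<in> roots then 1 else 0)"
    by (simp add: nbr_def lap_mass sum_subtractf s flip: sum_distrib_left)
  have "(\<Sum>u\<in>roots. if b - (a + u) \<in> roots then 1 else 0) \<le> (\<Sum>u\<in>roots. 1 :: real)" by (intro sum_mono) auto
  then have "(\<Sum>u\<in>roots. if b - (a + u) \<in> roots then 1 else 0) \<le> (24::real)" by (simp add: card_roots)
  moreover have "0 \<le> (\<Sum>u\<in>roots. if b - (a + u) \<in> roots then 1 else (0::real))" by (intro sum_nonneg) auto
  ultimately show "\<bar>lap (lap (pt_mass b)) a\<bar> \<le> 48"
    unfolding lap_def[of "lap (pt_mass b)"] n using ab
    by (simp only: lap_mass) (auto simp: pt_mass_def)
qed

lemma ip_scale: "ip (\<lambda>x. c * f x) (\<lambda>x. d * g x) = c * d * ip f g"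
proof -
  have "ip (\<lambda>x. c * f x) (\<lambda>x. d * g x) = (\<Sum>\<^sub>\<infinity>x. (c * d) * (f x * g x))"
    unfolding ip_def by (simp add: algebra_simps)
  then show ?thesis unfolding ip_def infsum_cmult_right' .
qed

text \<open>Pair \<open>g\<close> with the sum of the functions \<open>lap (pt_mass a)\<close>
  signed so that each term becomes an absolute value. The Gram entries bound the squared norm of
  this test function by 600 per point plus 48 per ordered pair of distinct points; Cauchy-Schwarz
  finishes.\<close>

lemma node_bound:
  assumes g: "sqs g" and T: "finite T"
  shows "(\<Sum>a\<in>T. \<bar>lap g a\<bar>)\<^sup>2 \<le> (552 * real (card T) + 48 * (real (card T))\<^sup>2) * ip g g"
proof -
  define s where "s a = (if 0 \<le> lap g a then 1 else - 1 :: real)" for a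
  define w where "w x = (\<Sum>a\<in>T. s a * lap (pt_mass a) x)" for x
  have fsw: "fs (\<lambda>x. s a * lap (pt_mass a) x)" for a
    using fs_lap_mass[of a] unfolding fs_def by (rule rev_finite_subset) auto
  have fw: "fs w" unfolding w_def by (intro fs_sum T fsw)
  have "ip w g = (\<Sum>a\<in>T. ip (\<lambda>x. s a * lap (pt_mass a) x) g)"
    unfolding w_def by (intro ip_sum_left T fsw g)
  also have "\<dots> = (\<Sum>a\<in>T. \<bar>lap g a\<bar>)"
    using ip_scale[of _ _ 1 g] by (intro sum.cong) (auto simp: ip_lap_mass[OF g] s_def)
  finally have wg: "ip w g = (\<Sum>a\<in>T. \<bar>lap g a\<bar>)" .
  have "ip w w = (\<Sum>a\<in>T. \<Sum>b\<in>T. s a * s b * lap (lap (pt_mass b)) a)"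
    unfolding w_def
    by (subst ip_sum_sum[OF T T fsw fsw]) (simp only: ip_scale ip_lap_mass[OF fs_sqs[OF fs_lap_mass]])
  also have "\<dots> \<le> (\<Sum>a\<in>T. \<Sum>b\<in>T. 48 + (if b = a then 552 else 0))"
  proof (intro sum_mono)
    fix a b
    show "s a * s b * lap (lap (pt_mass b)) a \<le> 48 + (if b = a then 552 else 0)"
      using lap_mass_gram(1)[of a] lap_mass_gram(2)[of a b] by (cases "b = a") (auto simp: s_def)
  qed
  also have "\<dots> = 552 * real (card T) + 48 * (real (card T))\<^sup>2"
    using T by (simp add: sum.distrib power2_eq_square algebra_simps)
  finally have ww: "ip w w \<le> 552 * real (card T) + 48 * (real (card T))\<^sup>2" .
  have "0 \<le> ip g g" unfolding ip_def by (intro infsum_nonneg) simp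
  then have "ip w w * ip g g \<le> (552 * real (card T) + 48 * (real (card T))\<^sup>2) * ip g g"
    using ww by (intro mult_right_mono)
  then show ?thesis using Cauchy_Schwarz_ip[OF fw g] unfolding wg by linarith
qed

lemma sqs_van: "sqs g \<Longrightarrow> e > 0 \<Longrightarrow> finite {x. g x \<le> - e}"
  by (rule finite_subset[OF _ sqs_tendsto[of g e]]) auto

text \<open>Applied in contrapositive form. The maximum principle, used for \<open>g\<close> and for
  its negative, only inspects points where the function is nonzero, hence only points of
  \<open>D\<close>.\<close>

lemma node_exists:
  assumes g: "sqs g" "supp_in D g" and z: "\<And>x. x \<in> D \<Longrightarrow> lap g x = 0"
  shows "g x = 0"
proof -
  have eq: "nbr g x = 24 * g x" if "g x \<noteq> 0" for x
    using z[of x] that supp_inD[OF g(2), of x] by (cases "x \<in> D") (simp_all add: lap_def)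
  have "0 \<le> g x"
    by (rule max_principle[OF sqs_van[OF g(1)]]) (use eq in force)+
  moreover have "0 \<le> - g x"
  proof (rule max_principle[of "\<lambda>x. - g x"])
    show "finite {x. - g x \<le> - e}" if "e > 0" for e
      by (rule finite_subset[OF _ sqs_tendsto[OF g(1) that]]) auto
    show "nbr (\<lambda>x. - g x) x \<le> 24 * - g x" if "- g x < 0" for x
      using eq[of x] that by (simp add: nbr_uminus)
  qed
  ultimately show ?thesis by simp
qed

lemma table_far: "sorted_all (\<lambda>a b c d. nrm a b c d \<le> 2 \<or> look4 tabh a b c d \<le> 20192978) 6 48"
  by code_simp

lemma nr_sym: "nr (swap12 x) = nr x" "nr (swap23 x) = nr x" "nr (swap34 x) = nr x" "nr (neg1 x) = nr x"
  by (cases x; simp add: nr_nrm nrm_def swap12_def swap23_def swap34_def neg1_def)+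

lemma G_far:
  assumes "x \<noteq> 0" "x \<notin> roots" shows "G x \<le> 20192978 / 10^10"
proof -
  have "nr x \<le> 2 \<or> G x \<le> 20192978 / 10^10"
  proof (rule fundamental_domain[of "\<lambda>x. nr x \<le> 2 \<or> G x \<le> 20192978 / 10^10"])
    fix x :: pt
    have f: "G (swap12 x) = G x" "G (swap23 x) = G x" "G (swap34 x) = G x" "G (neg1 x) = G x"
      using symm_G by (auto simp: symm_def)
    let ?Q = "\<lambda>x. nr x \<le> 2 \<or> G x \<le> 20192978 / 10^10"
    show "?Q (swap12 x) \<Longrightarrow> ?Q x" "?Q (swap23 x) \<Longrightarrow> ?Q x" "?Q (swap34 x) \<Longrightarrow> ?Q x"
      "?Q (neg1 x) \<Longrightarrow> ?Q x" unfolding f nr_sym by assumption+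
    assume s: "sorted4 x"
    obtain a b c d where x: "x = (a, b, c, d)" by (cases x)
    have o: "0 \<le> d" "d \<le> c" "c \<le> b" "b \<le> a" using s by (auto simp: x sorted4_def)
    show "?Q x"
    proof (cases "even (a + b + c + d)")
      case False
      then show ?thesis using G_odd[of x] by (simp add: x even_pt_def)
    next
      case ev: True
      have "h x = (if nrm a b c d \<le> 48 then real_of_int (look4 tabh a b c d) / 10^10
          else 85323 / 10^7 / (real_of_int (nrm a b c d) + 1/5))"
        unfolding x gfun_def prod.case by (rule if_not_P) (use ev in blast)
      then have h: "G x \<le> (if nrm a b c d \<le> 48 then real_of_int (look4 tabh a b c d) / 10^10
          else 85323 / 10^7 / (real_of_int (nrm a b c d) + 1/5))"
        using G_le_h[of x] by simp
      show ?thesis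
      proof (cases "nrm a b c d \<le> 48")
        case True
        have "nrm a b c d \<le> 2 \<or> look4 tabh a b c d \<le> 20192978"
          using sorted_allD[OF table_far o True ev] by simp
        then show ?thesis using h True by (auto simp: x nr_nrm)
      next
        case False
        then have "49 \<le> real_of_int (nrm a b c d)" by simp
        then have "85323 / 10^7 / (real_of_int (nrm a b c d) + 1/5) \<le> 85323 / 10^7 / (49 + 1/5)"
          by (intro divide_left_mono mult_pos_pos) auto
        then show ?thesis using h False by simp
      qed
    qed
  qed
  moreover have "G x = 0" if "nr x \<le> 2"
  proof (rule G_odd)
    obtain a b c d where x: "x = (a, b, c, d)" by (cases x)
    have s: "nr x = a\<^sup>2 + b\<^sup>2 + c\<^sup>2 + d\<^sup>2" by (simp add: x nr_nrm nrm_def power2_eq_square)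
    have "nr x \<noteq> 2" using assms(2) unfolding s by (simp add: x roots_def)
    moreover have "nr x \<noteq> 0" using assms(1) unfolding s
      by (auto simp: x zero_prod_def add_nonneg_eq_0_iff)
    moreover have "0 \<le> nr x" unfolding s by simp
    ultimately have "nr x = 1" using that by linarith
    then show "\<not> even_pt x" using even_nr[of x] by simp
  qed
  ultimately show ?thesis by auto
qed

text \<open>\<open>G\<close> decays like \<open>1 / nr x\<close>, which is not square summable in dimension four: each block below carries
  a fixed amount of mass.\<close>

lemma G_not_sqs: "\<not> sqs G"
proof
  assume s: "sqs G"
  \<comment> \<open>Doubling keeps all coordinates even, hence the points even, and the first
    coordinate, at least 2n, avoids any given finite set for large n. The norm is at most 4 (4 + 1 +
    1 + 1) n^2 = 28 n^2, and \<open>8 \<le> n\<close> puts the block beyond the table of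
    \<open>l\<close>.\<close>
  define b :: "nat \<Rightarrow> nat \<times> nat \<times> nat \<times> nat \<Rightarrow> pt" where
    "b n = (\<lambda>(i, j, k, m). (2 * int (n + i), 2 * int j, 2 * int k, 2 * int m))" for n
  let ?I = "\<lambda>n. {..<n} \<times> {..<n} \<times> {..<n} \<times> {..<n::nat}"
  define c :: real where "c = (84033 / 10^7 / 28)\<^sup>2"
  have c: "0 < c" by (simp add: c_def)
  have block: "c \<le> (\<Sum>x\<in>b n ` ?I n. (G x)\<^sup>2)" if n: "8 \<le> n" for n
  proof -
    have inj: "inj_on (b n) (?I n)" by (auto simp: inj_on_def b_def)
    have "c / real n ^ 4 \<le> (G (b n p))\<^sup>2" if p: "p \<in> ?I n" for p
    proof -
      obtain i j k m where pp: "p = (i, j, k, m)" by (cases p)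
      have lt: "i < n" "j < n" "k < n" "m < n" using p by (auto simp: pp)
      let ?N = "nrm (2 * int (n + i)) (2 * int j) (2 * int k) (2 * int m)"
      have bp: "b n p = (2 * int (n + i), 2 * int j, 2 * int k, 2 * int m)" by (simp add: b_def pp)
      have sq: "int j * int j \<le> int n * int n" "int k * int k \<le> int n * int n" "int m * int m \<le> int n * int n"
        "int (n + i) * int (n + i) \<le> (2 * int n) * (2 * int n)" "int n * int n \<le> int (n + i) * int (n + i)"
        "8 * 8 \<le> int n * int n"
        using lt n by (intro mult_mono; simp)+
      have N: "?N \<le> 28 * (int n * int n)" "60 < ?N"
        unfolding nrm_def using sq zero_le_square[of "int j"] zero_le_square[of "int k"] zero_le_square[of "int m"]
        by linarith+
      have Nr: "real_of_int ?N \<le> 28 * real n ^ 2" "60 < real_of_int ?N"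
      proof -
        have "real_of_int ?N \<le> real_of_int (28 * (int n * int n))" using N(1) by (simp only: of_int_le_iff)
        then show "real_of_int ?N \<le> 28 * real n ^ 2" by (simp add: power2_eq_square)
        show "60 < real_of_int ?N" using N(2) by linarith
      qed
      have "84033 / 10^7 / 28 / real n ^ 2 = 84033 / 10^7 / (28 * real n ^ 2)" by simp
      also have "\<dots> \<le> 84033 / 10^7 / (real_of_int ?N - 1/10)"
        using Nr n by (intro divide_left_mono mult_pos_pos) auto
      also have "\<dots> = l (b n p)" using N(2) unfolding bp by (simp add: gfun_def)
      also have "\<dots> \<le> G (b n p)" by (rule l_le_G)
      finally have "(84033 / 10^7 / 28 / real n ^ 2)\<^sup>2 \<le> (G (b n p))\<^sup>2" by (rule power_mono) simp
      then show ?thesis by (simp add: c_def power_divide flip: power_mult)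
    qed
    then have "(\<Sum>p\<in>?I n. c / real n ^ 4) \<le> (\<Sum>p\<in>?I n. (G (b n p))\<^sup>2)" by (rule sum_mono)
    also have "(\<Sum>p\<in>?I n. c / real n ^ 4) = c"
      using n by (simp add: eval_nat_numeral)
    also have "(\<Sum>p\<in>?I n. (G (b n p))\<^sup>2) = (\<Sum>x\<in>b n ` ?I n. (G x)\<^sup>2)"
      by (simp add: sum.reindex[OF inj])
    finally show ?thesis .
  qed
  have sm: "(\<lambda>x. (G x)\<^sup>2) summable_on UNIV" using s by (simp add: sqs_def)
  let ?M = "\<Sum>\<^sub>\<infinity>x. (G x)\<^sup>2"
  obtain F where F: "finite F" "?M - c < (\<Sum>x\<in>F. (G x)\<^sup>2)"
  proof -
    have "\<forall>\<^sub>F F in finite_subsets_at_top UNIV. ?M - c < (\<Sum>x\<in>F. (G x)\<^sup>2)"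
      using has_sum_infsum[OF sm] c unfolding has_sum_def by (intro order_tendstoD(1)) auto
    then show ?thesis using that unfolding eventually_finite_subsets_at_top by blast
  qed
  define M where "M = Max (insert 0 (fst ` F))"
  define n where "n = 8 + nat M"
  have "fst x < 2 * int (n + i)" if "x \<in> F" for x i
  proof -
    have "fst x \<le> M" "0 \<le> M"
      unfolding M_def using F(1) that by (intro Max_ge; simp)+
    then have "fst x \<le> int (nat M)" "int (nat M) = M" by simp_all
    then show ?thesis unfolding n_def using \<open>0 \<le> M\<close> by simp
  qed
  then have disj: "F \<inter> b n ` ?I n = {}" by (force simp: b_def)
  have "(\<Sum>x\<in>F. (G x)\<^sup>2) + (\<Sum>x\<in>b n ` ?I n. (G x)\<^sup>2) = (\<Sum>x\<in>F \<union> b n ` ?I n. (G x)\<^sup>2)"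
    using F(1) disj by (intro sum.union_disjoint[symmetric]) auto
  also have "\<dots> \<le> ?M" by (rule finite_sum_le_infsum[OF sm]) (use F in auto)
  finally show False using F(2) block[of n] by (simp add: n_def)
qed

section \<open>Lower bound for the functional with reflections\<close>

lemma cut_has_sum:
  assumes "sqs g" "supp_in D g" shows "((\<lambda>x. (g x)\<^sup>2) has_sum ip g g) D"
  by (rule has_sum_cong_neutral[THEN iffD1, OF _ _ _ has_sum_ip[OF assms(1) refl]])
    (use assms(2) in \<open>auto simp: supp_in_def\<close>)

lemma norm_le_phi:
  assumes g: "sqs g" "supp_in D g" and sm: "\<And>x. \<bar>g x\<bar> \<le> 1/16"
  shows "19 * ip g g \<le> (\<Sum>\<^sub>\<infinity>x\<in>D. phi (g x))"
proof -
  note K = cut_has_sum[OF g]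
  have "19 * ip g g = (\<Sum>\<^sub>\<infinity>x\<in>D. 19 * (g x)\<^sup>2)"
    unfolding infsum_cmult_right' infsumI[OF K] ..
  also have "\<dots> \<le> (\<Sum>\<^sub>\<infinity>x\<in>D. phi (g x))"
    by (rule infsum_mono[OF summable_on_cmult_right[OF has_sum_imp_summable[OF K]] phi_sum(1)[OF K, of "{}"]])
      (use phi_quad sm in auto)
  finally show ?thesis .
qed

lemma Ints_nonzero: "(t::real) \<in> \<int> \<Longrightarrow> t \<noteq> 0 \<Longrightarrow> 1 \<le> \<bar>t\<bar>"
  by (auto elim!: Ints_cases)

lemma Ints_two: "(t::real) \<in> \<int> \<Longrightarrow> t \<noteq> 0 \<Longrightarrow> \<bar>t\<bar>
    \<noteq> 1 \<Longrightarrow> 2 \<le> \<bar>t\<bar>"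
proof (elim Ints_cases)
  fix z assume "t \<noteq> 0" "\<bar>t\<bar> \<noteq> 1" and t: "t = of_int z"
  then have "z \<noteq> 0" "\<bar>z\<bar> \<noteq> 1" by auto
  then have "2 \<le> \<bar>z\<bar>" by linarith
  then show "2 \<le> \<bar>t\<bar>" unfolding t by linarith
qed

text \<open>At a minimal violation of \<open>green k (pole k) x \<le> g (x + t)\<close> both sides are harmonic or have the
  same source.\<close>

lemma green_dominates:
  assumes k: "1 \<le> k" "k \<le> 4" and g: "sqs g" "supp_in (chamber k) g"
    and a: "a \<in> chamber k" and lap: "\<And>x. x \<in> chamber k \<Longrightarrow> lap g x = pt_mass a x"
  shows "green k (pole k) x \<le> g (x + (a - pole k))"
proof -
  let ?q = "green k (pole k)" and ?t = "a - pole k"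
  note y = pole_chamber[OF k(2)]
  have g0: "0 \<le> g x" for x
  proof (rule max_principle[OF sqs_van[OF g(1)]])
    fix x assume "g x < 0"
    then have "x \<in> chamber k" using supp_inD[OF g(2), of x] by fastforce
    then show "nbr g x \<le> 24 * g x" using lap[of x] by (simp add: lap_def pt_mass_def split: if_splits)
  qed
  have "0 \<le> g (x + ?t) - ?q x"
  proof (rule max_principle[of "\<lambda>x. g (x + ?t) - ?q x"])
    fix e :: real assume "e > 0"
    show "finite {x. g (x + ?t) - ?q x \<le> - e}"
    proof (rule finite_subset[OF _ sqs_tendsto[OF green_values(1)[OF k] \<open>e > 0\<close>]])
      show "{x. g (x + ?t) - ?q x \<le> - e} \<subseteq> {x. e \<le> \<bar>?q x\<bar>}"
        using g0 by (smt (verit) Collect_mono)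
    qed
  next
    fix x assume neg: "g (x + ?t) - ?q x < 0"
    then have "?q x \<noteq> 0" using g0[of "x + ?t"] by linarith
    then have x: "x \<in> chamber k" by (simp add: green_def split: if_splits)
    \<comment> \<open>The first \<open>k\<close> coordinates of the pole are one, so those of
      \<open>a - pole k\<close> are nonnegative and the translation maps the chamber into
      itself.\<close>
    have xt: "x + ?t \<in> chamber k"
      unfolding chamber_def
    proof (intro CollectI allI impI)
      fix i assume i: "i < k"
      then have "0 < coord i x" "0 < coord i a" using x a by (auto simp: chamber_def)
      then show "0 < coord i (x + ?t)"
        using pole_coord[OF i k(2)] by (simp add: coord_add coord_diff)
    qed
    have "lap (\<lambda>x. g (x + ?t) - ?q x) x = 0"
      unfolding lap_diff lap_shift lap[OF xt] green_lap[OF k(2) y x]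
      by (simp add: pt_mass_def algebra_simps)
    then show "nbr (\<lambda>x. g (x + ?t) - ?q x) x \<le> 24 * (g (x + ?t) - ?q x)"
      by (simp add: lap_def)
  qed
  then show ?thesis by simp
qed

text \<open>Pointwise domination passes to the functional because both functions stay in the range
  from 0 to 1/2, where \<open>phi\<close> increases; the bound 1/16 on \<open>g\<close> guarantees
  this.\<close>

lemma functional_one_node:
  assumes k: "1 \<le> k" "k \<le> 4" and g: "sqs g" "supp_in (chamber k) g" and sm: "\<And>x. \<bar>g x\<bar> \<le> 1/16"
    and a: "a \<in> chamber k" and lap: "\<And>x. x \<in> chamber k \<Longrightarrow> lap g x = pt_mass a x"
  shows "low k \<le> (\<Sum>\<^sub>\<infinity>x\<in>chamber k. phi (g x))"
proof -
  let ?q = "green k (pole k)" and ?t = "a - pole k"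
  note y = pole_chamber[OF k(2)]
  note dom = green_dominates[OF k g a lap]
  have suppq: "supp_in (chamber k) ?q" by (simp add: supp_in_def green_def)
  have sg: "(\<lambda>x. phi (g x)) summable_on UNIV"
    using phi_sum(1)[OF has_sum_ip[OF g(1) refl], of "{}"] by simp
  have ph: "phi (?q x) \<le> phi (g (x + ?t))" for x
    by (rule phi_mono) (use green_nonneg[OF k(2) y] dom sm[of "x + ?t"] in auto)
  have "low k \<le> (\<Sum>\<^sub>\<infinity>x\<in>chamber k. phi (?q x))" by (rule green_values[OF k])
  also have "\<dots> = (\<Sum>\<^sub>\<infinity>x. phi (?q x))"
    by (rule infsum_cong_neutral) (auto simp: green_def phi_def)
  also have "\<dots> \<le> (\<Sum>\<^sub>\<infinity>x. phi (g (x + ?t)))"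
  proof (rule infsum_mono)
    show "(\<lambda>x. phi (?q x)) summable_on UNIV"
      using phi_sum(1)[OF has_sum_ip[OF green_values(1)[OF k] refl], of "{}"] by simp
    show "(\<lambda>x. phi (g (x + ?t))) summable_on UNIV"
      using sg summable_shift[of "\<lambda>x. phi (g x)" ?t] by simp
  qed (rule ph)
  also have "\<dots> = (\<Sum>\<^sub>\<infinity>x. phi (g x))" by (rule infsum_shift)
  also have "\<dots> = (\<Sum>\<^sub>\<infinity>x\<in>chamber k. phi (g x))"
    by (rule infsum_cong_neutral) (use g(2) in \<open>auto simp: supp_in_def phi_def\<close>)
  finally show ?thesis .
qed

text \<open>The largest bound with a reflection is \<open>low 1 = 0.0439257\<close>, so a
  counterexample has squared norm at most 0.0439257/19. Two nodes would require 4 to be at most 1296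
  times this, which is below 3, and a node of weight two would require 4 to be at most 600 times
  this. One node of weight one remains, up to a sign.\<close>

lemma functional_lower_boundary:
  assumes k: "1 \<le> k" "k \<le> 4" and g: "sqs g" "supp_in (chamber k) g" and sm: "\<And>x. \<bar>g x\<bar> \<le> 1/16"
    and int: "\<And>x. x \<in> chamber k \<Longrightarrow> lap g x \<in> \<int>" and nz: "g z \<noteq> 0"
  shows "low k \<le> (\<Sum>\<^sub>\<infinity>x\<in>chamber k. phi (g x))"
proof (rule ccontr)
  assume "\<not> ?thesis"
  then have small: "(\<Sum>\<^sub>\<infinity>x\<in>chamber k. phi (g x)) < low k" by simp
  have "low k \<le> 0.0439257" using k by (simp add: low_def)
  then have nrm: "ip g g \<le> 0.0439257 / 19" using norm_le_phi[OF g sm] small by simp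
  obtain a where a: "a \<in> chamber k" "lap g a \<noteq> 0" using node_exists[OF g] nz by blast
  have "lap g b = 0" if b: "b \<in> chamber k" "b \<noteq> a" for b
  proof (rule ccontr)
    assume "lap g b \<noteq> 0"
    then have "2\<^sup>2 \<le> (\<Sum>x\<in>{a, b}. \<bar>lap g x\<bar>)\<^sup>2"
      using Ints_nonzero[OF int[OF a(1)] a(2)] Ints_nonzero[OF int[OF b(1)]] b(2)
      by (intro power_mono) auto
    also have "\<dots> \<le> 1296 * ip g g" using node_bound[OF g(1), of "{a, b}"] b(2) by simp
    finally show False using nrm by simp
  qed
  then have oth: "\<And>b. b \<in> chamber k \<Longrightarrow> b \<noteq> a \<Longrightarrow> lap g b = 0" .
  have "\<bar>lap g a\<bar> = 1"
  proof (rule ccontr)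
    assume "\<bar>lap g a\<bar> \<noteq> 1"
    then have "2\<^sup>2 \<le> \<bar>lap g a\<bar>\<^sup>2" using Ints_two[OF int[OF a(1)] a(2)] by (intro power_mono) auto
    also have "\<dots> \<le> 600 * ip g g" using node_bound[OF g(1), of "{a}"] by simp
    finally show False using nrm by simp
  qed
  then consider "lap g a = 1" | "lap g a = - 1" by linarith
  then show False
  proof cases
    case 1
    then have "lap g x = pt_mass a x" if "x \<in> chamber k" for x using oth that by (simp add: pt_mass_def)
    then show False using functional_one_node[OF k g sm a(1)] small by simp
  next
    case 2
    have g': "sqs (\<lambda>x. - g x)" "supp_in (chamber k) (\<lambda>x. - g x)"
      using g by (auto simp: sqs_def supp_in_def)
    have "lap (\<lambda>x. - g x) x = pt_mass a x" if "x \<in> chamber k" for x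
      using oth that 2 by (simp add: pt_mass_def lap_uminus)
    then have "low k \<le> (\<Sum>\<^sub>\<infinity>x\<in>chamber k. phi (- g x))"
      using sm by (intro functional_one_node[OF k g' _ a(1)]) auto
    then show False using small by (simp add: phi_minus)
  qed
qed

section \<open>Lower bound for the functional without reflections\<close>

lemma lap_G_shift: "lap (\<lambda>x. G (x - a)) x = pt_mass a x"
  using lap_shift[of G "- a" x] by (simp add: lap_G pt_mass_def)

lemma G_shift_vanish: "e > 0 \<Longrightarrow> finite {x. G (x - a) \<ge> e}"
  using finite_vimageI[OF G_vanish[of e], of "\<lambda>x. x - a"] by (simp add: vimage_def inj_on_def)

lemma dominates_G:
  assumes g: "sqs g" and lap: "\<And>x. pt_mass a x \<le> lap g x" shows "G (x - a) \<le> g x"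
proof -
  have "0 \<le> g x - G (x - a)"
  proof (rule max_principle[of "\<lambda>x. g x - G (x - a)"])
    fix e :: real assume "e > 0"
    then have "finite ({x. \<bar>g x\<bar> \<ge> e/2} \<union> {x. G (x - a) \<ge> e/2})"
      using sqs_tendsto[OF g, of "e/2"] G_shift_vanish[of "e/2" a] by simp
    moreover have "{x. g x - G (x - a) \<le> - e} \<subseteq> {x. \<bar>g x\<bar> \<ge> e/2} \<union> {x. G (x - a) \<ge> e/2}"
    proof
      fix x assume "x \<in> {x. g x - G (x - a) \<le> - e}"
      then show "x \<in> {x. \<bar>g x\<bar> \<ge> e/2} \<union> {x. G (x - a) \<ge> e/2}" by simp linarith
    qed
    ultimately show "finite {x. g x - G (x - a) \<le> - e}" by (rule rev_finite_subset)
  next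
    fix x show "nbr (\<lambda>x. g x - G (x - a)) x \<le> 24 * (g x - G (x - a))"
      using lap[of x] lap_diff[of g "\<lambda>x. G (x - a)" x] by (simp add: lap_G_shift lap_def)
  qed
  then show ?thesis by simp
qed

text \<open>Such a \<open>g\<close> would dominate a translate of \<open>G\<close>, which is not
  square summable. So without reflections nodes of both signs must occur.\<close>

lemma no_positive_source:
  assumes "sqs g" "\<And>x. pt_mass a x \<le> lap g x" shows False
proof -
  have "sqs (\<lambda>x. G (x - a))"
    unfolding sqs_def
  proof (rule summable_on_comparison_test[OF assms(1)[unfolded sqs_def]])
    show "(G (x - a))\<^sup>2 \<le> (g x)\<^sup>2" for x
      using dominates_G[OF assms] G_nonneg by (intro power_mono)
  qed simp
  then have "sqs G" using sqs_shift[of "\<lambda>x. G (x - a)" a] by simp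
  then show False using G_not_sqs by simp
qed

lemma dipole_unique:
  assumes g: "sqs g" and lap: "\<And>x. lap g x = pt_mass a x - pt_mass b x"
  shows "g x = G (x - a) - G (x - b)"
proof -
  let ?d = "\<lambda>x. G (x - a) - G (x - b)"
  have van: "finite {x. \<bar>g x - ?d x\<bar> \<ge> e}" if "e > 0" for e
  proof (rule rev_finite_subset)
    show "finite ({x. \<bar>g x\<bar> \<ge> e/3} \<union> {x. G (x - a) \<ge> e/3} \<union> {x. G (x - b) \<ge> e/3})"
      using sqs_tendsto[OF g, of "e/3"] G_shift_vanish[of "e/3"] that by simp
    show "{x. \<bar>g x - ?d x\<bar> \<ge> e} \<subseteq> {x. \<bar>g x\<bar> \<ge> e/3} \<union> {x. G (x -
        a) \<ge> e/3} \<union> {x. G (x - b) \<ge> e/3}"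
    proof
      fix x assume "x \<in> {x. \<bar>g x - ?d x\<bar> \<ge> e}"
      moreover have "\<bar>g x - ?d x\<bar> \<le> \<bar>g x\<bar> + G (x - a) + G (x - b)"
        using G_nonneg[of "x - a"] G_nonneg[of "x - b"] by linarith
      ultimately show "x \<in> {x. \<bar>g x\<bar> \<ge> e/3} \<union> {x. G (x - a) \<ge> e/3} \<union> {x. G (x - b) \<ge> e/3}"
        by simp linarith
    qed
  qed
  have har: "nbr (\<lambda>x. g x - ?d x) x = 24 * (g x - ?d x)" for x
    using lap_diff[of g ?d x] lap_diff[of "\<lambda>x. G (x - a)" "\<lambda>x. G (x - b)" x]
    by (simp add: lap lap_G_shift) (simp add: lap_def)
  have "0 \<le> g x - ?d x"
  proof (rule max_principle[of "\<lambda>x. g x - ?d x"])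
    show "finite {x. g x - ?d x \<le> - e}" if "e > 0" for e
      by (rule finite_subset[OF _ van[OF that]]) auto
    show "nbr (\<lambda>x. g x - ?d x) x \<le> 24 * (g x - ?d x)" for x
      unfolding har by simp
  qed
  moreover have "0 \<le> - (g x - ?d x)"
  proof (rule max_principle[of "\<lambda>x. - (g x - ?d x)"])
    show "finite {x. - (g x - ?d x) \<le> - e}" if "e > 0" for e
      by (rule finite_subset[OF _ van[OF that]]) auto
    show "nbr (\<lambda>x. - (g x - ?d x)) x \<le> 24 * - (g x - ?d x)" for x
      unfolding nbr_uminus har by simp
  qed
  ultimately show ?thesis by simp
qed

text \<open>Adjacent poles are a translate of the extremal dipole. Otherwise each pole sees at least
  \<open>G 0\<close> minus the bound of \<open>G_far\<close>, more than 0.0439, and the two poles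
  alone already contribute enough.\<close>

lemma functional_dipole:
  assumes "a \<noteq> b" and g: "sqs (\<lambda>x. G (x - a) - G (x - b))"
  shows "low 0 \<le> (\<Sum>\<^sub>\<infinity>x. phi (G (x - a) - G (x - b)))"
proof (cases "b - a \<in> roots")
  case True
  have "(\<Sum>\<^sub>\<infinity>x. phi (G x - G (x - (b - a)))) = (\<Sum>\<^sub>\<infinity>x. phi (G (x - a) - G (x - b)))"
    using infsum_shift[of "\<lambda>x. phi (G x - G (x - (b - a)))" "- a"] by (simp add: algebra_simps)
  then show ?thesis using dipole_values(2)[OF True] by simp
next
  case False
  have far: "G (b - a) \<le> 20192978 / 10^10" using G_far[OF _ False] assms(1) by simp
  then have far': "G (a - b) \<le> 20192978 / 10^10" using G_minus[of "b - a"] by simp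
  let ?f = "\<lambda>x. G (x - a) - G (x - b)"
  have v: "0.0439 \<le> ?f a" "?f a \<le> 1/2" "0.0439 \<le> - ?f b" "- ?f b \<le> 1/2"
    using far far' G0_bounds G_nonneg[of "a - b"] G_nonneg[of "b - a"] by simp_all
  have "low 0 / 2 \<le> 2 * 9.8696044 * 0.0439\<^sup>2 - 2/3 * 97.409094 * 0.0439^4"
    by (simp add: low_def power2_eq_square eval_nat_numeral)
  also have "\<dots> \<le> 2 * pi\<^sup>2 * 0.0439\<^sup>2 - 2/3 * pi^4 * 0.0439^4"
    using pi2_bounds pi4_bounds by (intro diff_mono mult_right_mono mult_left_mono) auto
  also have "\<dots> \<le> phi 0.0439" by (rule phi_lower)
  finally have ph: "low 0 / 2 \<le> phi 0.0439" .
  have "phi 0.0439 \<le> phi (?f a)" "phi 0.0439 \<le> phi (- ?f b)" using v by (intro phi_mono; simp)+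
  then have "low 0 \<le> (\<Sum>x\<in>{a, b}. phi (?f x))"
    using ph assms(1) phi_minus[of "?f b"] by simp
  also have "\<dots> \<le> (\<Sum>\<^sub>\<infinity>x. phi (?f x))"
    by (rule finite_sum_le_infsum)
      (use phi_sum(1)[OF has_sum_ip[OF g refl], of "{}"] phi_nonneg in auto)
  finally show ?thesis .
qed

text \<open>A counterexample has squared norm at most 0.075314/19. A node of weight two is excluded
  since 600 times this is below 4, three nodes since 2088 times this is below 9. With
  \<open>no_positive_source\<close> exactly one node of each sign is left, so the function is a
  dipole.\<close>

lemma functional_lower_bulk:
  assumes g: "sqs g" and sm: "\<And>x. \<bar>g x\<bar> \<le> 1/16" and int: "\<And>x. lap g x \<in> \<int>" and nz: "g z \<noteq> 0"
  shows "low 0 \<le> (\<Sum>\<^sub>\<infinity>x. phi (g x))"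
proof (rule ccontr)
  assume "\<not> ?thesis"
  then have small: "(\<Sum>\<^sub>\<infinity>x. phi (g x)) < low 0" by simp
  have supp: "supp_in UNIV g" by (simp add: supp_in_def)
  have nrm: "ip g g \<le> 0.075314 / 19" using norm_le_phi[OF g supp sm] small by (simp add: low_def)
  obtain a where a: "lap g a \<noteq> 0" using node_exists[OF g supp] nz by blast
  have one: "\<bar>lap g x\<bar> = 1" if "lap g x \<noteq> 0" for x
  proof (rule ccontr)
    assume "\<bar>lap g x\<bar> \<noteq> 1"
    then have "2\<^sup>2 \<le> \<bar>lap g x\<bar>\<^sup>2" using Ints_two[OF int that] by (intro power_mono) auto
    also have "\<dots> \<le> 600 * ip g g" using node_bound[OF g, of "{x}"] by simp
    finally show False using nrm by simp
  qed
  have cases3: "lap g x = 0 \<or> lap g x = 1 \<or> lap g x = - 1" for x using one[of x] by linarith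
  have neg: "sqs (\<lambda>x. - g x)" using g by (simp add: sqs_def)
  have "\<exists>x. lap g x = 1"
  proof (rule ccontr)
    assume "\<nexists>x. lap g x = 1"
    then have "pt_mass a x \<le> lap (\<lambda>x. - g x) x" for x
      using cases3[of x] cases3[of a] a by (auto simp: lap_uminus pt_mass_def)
    then show False by (rule no_positive_source[OF neg])
  qed
  moreover have "\<exists>x. lap g x = - 1"
  proof (rule ccontr)
    assume "\<nexists>x. lap g x = - 1"
    then have "pt_mass a x \<le> lap g x" for x
      using cases3[of x] cases3[of a] a by (auto simp: pt_mass_def)
    then show False by (rule no_positive_source[OF g])
  qed
  ultimately obtain b c where b: "lap g b = 1" and c: "lap g c = - 1" by blast
  then have bc: "b \<noteq> c" by auto
  have oth: "lap g x = 0" if x: "x \<noteq> b" "x \<noteq> c" for x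
  proof (rule ccontr)
    assume "lap g x \<noteq> 0"
    then have "3\<^sup>2 = (\<Sum>y\<in>{b, c, x}. \<bar>lap g y\<bar>)\<^sup>2" using one[of x] b c bc x by simp
    also have "\<dots> \<le> 2088 * ip g g" using node_bound[OF g, of "{b, c, x}"] bc x by simp
    finally show False using nrm by simp
  qed
  have "g x = G (x - b) - G (x - c)" for x
    by (rule dipole_unique[OF g]) (use oth b c bc in \<open>auto simp: pt_mass_def\<close>)
  then have "g = (\<lambda>x. G (x - b) - G (x - c))" by (rule ext)
  then show False using functional_dipole[OF bc] g small by simp
qed

section \<open>Reduction modulo one\<close>

definition admissible :: "nat \<Rightarrow> (pt \<Rightarrow> real) \<Rightarrow> bool" where
  "admissible k f \<longleftrightarrow> sqs f \<and> (\<forall>x. \<not> even_pt x \<longrightarrow> f x = 0) \<and>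
     (\<forall>i<k. \<forall>x. f (negs i x) = - f x) \<and> (\<forall>x. lap f x \<in> \<int>)"

lemma antisym_wall:
  fixes f :: "pt \<Rightarrow> real"
  assumes "\<And>i x. i < k \<Longrightarrow> f (negs i x) = - f x" "k \<le> 4" "i < k" "coord i x = 0"
  shows "f x = 0"
  using assms(1)[OF assms(3), of x] negs_fix[of i x] assms(2-4) by simp

lemma fold_into_chamber:
  fixes f :: "pt \<Rightarrow> real"
  assumes anti: "\<And>i x. i < k \<Longrightarrow> f (negs i x) = - f x" and k: "k \<le> 4" and x: "f x \<notin> \<int>"
  shows "\<exists>y\<in>chamber k. f y \<notin> \<int>"
proof -
  have "\<exists>y\<in>chamber j. f y \<notin> \<int>" if "j \<le> k" for j
    using that
  proof (induction j)
    case 0 then show ?case using x by (auto simp: chamber_def)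
  next
    case (Suc j)
    then obtain y where y: "y \<in> chamber j" "f y \<notin> \<int>" by auto
    have nz: "coord j y \<noteq> 0" using antisym_wall[OF anti k, of j y] y Suc.prems by auto
    show ?case
    proof (cases "0 < coord j y")
      case True then show ?thesis using y by (auto simp: chamber_Suc)
    next
      case False
      have "negs j y \<in> chamber (Suc j)"
        using y(1) False nz Suc.prems k coord_negs[of _ j y] by (auto simp: chamber_def less_Suc_eq)
      moreover have "f (negs j y) \<notin> \<int>"
        using anti[of j y] y(2) Suc.prems by (simp add: minus_in_Ints_iff)
      ultimately show ?thesis by blast
    qed
  qed
  then show ?thesis by blast
qed

lemma phi_round: "phi (t - of_int n) = phi t"
proof -
  have "cos (2 * pi * t - 2 * pi * of_int n) = cos (2 * pi * t)"
    using cos_diff[of "2 * pi * t" "2 * pi * of_int n"] cos_int_2pin[of n] sin_int_2pin[of n]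
    by simp
  then show ?thesis by (simp add: phi_def right_diff_distrib)
qed

text \<open>The threshold 0.076 lies above \<open>low 0\<close> and below \<open>phi (1/16)\<close>,
  so a near-minimiser is everywhere within 1/16 of an integer.\<close>

lemma phi_small_imp:
  assumes "phi t < 0.076" shows "\<bar>t - of_int (round t)\<bar> \<le> 1/16"
proof (rule ccontr)
  let ?d = "t - of_int (round t)"
  assume "\<not> ?thesis"
  then have d: "1/16 \<le> \<bar>?d\<bar>" by simp
  have "\<bar>?d\<bar> \<le> 1/2" using of_int_round_abs_le[of t] by (simp add: abs_minus_commute)
  then have "phi (1/16) \<le> phi \<bar>?d\<bar>" using d by (intro phi_mono) auto
  also have "phi \<bar>?d\<bar> = phi t" using phi_minus[of ?d] phi_round[of t "round t"] by (simp add: abs_if)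
  finally have "phi (1/16) \<le> phi t" .
  moreover have "2 * 9.8696044 * (1/16)\<^sup>2 - 2/3 * 97.409094 * (1/16)^4 \<le> 2 * pi\<^sup>2 * (1/16)\<^sup>2 - 2/3 * pi^4 * (1/16)^4"
    using pi2_bounds pi4_bounds by (intro diff_mono mult_right_mono mult_left_mono) auto
  then have "0.076 \<le> 2 * pi\<^sup>2 * (1/16)\<^sup>2 - 2/3 * pi^4 * (1/16)^4"
    by (simp add: power2_eq_square power_divide)
  ultimately show False using phi_lower[of "1/16"] assms by linarith
qed

lemma lap_Ints: "(\<And>x. f x \<in> \<int>) \<Longrightarrow> lap f x \<in> \<int>"
  unfolding lap_def nbr_def by (intro Ints_diff Ints_mult Ints_sum) auto

text \<open>Subtract the nearest integer inside the open chamber and put zero outside. This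
  preserves \<open>phi\<close>, never increases the modulus, and keeps the Laplacian integral; the
  cut is harmless because \<open>f\<close> and its rounding vanish on the walls.\<close>

lemma functional_lower:
  assumes k: "k \<le> 4" and f: "admissible k f" and nz: "f z \<notin> \<int>"
  shows "low k \<le> (\<Sum>\<^sub>\<infinity>x\<in>chamber k. phi (f x))"
proof (rule ccontr)
  assume "\<not> ?thesis"
  then have small: "(\<Sum>\<^sub>\<infinity>x\<in>chamber k. phi (f x)) < low k" by simp
  have sf: "sqs f" and anti: "\<And>i x. i < k \<Longrightarrow> f (negs i x) = - f x" and int: "\<And>x. lap f x \<in> \<int>"
    using f by (auto simp: admissible_def)
  have low: "low k \<le> 0.075314" using k by (simp add: low_def)
  have sm: "(\<lambda>x. phi (f x)) summable_on chamber k"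
    using phi_sum(1)[OF has_sum_ip[OF sf refl], of "{}"] by (auto intro: summable_on_subset)
  have near: "\<bar>f x - of_int (round (f x))\<bar> \<le> 1/16" if "x \<in> chamber k" for x
  proof (rule phi_small_imp)
    have "phi (f x) \<le> (\<Sum>\<^sub>\<infinity>x\<in>chamber k. phi (f x))"
      using finite_sum_le_infsum[OF sm, of "{x}"] that phi_nonneg by simp
    then show "phi (f x) < 0.076" using small low by simp
  qed
  define g where "g x = (if x \<in> chamber k then f x - of_int (round (f x)) else 0)" for x
  have g1: "\<bar>g x\<bar> \<le> 1/16" for x using near by (simp add: g_def)
  have gf: "\<bar>g x\<bar> \<le> \<bar>f x\<bar>" for x
    using round_diff_minimal[of "f x" 0] by (simp add: g_def)
  have sg: "sqs g"
    unfolding sqs_def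
  proof (rule summable_on_comparison_test[OF sf[unfolded sqs_def]])
    show "(g x)\<^sup>2 \<le> (f x)\<^sup>2" for x using gf[of x] by (simp add: abs_le_square_iff)
  qed simp
  have supp: "supp_in (chamber k) g" by (simp add: supp_in_def g_def)
  have lapg: "lap g x \<in> \<int>" if x: "x \<in> chamber k" for x
  proof -
    have "lap g x = lap (\<lambda>x. f x - of_int (round (f x))) x"
      unfolding g_def by (rule cut_lap[OF _ x]) (use antisym_wall[OF anti k] in auto)
    also have "\<dots> = lap f x - lap (\<lambda>x. of_int (round (f x))) x" by (rule lap_diff)
    also have "\<dots> \<in> \<int>" by (intro Ints_diff int lap_Ints) simp
    finally show ?thesis .
  qed
  obtain y where y: "y \<in> chamber k" "f y \<notin> \<int>" using fold_into_chamber[OF anti k nz] by blast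
  then have gy: "g y \<noteq> 0" by (metis Ints_of_int eq_iff_diff_eq_0 g_def)
  have eq: "(\<Sum>\<^sub>\<infinity>x\<in>chamber k. phi (g x)) = (\<Sum>\<^sub>\<infinity>x\<in>chamber k. phi (f x))"
    by (rule infsum_cong) (simp add: g_def phi_round)
  show False
  proof (cases "k = 0")
    case True
    have U: "chamber 0 = UNIV" by (simp add: chamber_def)
    show False using functional_lower_bulk[OF sg g1 _ gy] lapg eq small True by (simp add: U)
  next
    case False
    then show False using functional_lower_boundary[OF _ k sg supp g1 lapg gy] eq small by simp
  qed
qed

section \<open>Admissible functions attaining the upper bounds\<close>

lemma even_pt_negs: "even_pt (negs i x) = even_pt x"
  by (cases x) (auto simp: even_pt_def negs_def neg1_def neg2_def neg3_def neg4_def)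

lemma ws_odd: "(\<And>x. \<not> even_pt x \<Longrightarrow> f x = 0) \<Longrightarrow> \<not> even_pt x \<Longrightarrow> ws k f x = 0"
  by (induction k arbitrary: x) (simp_all add: even_pt_negs)

lemma ws_Ints: "(\<And>x. f x \<in> \<int>) \<Longrightarrow> ws k f x \<in> \<int>"
  by (induction k arbitrary: x) (auto intro: Ints_diff)

lemma sqs_negs: "sqs f \<Longrightarrow> sqs (\<lambda>x. f (negs i x))"
  unfolding sqs_def
  using summable_on_reindex_bij_betw[of "negs i" UNIV UNIV "\<lambda>x. (f x)\<^sup>2"]
    bij_betw_byWitness[of UNIV "negs i" "negs i" UNIV] by (simp add: negs.inv)

lemma ws_sqs: "sqs f \<Longrightarrow> sqs (ws k f)"
  by (induction k) (simp_all add: sqs_diff sqs_negs)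

text \<open>An antisymmetric function is recovered from its restriction to the chamber. The
  induction removes the positivity constraint on one coordinate at a time: the two half-spaces are
  joined by the sign change, and on the wall between them \<open>f\<close> is zero.\<close>

lemma ws_cut:
  fixes f :: "pt \<Rightarrow> real"
  assumes anti: "\<And>i x. i < k \<Longrightarrow> f (negs i x) = - f x" and k: "k \<le> 4"
  shows "ws k (\<lambda>x. if x \<in> chamber k then f x else 0) x = f x"
proof -
  let ?c = "\<lambda>x. if x \<in> chamber k then f x else 0"
  have "ws j ?c x = (if \<forall>i. j \<le> i \<and> i < k \<longrightarrow> 0 < coord i x then f x else 0)" if "j \<le> k" for j x
    using that
  proof (induction j arbitrary: x)
    case 0 show ?case by (simp add: chamber_def)
  next
    case (Suc j)
    have c: "coord i (negs j x) = (if i = j then - coord j x else coord i x)" if "i < k" for i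
      using coord_negs[of i j x] that Suc.prems k by auto
    have le: "j \<le> i \<longleftrightarrow> i = j \<or> Suc j \<le> i" for i by linarith
    let ?P = "\<forall>i. Suc j \<le> i \<and> i < k \<longrightarrow> 0 < coord i x"
    have a: "(\<forall>i. j \<le> i \<and> i < k \<longrightarrow> 0 < coord i x) \<longleftrightarrow> ?P \<and> 0 < coord j x"
      unfolding le using Suc.prems by auto
    have b: "(\<forall>i. j \<le> i \<and> i < k \<longrightarrow> 0 < coord i (negs j x)) \<longleftrightarrow> ?P \<and> coord j x < 0"
      unfolding le using Suc.prems c by auto
    have w: "coord j x = 0 \<Longrightarrow> f x = 0" using antisym_wall[OF anti k, of j x] Suc.prems by simp
    have IH: "ws j ?c z = (if \<forall>i. j \<le> i \<and> i < k \<longrightarrow> 0 < coord i z then f z else 0)" for z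
      by (rule Suc.IH) (use Suc.prems in simp)
    have "ws (Suc j) ?c x = ws j ?c x - ws j ?c (negs j x)" by simp
    also have "\<dots> = (if ?P then f x else 0)"
      unfolding IH a b using w anti[of j x] Suc.prems by (cases "coord j x" "0 :: int" rule: linorder_cases) auto
    finally show ?case .
  qed
  from this[of k x] show ?thesis by auto
qed

lemma pole_even: "even_pt (pole k)"
  by (simp add: pole_def even_pt_def)

lemma even_pt_diff: "even_pt y \<Longrightarrow> even_pt (x - y) = even_pt x"
proof -
  obtain a b c d a' b' c' d' where x: "x = (a, b, c, d)" and y: "y = (a', b', c', d')"
    by (cases x; cases y) blast
  have "(a - a') + (b - b') + (c - c') + (d - d') = (a + b + c + d) - (a' + b' + c' + d')" by simp
  then have "even ((a - a') + (b - b') + (c - c') + (d - d')) \<longleftrightarrow>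
    (even (a + b + c + d) \<longleftrightarrow> even (a' + b' + c' + d'))" by (simp only: even_diff even_add)
  then show "even_pt y \<Longrightarrow> even_pt (x - y) = even_pt x"
    unfolding x y even_pt_def diff_Pair prod.case by blast
qed

lemma between_notin_Ints: "0 < t \<Longrightarrow> t < 1 \<Longrightarrow> (t :: real) \<notin> \<int>"
  by (auto elim!: Ints_cases)

text \<open>Without reflections the dipole of adjacent poles is used, otherwise \<open>xi\<close>.
  Square summability of \<open>xi\<close> is inherited from its restriction \<open>green\<close>
  through \<open>ws_cut\<close>, as single translates of \<open>G\<close> are not square
  summable.\<close>

lemma functional_attained:
  assumes k: "k \<le> 4"
  shows "\<exists>f. admissible k f \<and> f (if k = 0 then 0 else pole k) \<notin> \<int> \<and>
      (\<Sum>\<^sub>\<infinity>x\<in>chamber k. phi (f x)) \<le> high k"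
proof (cases "k = 0")
  case True
  let ?u = "(1,1,0,0) :: pt"
  let ?f = "\<lambda>x. G x - G (x - ?u)"
  have u: "?u \<in> roots" by (simp add: roots_def)
  have "lap ?f x = pt_mass 0 x - pt_mass ?u x" for x
    by (simp only: lap_diff lap_G lap_G_shift)
  then have lap: "lap ?f x \<in> \<int>" for x by (auto simp: pt_mass_def)
  have "even_pt ?u" by (simp add: even_pt_def)
  then have odd: "?f x = 0" if "\<not> even_pt x" for x using that by (simp add: G_odd even_pt_diff)
  have "?f 0 = 1/24" using G_root'[OF u] G_minus[of ?u] by simp
  then have "?f 0 \<notin> \<int>" by (simp only:) (rule between_notin_Ints; simp)
  then show ?thesis
    using dipole_values[OF u] lap odd True
    by (intro exI[of _ ?f]) (auto simp: admissible_def chamber_def)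
next
  case False
  then have k1: "1 \<le> k" by simp
  let ?f = "xi k (pole k)"
  note y = pole_chamber[OF k]
  have anti: "?f (negs i x) = - ?f x" if "i < k" for i x
    unfolding xi_def by (rule ws_antisym[OF that])
  have "ws k (green k (pole k)) = ?f"
    unfolding green_def[abs_def] by (rule ext, rule ws_cut[OF anti k])
  then have "sqs ?f" using ws_sqs[OF green_values(1)[OF k1 k], of k] by simp
  moreover have "?f x = 0" if "\<not> even_pt x" for x
    unfolding xi_def by (rule ws_odd) (use that in \<open>auto simp: G_odd even_pt_diff pole_even\<close>)
  moreover have "lap ?f x \<in> \<int>" for x
    unfolding lap_xi by (rule ws_Ints) (simp add: pt_mass_def)
  moreover have "?f (pole k) \<notin> \<int>"
    using green_pole[OF k y] green_values(2)[OF k1 k] y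
    by (intro between_notin_Ints) (auto simp: green_def)
  moreover have "(\<Sum>\<^sub>\<infinity>x\<in>chamber k. phi (?f x)) =
      (\<Sum>\<^sub>\<infinity>x\<in>chamber k. phi (green k (pole k) x))"
    by (rule infsum_cong) (simp add: green_def)
  ultimately show ?thesis using anti green_values(4)[OF k1 k] False
    by (intro exI[of _ ?f]) (auto simp: admissible_def)
qed

section \<open>The lattice graph\<close>

definition crd :: "nat \<Rightarrow> real^4 \<Rightarrow> real" where
  "crd j x = x \<bullet> normal_vec j"

lemma nat_1_4: "{1..4::nat} = {1, 2, 3, 4}"
  by auto

lemma normal_vec_nth:
  "normal_vec 1 $ 1 = 1" "normal_vec 1 $ 2 = 1" "normal_vec 1 $ 3 = 0" "normal_vec 1 $ 4 = 0"
  "normal_vec 2 $ 1 = 1" "normal_vec 2 $ 2 = - 1" "normal_vec 2 $ 3 = 0" "normal_vec 2 $ 4 = 0"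
  "normal_vec 3 $ 1 = 0" "normal_vec 3 $ 2 = 0" "normal_vec 3 $ 3 = 1" "normal_vec 3 $ 4 = 1"
  "normal_vec 4 $ 1 = 0" "normal_vec 4 $ 2 = 0" "normal_vec 4 $ 3 = 1" "normal_vec 4 $ 4 = - 1"
  by (simp_all add: normal_vec_def vector_def)

lemma crd_nth:
  "crd 1 x = x $ 1 + x $ 2" "crd 2 x = x $ 1 - x $ 2" "crd 3 x = x $ 3 + x $ 4" "crd 4 x = x $ 3 - x $ 4"
  by (simp_all only: crd_def inner_vec_def sum_4 normal_vec_nth) simp_all

lemma normal_vec_inner:
  assumes "i \<in> {1..4}" "j \<in> {1..4}"
  shows "normal_vec i \<bullet> normal_vec j = (if i = j then 2 else 0)"
  using assms unfolding nat_1_4 insert_iff empty_iff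
  by (elim disjE; simp only: inner_vec_def sum_4 normal_vec_nth) simp_all

lemma crd_expand: "(\<Sum>j\<in>{1..4}. (crd j x / 2) *\<^sub>R normal_vec j) = x"
  unfolding nat_1_4 vec_eq_iff forall_4
  by (simp add: crd_nth normal_vec_nth del: One_nat_def) (simp add: field_simps)

text \<open>The half-sum condition is the parity that defines even points. The half-integer vertices
  are those for which the first two pairings have odd sum.\<close>

lemma vertices_crd:
  "x \<in> D4_vertices \<longleftrightarrow> (\<forall>j\<in>{1..4}. crd j x \<in> \<int>) \<and>
      (\<Sum>j\<in>{1..4}. crd j x) / 2 \<in> \<int>"
  (is "?L \<longleftrightarrow> ?R")
proof
  assume ?L
  then consider n1 n2 n3 n4 where "x $ 1 = of_int n1" "x $ 2 = of_int n2" "x $ 3 = of_int n3" "x $ 4 = of_int n4"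
    | n1 n2 n3 n4 where "x $ 1 = of_int n1 + 1/2" "x $ 2 = of_int n2 + 1/2" "x $ 3 = of_int n3 + 1/2" "x $ 4 = of_int n4 + 1/2"
    unfolding D4_vertices_def mem_Collect_eq forall_4
    by (elim disjE conjE Ints_cases) (force simp: algebra_simps)+
  then show ?R
  proof cases
    case 1
    have "(\<Sum>j\<in>{1..4}. crd j x) / 2 = of_int (n1 + n3)"
      unfolding nat_1_4 by (simp add: crd_nth 1 del: One_nat_def)
    moreover have "crd 1 x = of_int (n1 + n2)" "crd 2 x = of_int (n1 - n2)"
      "crd 3 x = of_int (n3 + n4)" "crd 4 x = of_int (n3 - n4)" by (simp_all add: crd_nth 1 del: One_nat_def)
    ultimately show ?thesis unfolding nat_1_4 by (metis Ints_of_int empty_iff insertE)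
  next
    case 2
    have "(\<Sum>j\<in>{1..4}. crd j x) / 2 = of_int (n1 + n3 + 1)"
      unfolding nat_1_4 by (simp add: crd_nth 2 del: One_nat_def)
    moreover have "crd 1 x = of_int (n1 + n2 + 1)" "crd 2 x = of_int (n1 - n2)"
      "crd 3 x = of_int (n3 + n4 + 1)" "crd 4 x = of_int (n3 - n4)" by (simp_all add: crd_nth 2 del: One_nat_def)
    ultimately show ?thesis unfolding nat_1_4 by (metis Ints_of_int empty_iff insertE)
  qed
next
  assume R: ?R
  then obtain c1 c2 c3 c4 where c: "crd 1 x = of_int c1" "crd 2 x = of_int c2" "crd 3 x = of_int c3" "crd 4 x = of_int c4"
    unfolding nat_1_4 by (simp del: One_nat_def) (elim conjE Ints_cases, blast)
  from R obtain n where "(\<Sum>j\<in>{1..4}. crd j x) / 2 = of_int n" by (elim conjE Ints_cases) blast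
  then have "real_of_int (c1 + c2 + c3 + c4) = real_of_int (2 * n)"
    unfolding nat_1_4 by (simp add: c del: One_nat_def)
  then have s: "c1 + c2 + c3 + c4 = 2 * n" by (simp only: of_int_eq_iff)
  have x: "x $ 1 = (of_int c1 + of_int c2) / 2" "x $ 2 = (of_int c1 - of_int c2) / 2"
    "x $ 3 = (of_int c3 + of_int c4) / 2" "x $ 4 = (of_int c3 - of_int c4) / 2"
    using c by (simp_all add: crd_nth del: One_nat_def)
  show ?L
  proof (cases "even (c1 + c2)")
    case True
    then obtain m where m: "c1 + c2 = 2 * m" by blast
    have m': "c1 = 2 * m - c2" "c3 = 2 * n - 2 * m - c4" using m s by linarith+
    have "x $ 1 = of_int m" "x $ 2 = of_int (m - c2)" "x $ 3 = of_int (n - m)" "x $ 4 = of_int (n - m - c4)"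
      unfolding x m' by (simp_all add: field_simps)
    then have "\<forall>i. x $ i \<in> \<int>" unfolding forall_4 by (metis Ints_of_int)
    then show ?thesis by (simp add: D4_vertices_def)
  next
    case False
    then obtain m where m: "c1 + c2 = 2 * m + 1" using oddE by blast
    have m': "c1 = 2 * m + 1 - c2" "c3 = 2 * n - 2 * m - 1 - c4" using m s by linarith+
    have "x $ 1 - 1/2 = of_int m" "x $ 2 - 1/2 = of_int (m - c2)" "x $ 3 - 1/2 = of_int (n - m - 1)"
      "x $ 4 - 1/2 = of_int (n - m - 1 - c4)"
      unfolding x m' by (simp_all add: field_simps)
    then have "\<forall>i. x $ i - 1/2 \<in> \<int>" unfolding forall_4 by (metis Ints_of_int)
    then show ?thesis by (simp add: D4_vertices_def)
  qed
qed

lemma exists_4: "(\<exists>i::4. P i) \<longleftrightarrow> P 1 \<or> P 2 \<or> P 3 \<or> P 4"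
  using forall_4[of "\<lambda>i. \<not> P i"] by blast

lemma U4_nth:
  "x \<in> U4 \<longleftrightarrow>
    (x $ 1, x $ 2, x $ 3, x $ 4) \<in> {(1,0,0,0), (-1,0,0,0), (0,1,0,0), (0,-1,0,0), (0,0,1,0), (0,0,-1,0), (0,0,0,1), (0,0,0,-1)}
    \<or> (x $ 1 = 1/2 \<or> x $ 1 = - 1/2) \<and> (x $ 2 = 1/2 \<or> x $ 2 = - 1/2) \<and>
      (x $ 3 = 1/2 \<or> x $ 3 = - 1/2) \<and> (x $ 4 = 1/2 \<or> x $ 4 = - 1/2)"
  unfolding U4_def Un_iff UN_iff bex_UNIV exists_4 mem_Collect_eq forall_4 insert_iff empty_iff vec_eq_iff
  by (simp add: axis_def)

text \<open>The four pairings multiply squared lengths by two, so the unit vectors of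
  \<open>U4\<close> become vectors of norm two; conversely each of the 24 roots is traced back by
  enumeration.\<close>

lemma U4_crd:
  "x \<in> U4 \<longleftrightarrow> (\<forall>j\<in>{1..4}. crd j x \<in> \<int>) \<and> (\<Sum>j\<in>{1..4}.
      (crd j x)\<^sup>2) = 2" (is "?L \<longleftrightarrow> ?R")
proof
  assume ?L
  then have "x $ 1 + x $ 2 \<in> \<int> \<and> x $ 1 - x $ 2 \<in> \<int> \<and> x $ 3 + x $ 4 \<in> \<int>
      \<and> x $ 3 - x $ 4 \<in> \<int> \<and>
    (x $ 1 + x $ 2)\<^sup>2 + (x $ 1 - x $ 2)\<^sup>2 + (x $ 3 + x $ 4)\<^sup>2 + (x $ 3 - x $ 4)\<^sup>2 = 2"
    unfolding U4_nth insert_iff empty_iff prod.inject simp_thms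
    by (elim disjE conjE; simp only:) simp_all
  then show ?R unfolding nat_1_4 by (simp add: crd_nth del: One_nat_def)
next
  assume R: ?R
  then obtain c1 c2 c3 c4 where c: "crd 1 x = of_int c1" "crd 2 x = of_int c2" "crd 3 x = of_int c3" "crd 4 x = of_int c4"
    unfolding nat_1_4 by (simp del: One_nat_def) (elim conjE Ints_cases, blast)
  have "real_of_int (c1\<^sup>2 + c2\<^sup>2 + c3\<^sup>2 + c4\<^sup>2) = real_of_int 2"
    using R unfolding nat_1_4 by (simp add: c del: One_nat_def)
  then have "c1\<^sup>2 + c2\<^sup>2 + c3\<^sup>2 + c4\<^sup>2 = 2" by (simp only: of_int_eq_iff)
  then have mem: "(c1, c2, c3, c4) \<in> set root_list" by (simp add: roots_eq[symmetric] roots_def)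
  have x: "x $ 1 = (of_int c1 + of_int c2) / 2" "x $ 2 = (of_int c1 - of_int c2) / 2"
    "x $ 3 = (of_int c3 + of_int c4) / 2" "x $ 4 = (of_int c3 - of_int c4) / 2"
    using c by (simp_all add: crd_nth del: One_nat_def)
  show ?L
    using mem unfolding U4_nth x root_list_def list.set insert_iff empty_iff prod.inject
    by (elim disjE conjE) simp_all
qed

lemma pt_eq_coord: "x = y \<longleftrightarrow> (\<forall>i<4. coord i x = coord i y)"
  by (cases x; cases y) (auto simp: coord_def numeral_eq_Suc less_Suc_eq)

lemma sum_coord: "(\<Sum>i<4. f (coord i (a, b, c, d))) = f a + f b + f c + (f d :: 'a::comm_monoid_add)"
  by (simp add: coord_def numeral_eq_Suc ac_simps)

text \<open>\<open>\<sigma>\<close> lists the normal vectors with those indexed by \<open>S\<close>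
  first. They are orthogonal and of equal length, so any \<open>k\<close> of the reflections become
  the sign changes of the first \<open>k\<close> coordinates, and all sets of the same size lead to
  the same problem.\<close>

locale frame =
  fixes \<sigma> :: "nat \<Rightarrow> nat" and S :: "nat set" and k :: nat
  assumes sigma: "bij_betw \<sigma> {..<4} {1..4}" and S: "S = \<sigma> ` {..<k}" and k: "k \<le> 4"
begin

lemma sigma_in: "i < 4 \<Longrightarrow> \<sigma> i \<in> {1..4}"
  using sigma by (auto simp: bij_betw_def)

lemma sigma_inner: "i < 4 \<Longrightarrow> j < 4 \<Longrightarrow> normal_vec (\<sigma> i) \<bullet>
    normal_vec (\<sigma> j) = (if i = j then 2 else 0)"
  using sigma by (auto simp: normal_vec_inner[OF sigma_in sigma_in] bij_betw_def inj_on_def)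

lemma sigma_sum: "(\<Sum>j\<in>{1..4}. F j) = (\<Sum>i<4. F (\<sigma> i))"
  using sum.reindex_bij_betw[OF sigma, of F] by simp

lemma sigma_all: "(\<forall>j\<in>{1..4}. P j) \<longleftrightarrow> (\<forall>i<4. P (\<sigma> i))"
  using sigma unfolding bij_betw_def by (metis (no_types, opaque_lifting) imageE imageI lessThan_iff)

definition emb :: "pt \<Rightarrow> real^4" where
  "emb m = (\<Sum>i<4. (real_of_int (coord i m) / 2) *\<^sub>R normal_vec (\<sigma> i))"

definition pr :: "real^4 \<Rightarrow> pt" where
  "pr x = (\<lfloor>crd (\<sigma> 0) x\<rfloor>, \<lfloor>crd (\<sigma> 1) x\<rfloor>, \<lfloor>crd (\<sigma>
      2) x\<rfloor>, \<lfloor>crd (\<sigma> 3) x\<rfloor>)"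

lemma crd_emb: "i < 4 \<Longrightarrow> crd (\<sigma> i) (emb m) = coord i m"
proof -
  assume i: "i < 4"
  have "crd (\<sigma> i) (emb m) = (\<Sum>j<4. real_of_int (coord j m) / 2 * (if j = i then 2 else 0))"
    unfolding crd_def emb_def inner_sum_left using i by (intro sum.cong) (simp_all add: sigma_inner)
  also have "\<dots> = (\<Sum>j<4. if j = i then real_of_int (coord j m) else 0)"
    by (intro sum.cong) auto
  finally show ?thesis using i by simp
qed

lemma coord_pr: "i < 4 \<Longrightarrow> coord i (pr x) = \<lfloor>crd (\<sigma> i) x\<rfloor>"
  by (auto simp: coord_def pr_def numeral_eq_Suc less_Suc_eq)

lemma pr_emb: "pr (emb m) = m"
  unfolding pt_eq_coord by (simp add: coord_pr crd_emb)

lemma emb_pr: assumes "\<And>i. i < 4 \<Longrightarrow> crd (\<sigma> i) x \<in> \<int>" shows "emb (pr x) = x"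
proof -
  have "emb (pr x) = (\<Sum>i<4. (crd (\<sigma> i) x / 2) *\<^sub>R normal_vec (\<sigma> i))"
    unfolding emb_def using assms by (intro sum.cong) (auto simp: coord_pr)
  also have "\<dots> = x" using crd_expand[of x] unfolding sigma_sum .
  finally show ?thesis .
qed

lemma emb_add: "emb (x + y) = emb x + emb y"
  by (simp add: emb_def coord_add add_divide_distrib scaleR_add_left sum.distrib)

lemma emb_diff: "emb (x - y) = emb x - emb y"
  by (simp add: emb_def coord_diff diff_divide_distrib scaleR_diff_left sum_subtractf)

lemma emb_vertex: "emb m \<in> D4_vertices \<longleftrightarrow> even_pt m"
proof -
  obtain a b c d where m: "m = (a, b, c, d)" by (cases m)
  have s: "(\<Sum>i<4. crd (\<sigma> i) (emb m)) = real_of_int (a + b + c + d)"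
    using sum_coord[of real_of_int a b c d] by (simp add: crd_emb m)
  have "emb m \<in> D4_vertices \<longleftrightarrow> real_of_int (a + b + c + d) / 2 \<in> \<int>"
    unfolding vertices_crd sigma_all sigma_sum s by (simp add: crd_emb)
  also have "\<dots> \<longleftrightarrow> even (a + b + c + d)"
  proof
    assume "real_of_int (a + b + c + d) / 2 \<in> \<int>"
    then obtain n where "real_of_int (a + b + c + d) / 2 = of_int n" by (rule Ints_cases)
    then have "real_of_int (a + b + c + d) = real_of_int (2 * n)" by simp
    then have "a + b + c + d = 2 * n" by (simp only: of_int_eq_iff)
    then show "even (a + b + c + d)" by simp
  next
    assume "even (a + b + c + d)"
    then obtain n where "a + b + c + d = 2 * n" by blast
    then have "real_of_int (a + b + c + d) / 2 = of_int n" by simp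
    then show "real_of_int (a + b + c + d) / 2 \<in> \<int>" by simp
  qed
  finally show ?thesis by (simp add: m even_pt_def)
qed

lemma vertexE:
  assumes "x \<in> D4_vertices" obtains m where "x = emb m" "even_pt m"
proof -
  have "emb (pr x) = x" using assms sigma_in by (intro emb_pr) (simp add: vertices_crd del: One_nat_def)
  then show ?thesis using that[of "pr x"] emb_vertex[of "pr x"] assms by simp
qed

lemma emb_inj: "emb x = emb y \<longleftrightarrow> x = y"
  using pr_emb by metis

lemma emb_bij: "bij_betw emb {m. even_pt m} D4_vertices"
  unfolding bij_betw_def
proof
  show "inj_on emb {m. even_pt m}" by (simp add: inj_on_def emb_inj)
  show "emb ` {m. even_pt m} = D4_vertices"
    using vertexE emb_vertex by blast
qed

lemma emb_U4: "emb u \<in> U4 \<longleftrightarrow> u \<in> roots"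
proof -
  obtain a b c d where u: "u = (a, b, c, d)" by (cases u)
  have "(\<Sum>i<4. (crd (\<sigma> i) (emb u))\<^sup>2) = real_of_int (a\<^sup>2 + b\<^sup>2 + c\<^sup>2 + d\<^sup>2)"
    using sum_coord[of "\<lambda>t. (real_of_int t)\<^sup>2" a b c d] by (simp add: crd_emb u)
  then have "emb u \<in> U4 \<longleftrightarrow> real_of_int (a\<^sup>2 + b\<^sup>2 + c\<^sup>2 + d\<^sup>2) = real_of_int 2"
    unfolding U4_crd sigma_all sigma_sum by (simp add: crd_emb)
  then show ?thesis by (simp only: of_int_eq_iff) (simp add: u roots_def)
qed

lemma neighbours:
  assumes "even_pt m"
  shows "{w. D4_adj (emb m) w} = (\<lambda>u. emb (m + u)) ` roots"
proof
  show "{w. D4_adj (emb m) w} \<subseteq> (\<lambda>u. emb (m + u)) ` roots"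
  proof
    fix w assume "w \<in> {w. D4_adj (emb m) w}"
    then have w: "w \<in> D4_vertices" "w - emb m \<in> U4" by (auto simp: D4_adj_def)
    obtain n where n: "w = emb n" using vertexE[OF w(1)] by blast
    then have "n - m \<in> roots" using w(2) emb_U4[of "n - m"] by (simp add: emb_diff)
    then show "w \<in> (\<lambda>u. emb (m + u)) ` roots" using n by (intro image_eqI[of _ _ "n - m"]) auto
  qed
  show "(\<lambda>u. emb (m + u)) ` roots \<subseteq> {w. D4_adj (emb m) w}"
    using assms by (auto simp: D4_adj_def emb_vertex even_pt_add) (simp add: emb_add emb_U4)
qed

lemma laplacian_emb:
  assumes "even_pt m"
  shows "D4_laplacian \<xi> (emb m) = lap (\<lambda>x. if even_pt x then \<xi> (emb x) else 0) m"
proof -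
  have inj: "inj_on (\<lambda>u. emb (m + u)) roots" by (simp add: inj_on_def emb_inj)
  have "(\<Sum>w\<in>{w. D4_adj (emb m) w}. \<xi> w) = (\<Sum>u\<in>roots. \<xi> (emb (m + u)))"
    unfolding neighbours[OF assms] by (simp add: sum.reindex[OF inj])
  also have "\<dots> = nbr (\<lambda>x. if even_pt x then \<xi> (emb x) else 0) m"
    unfolding nbr_def using assms by (intro sum.cong) (auto simp: even_pt_add)
  finally show ?thesis
    using assms by (simp add: D4_laplacian_def lap_def neighbours card_image[OF inj] card_roots)
qed

lemma reflection_emb: "i < 4 \<Longrightarrow> reflection (\<sigma> i) (emb m) = emb (negs i m)"
proof -
  assume i: "i < 4"
  have "emb m - emb (negs i m) = (\<Sum>j<4. (if j = i then real_of_int (coord i m) else 0) *\<^sub>R normal_vec (\<sigma> j))"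
    unfolding emb_def sum_subtractf[symmetric] scaleR_diff_left[symmetric]
    using i by (intro sum.cong) (auto simp: coord_negs)
  also have "\<dots> = (\<Sum>j<4. if j = i then real_of_int (coord i m) *\<^sub>R normal_vec (\<sigma> j) else 0)"
    by (intro sum.cong) auto
  also have "\<dots> = real_of_int (coord i m) *\<^sub>R normal_vec (\<sigma> i)" using i by simp
  finally show ?thesis
    unfolding reflection_def using i crd_emb[OF i, of m] by (simp add: sigma_inner crd_def algebra_simps)
qed

lemma S_all: "(\<forall>j\<in>S. P j) \<longleftrightarrow> (\<forall>i<k. P (\<sigma> i))"
  by (auto simp: S)

text \<open>Extension by zero to the odd points creates no new condition: neighbours of odd points
  are odd, so the Laplacian vanishes there.\<close>

definition pull :: "(real^4 \<Rightarrow> real) \<Rightarrow> pt \<Rightarrow> real" where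
  "pull \<xi> x = (if even_pt x then \<xi> (emb x) else 0)"

lemma lap_pull: "even_pt m \<Longrightarrow> lap (pull \<xi>) m = D4_laplacian \<xi> (emb m)"
  by (simp add: laplacian_emb pull_def[abs_def])

lemma lap_pull_odd: "\<not> even_pt m \<Longrightarrow> lap (pull \<xi>) m = 0"
  by (simp add: lap_def nbr_def pull_def even_pt_add)

lemma sqs_pull: "sqs (pull \<xi>) \<longleftrightarrow> \<xi> \<in> D4_l2"
proof -
  have "sqs (pull \<xi>) \<longleftrightarrow> (\<lambda>m. (\<xi> (emb m))\<^sup>2) summable_on {m. even_pt m}"
    unfolding sqs_def by (rule summable_on_cong_neutral) (auto simp: pull_def)
  also have "\<dots> \<longleftrightarrow> \<xi> \<in> D4_l2"
    unfolding D4_l2_def mem_Collect_eq by (rule summable_on_reindex_bij_betw[OF emb_bij])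
  finally show ?thesis .
qed

lemma admissible_pull: "admissible k (pull \<xi>) \<longleftrightarrow> \<xi> \<in> H2 S"
proof -
  have ball: "(\<forall>x\<in>D4_vertices. Q x) \<longleftrightarrow> (\<forall>m. even_pt m \<longrightarrow> Q (emb m))" for Q
    using vertexE emb_vertex by metis
  have "(\<forall>x. lap (pull \<xi>) x \<in> \<int>) \<longleftrightarrow> harmonic_mod1 \<xi>"
    unfolding harmonic_mod1_def ball by (metis lap_pull lap_pull_odd Ints_0)
  moreover have "(\<forall>i<k. \<forall>x. pull \<xi> (negs i x) = - pull \<xi> x) \<longleftrightarrow>
      (\<forall>j\<in>S. \<forall>x\<in>D4_vertices. \<xi> (reflection j x) = - \<xi> x)"
    unfolding S_all ball using k by (auto simp: pull_def reflection_emb even_pt_negs)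
  ultimately show ?thesis
    by (simp add: admissible_def H2_def sqs_pull) (auto simp: pull_def)
qed

lemma zero_mod1_pull: "zero_mod1 \<xi> \<longleftrightarrow> (\<forall>x. pull \<xi> x \<in> \<int>)"
  unfolding zero_mod1_def pull_def using vertexE emb_vertex by (metis Ints_0)

lemma pull_surj:
  assumes "\<And>x. \<not> even_pt x \<Longrightarrow> f x = 0" shows "pull (\<lambda>x. f (pr x)) = f"
  using assms by (auto simp: pull_def pr_emb fun_eq_iff)

end

section \<open>Orbits of the reflection group and the functional on the closed chamber\<close>

context frame
begin

definition orb :: "pt \<Rightarrow> (real^4) set" where
  "orb m = (\<lambda>g. g (emb m)) ` reflection_group S"

lemma group_right: "g \<in> reflection_group S \<Longrightarrow> j \<in> S \<Longrightarrow> g \<circ>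
    reflection j \<in> reflection_group S"
proof (induction rule: reflection_group.induct)
  case one
  then show ?case using reflection_group.mult[OF one reflection_group.one] by simp
next
  case (mult i g)
  then have "reflection i \<circ> (g \<circ> reflection j) \<in> reflection_group S" by (intro reflection_group.mult)
  then show ?case by (simp only: comp_assoc)
qed

lemma orb_negs: assumes i: "i < k" shows "orb (negs i m) = orb m"
proof -
  have i4: "i < 4" and iS: "\<sigma> i \<in> S" using i k by (auto simp: S)
  have sub: "orb (negs i m) \<subseteq> orb m" for m
  proof
    fix x assume "x \<in> orb (negs i m)"
    then obtain g where g: "g \<in> reflection_group S" "x = g (emb (negs i m))" by (auto simp: orb_def)
    then have "x = (g \<circ> reflection (\<sigma> i)) (emb m)" by (simp add: reflection_emb[OF i4])
    then show "x \<in> orb m" unfolding orb_def using group_right[OF g(1) iS] by (rule image_eqI)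
  qed
  have "orb m \<subseteq> orb (negs i m)" using sub[of "negs i m"] by (simp add: negs.inv)
  then show ?thesis using sub by blast
qed

lemma orb_self: "emb m \<in> orb m"
  unfolding orb_def by (rule image_eqI[OF _ reflection_group.one]) simp

text \<open>Group elements act as sign changes. The induction carries exactly what is needed later:
  absolute values of the coordinates separate orbits in the closed chamber, and invariance of the
  modulus of antisymmetric functions makes the summand constant on orbits.\<close>

lemma orb_elem:
  assumes "g \<in> reflection_group S"
  shows "\<exists>m'. g (emb m) = emb m' \<and> even_pt m' = even_pt m \<and>
    (\<forall>i<4. \<bar>coord i m'\<bar> = \<bar>coord i m\<bar> \<and> (k \<le> i \<longrightarrow> coord i m' = coord i m)) \<and>
    (\<forall>f :: pt \<Rightarrow> real. (\<forall>i<k. \<forall>x. f (negs i x) = - f x) \<longrightarrow>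
        \<bar>f m'\<bar> = \<bar>f m\<bar>)"
  using assms
proof (induction rule: reflection_group.induct)
  case one then show ?case by (intro exI[of _ m]) simp
next
  case (mult j g)
  then obtain m' where m': "g (emb m) = emb m'" "even_pt m' = even_pt m"
    "\<forall>i<4. \<bar>coord i m'\<bar> = \<bar>coord i m\<bar> \<and> (k \<le> i \<longrightarrow> coord i m' = coord i m)"
    "\<forall>f :: pt \<Rightarrow> real. (\<forall>i<k. \<forall>x. f (negs i x) = - f x) \<longrightarrow>
        \<bar>f m'\<bar> = \<bar>f m\<bar>" by blast
  obtain i where i: "i < k" "j = \<sigma> i" using mult.hyps(1) by (auto simp: S)
  then have i4: "i < 4" using k by simp
  show ?case
  proof (intro exI[of _ "negs i m'"] conjI allI impI)
    show "(reflection j \<circ> g) (emb m) = emb (negs i m')"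
      using reflection_emb[OF i4] m'(1) i by simp
    show "even_pt (negs i m') = even_pt m" using m'(2) by (simp add: even_pt_negs)
    show "\<bar>coord l (negs i m')\<bar> = \<bar>coord l m\<bar>" if "l < 4" for l
      using m'(3) that coord_negs[OF that i4] by simp
    show "coord l (negs i m') = coord l m" if "l < 4" "k \<le> l" for l
      using m'(3) that coord_negs[OF that(1) i4] i by simp
    show "\<bar>f (negs i m')\<bar> = \<bar>f m\<bar>" if "\<forall>i<k. \<forall>x. f (negs i x) = - f x" for f :: "pt \<Rightarrow> real"
      using m'(4) that i by simp
  qed
qed

definition closed_chamber :: "pt set" where
  "closed_chamber = {m. even_pt m \<and> (\<forall>i<k. 0 \<le> coord i m)}"

lemma orb_bij: "bij_betw orb closed_chamber (D4_orbits S)"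
  unfolding bij_betw_def
proof
  show "inj_on orb closed_chamber"
  proof (rule inj_onI)
    fix m n assume m: "m \<in> closed_chamber" and n: "n \<in> closed_chamber" and eq: "orb m = orb n"
    have "emb m \<in> orb n" using orb_self[of m] eq by simp
    then obtain g where g: "g \<in> reflection_group S" "emb m = g (emb n)" by (auto simp: orb_def)
    then have c: "\<forall>i<4. \<bar>coord i m\<bar> = \<bar>coord i n\<bar> \<and> (k \<le> i \<longrightarrow> coord i m = coord i n)"
      using orb_elem[OF g(1), of n] by (metis emb_inj)
    show "m = n" unfolding pt_eq_coord
    proof (intro allI impI)
      fix i :: nat assume i: "i < 4"
      show "coord i m = coord i n"
        using c[rule_format, OF i] m n by (cases "i < k") (auto simp: closed_chamber_def)
    qed
  qed
  have fold: "\<exists>n. even_pt n \<and> (\<forall>i<j. 0 \<le> coord i n) \<and> orb n = orb m" if "even_pt m" "j \<le> k" for m j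
    using that(2)
  proof (induction j)
    case 0 then show ?case using that by auto
  next
    case (Suc j)
    then obtain n where n: "even_pt n" "\<forall>i<j. 0 \<le> coord i n" "orb n = orb m" by auto
    show ?case
    proof (cases "0 \<le> coord j n")
      case True then show ?thesis using n by (auto simp: less_Suc_eq)
    next
      case False
      then have "\<forall>i<Suc j. 0 \<le> coord i (negs j n)"
        using n(2) Suc.prems k coord_negs[of _ j n] by (auto simp: less_Suc_eq)
      then show ?thesis using n orb_negs[of j n] Suc.prems even_pt_negs by (intro exI[of _ "negs j n"]) simp
    qed
  qed
  have "D4_orbits S = orb ` {m. even_pt m}"
  proof -
    have eq: "D4_vertices = emb ` {m. even_pt m}" using emb_bij by (simp add: bij_betw_def)
    show ?thesis unfolding D4_orbits_def orb_def[abs_def] eq image_image ..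
  qed
  also have "\<dots> = orb ` closed_chamber"
  proof
    show "orb ` {m. even_pt m} \<subseteq> orb ` closed_chamber"
    proof
      fix x assume "x \<in> orb ` {m. even_pt m}"
      then obtain m where m: "even_pt m" "x = orb m" by auto
      obtain n where "even_pt n" "\<forall>i<k. 0 \<le> coord i n" "orb n = orb m" using fold[OF m(1) order_refl] by blast
      then show "x \<in> orb ` closed_chamber"
        unfolding m(2) by (intro image_eqI[of _ _ n]) (auto simp: closed_chamber_def)
    qed
    show "orb ` closed_chamber \<subseteq> orb ` {m. even_pt m}" by (auto simp: closed_chamber_def)
  qed
  finally show "orb ` closed_chamber = D4_orbits S" by simp
qed

text \<open>Orbits correspond to points of the closed chamber. Those on a wall contribute nothing,
  since an antisymmetric function vanishes there, and neither do odd points, so the sum over the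
  open chamber agrees.\<close>

lemma orbit_functional_pull:
  assumes xi: "\<xi> \<in> H2 S"
  shows "orbit_functional S \<xi> = (\<Sum>\<^sub>\<infinity>x\<in>chamber k. phi (pull \<xi> x))"
proof -
  let ?F = "\<lambda>x. 1 - cos (2 * pi * \<xi> x)"
  have anti: "\<forall>i<k. \<forall>x. pull \<xi> (negs i x) = - pull \<xi> x"
    using xi unfolding admissible_pull[symmetric] by (simp add: admissible_def)
  have val: "the_elem (?F ` orb m) = phi (pull \<xi> m)" if m: "even_pt m" for m
  proof -
    have "?F x = phi (pull \<xi> m)" if "x \<in> orb m" for x
    proof -
      obtain g where g: "g \<in> reflection_group S" "x = g (emb m)" using \<open>x \<in> orb m\<close> by (auto simp: orb_def)
      obtain m' where m': "x = emb m'" "even_pt m'" "\<bar>pull \<xi> m'\<bar> = \<bar>pull \<xi> m\<bar>"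
        using orb_elem[OF g(1), of m] g(2) m anti by metis
      have "phi (pull \<xi> m') = phi (pull \<xi> m)" using m'(3) phi_minus by (metis abs_eq_iff)
      then show ?thesis using m' by (simp add: pull_def phi_def)
    qed
    then have "?F ` orb m = {phi (pull \<xi> m)}" using orb_self[of m] by (auto simp: image_iff)
    then show ?thesis by simp
  qed
  have "orbit_functional S \<xi> = (\<Sum>\<^sub>\<infinity>m\<in>closed_chamber. the_elem (?F ` orb m))"
    unfolding orbit_functional_def by (rule infsum_reindex_bij_betw[OF orb_bij, symmetric])
  also have "\<dots> = (\<Sum>\<^sub>\<infinity>m\<in>closed_chamber. phi (pull \<xi> m))"
    by (rule infsum_cong) (simp add: val closed_chamber_def)
  also have "\<dots> = (\<Sum>\<^sub>\<infinity>x\<in>chamber k. phi (pull \<xi> x))"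
  proof (rule infsum_cong_neutral)
    fix x assume "x \<in> chamber k - closed_chamber"
    then have "\<not> even_pt x" by (force simp: chamber_def closed_chamber_def)
    then show "phi (pull \<xi> x) = 0" by (simp add: pull_def phi_def)
  next
    fix x assume "x \<in> closed_chamber - chamber k"
    then obtain i where "i < k" "coord i x = 0"
      unfolding chamber_def closed_chamber_def by (auto simp: order.order_iff_strict)
    then have "pull \<xi> x = 0" using antisym_wall[of k "pull \<xi>" i x] anti k by blast
    then show "phi (pull \<xi> x) = 0" by (simp add: phi_def)
  qed simp
  finally show ?thesis .
qed

lemma orbit_functional_lower:
  assumes "\<xi> \<in> H2 S" "\<not> zero_mod1 \<xi>" shows "low k \<le> orbit_functional S \<xi>"
proof -
  obtain z where "pull \<xi> z \<notin> \<int>" using assms(2) by (auto simp: zero_mod1_pull)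
  then show ?thesis
    using functional_lower[OF k, of "pull \<xi>" z] assms(1) by (simp add: admissible_pull orbit_functional_pull)
qed

lemma orbit_functional_attained:
  "\<exists>\<xi>\<in>H2 S. \<not> zero_mod1 \<xi> \<and> orbit_functional S \<xi> \<le> high k"
proof -
  obtain f where f: "admissible k f" "\<exists>x. f x \<notin> \<int>" "(\<Sum>\<^sub>\<infinity>x\<in>chamber k. phi (f x)) \<le> high k"
    using functional_attained[OF k] by blast
  have eq: "pull (\<lambda>x. f (pr x)) = f" by (rule pull_surj) (use f(1) admissible_def in blast)
  have mem: "(\<lambda>x. f (pr x)) \<in> H2 S" using admissible_pull[of "\<lambda>x. f (pr x)"] f(1) by (simp add: eq)
  show ?thesis
    using mem f(2,3) zero_mod1_pull[of "\<lambda>x. f (pr x)"] orbit_functional_pull[OF mem]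
    by (intro bexI[of _ "\<lambda>x. f (pr x)"]) (simp_all add: eq)
qed

end

lemma frame_exists:
  assumes S: "S \<subseteq> {1..4}" "card S = k" and k: "k \<le> 4"
  shows "\<exists>\<sigma>. frame \<sigma> S k"
proof -
  have fin: "finite S" using S(1) finite_subset by blast
  define a where "a = sorted_list_of_set S"
  define js where "js = a @ sorted_list_of_set ({1..4} - S)"
  have len: "length a = k" using S(2) fin by (simp add: a_def)
  have dist: "distinct js" and set: "set js = {1..4}" using S(1) fin by (auto simp: js_def a_def)
  then have "length js = 4" using distinct_card[OF dist] by simp
  then have "bij_betw ((!) js) {..<4} {1..4}" using dist set by (intro bij_betw_nth) auto
  moreover have "S = (!) js ` {..<k}"
    using nth_image[of k js] len fin by (simp add: js_def a_def atLeast0LessThan)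
  ultimately show ?thesis using k by (intro exI[of _ "(!) js"]) (simp add: frame_def)
qed

text \<open>Both bounds hold for each \<open>S\<close> of the given size and so pass to the two
  nested infima. The attaining function also shows that the inner sets are nonempty, and the lower
  bound that they are bounded below.\<close>

lemma spectral_parameter_bounds:
  assumes k: "k \<le> 4"
  shows "low k \<le> spectral_parameter k" "spectral_parameter k \<le> high k"
proof -
  let ?A = "{S. S \<subseteq> {1..4::nat} \<and> card S = k}"
  let ?B = "\<lambda>S. {\<xi> \<in> H2 S. \<not> zero_mod1 \<xi>}"
  let ?I = "\<lambda>S. INF \<xi>\<in>?B S. orbit_functional S \<xi>"
  have low: "low k \<le> orbit_functional S \<xi>" if "S \<in> ?A" "\<xi> \<in> ?B S" for S \<xi>
    using that frame_exists[OF _ _ k, of S] frame.orbit_functional_lower[of _ S k \<xi>] by blast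
  have att: "\<exists>\<xi>\<in>?B S. orbit_functional S \<xi> \<le> high k" if "S \<in> ?A" for S
    using that frame_exists[OF _ _ k, of S] frame.orbit_functional_attained[of _ S k] by blast
  have ne: "?A \<noteq> {}"
  proof -
    have "{1..k} \<in> ?A" using k by auto
    then show ?thesis by blast
  qed
  have I_low: "low k \<le> ?I S" if "S \<in> ?A" for S
    using att[OF that] low[OF that] by (intro cINF_greatest) auto
  have I_high: "?I S \<le> high k" if S: "S \<in> ?A" for S
  proof -
    obtain \<xi> where xi: "\<xi> \<in> ?B S" "orbit_functional S \<xi> \<le> high k" using att[OF S] by blast
    have "bdd_below (orbit_functional S ` ?B S)" using low[OF S] by (intro bdd_belowI2)
    then have "?I S \<le> orbit_functional S \<xi>" using xi(1) by (rule cINF_lower)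
    then show ?thesis using xi(2) by linarith
  qed
  show "low k \<le> spectral_parameter k"
    unfolding spectral_parameter_def by (rule cINF_greatest[OF ne I_low])
  obtain S where S: "S \<in> ?A" using ne by blast
  have "bdd_below (?I ` ?A)" using I_low by (intro bdd_belowI2)
  then have "spectral_parameter k \<le> ?I S" unfolding spectral_parameter_def using S by (rule cINF_lower)
  then show "spectral_parameter k \<le> high k" using I_high[OF S] by linarith
qed

lemma quotient_bounds:
  fixes c g :: real
  assumes "0 < a" "a \<le> g" "g \<le> b" "0 < c" shows "c / b \<le> c / g" "c / g \<le> c / a"
  using assms by (auto intro!: divide_left_mono mult_pos_pos)

theorem theorem2:
  shows "\<bar>spectral_parameter 0 - 0.075554\<bar> \<le> 0.00024 \<and>
     \<bar>spectral_parameter 1 - 0.0440957\<bar> \<le> 0.00017 \<and>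
     \<bar>spectral_parameter 2 - 0.0389569\<bar> \<le> 0.00013 \<and>
     \<bar>spectral_parameter 3 - 0.036873324\<bar> \<le> 0.00012 \<and>
     \<bar>spectral_parameter 4 - 0.0357604\<bar> \<le> 0.00011 \<and>
     \<bar>spectral_factor 0 - 52.9428\<bar> \<le> 0.17 \<and>
     \<bar>spectral_factor 1 - 68.03486\<bar> \<le> 0.27 \<and>
     \<bar>spectral_factor 2 - 51.3393\<bar> \<le> 0.17 \<and>
     \<bar>spectral_factor 3 - 27.1201\<bar> \<le> 0.084 \<and>
     max_spectral_factor = spectral_factor 1 \<and>
     max_spectral_factor \<noteq> spectral_factor 0"
proof -
  have p0: "0.075314 \<le> spectral_parameter 0" "spectral_parameter 0 \<le> 0.075794"
    and p1: "0.0439257 \<le> spectral_parameter 1" "spectral_parameter 1 \<le> 0.0442657"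
    and p2: "0.03882796 \<le> spectral_parameter 2" "spectral_parameter 2 \<le> 0.0390859"
    and p3: "0.0367592 \<le> spectral_parameter 3" "spectral_parameter 3 \<le> 0.036987"
    and p4: "0.0356504 \<le> spectral_parameter 4" "spectral_parameter 4 \<le> 0.0358704"
    using spectral_parameter_bounds[of 0] spectral_parameter_bounds[of 1] spectral_parameter_bounds[of 2]
      spectral_parameter_bounds[of 3] spectral_parameter_bounds[of 4] by (simp_all add: low_def high_def)
  have f0: "4 / 0.075794 \<le> spectral_factor 0" "spectral_factor 0 \<le> 4 / 0.075314"
    using quotient_bounds[OF _ p0, of 4] by (simp_all add: spectral_factor_def)
  have f1: "3 / 0.0442657 \<le> spectral_factor 1" "spectral_factor 1 \<le> 3 / 0.0439257"
    using quotient_bounds[OF _ p1, of 3] by (simp_all add: spectral_factor_def)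
  have f2: "2 / 0.0390859 \<le> spectral_factor 2" "spectral_factor 2 \<le> 2 / 0.03882796"
    using quotient_bounds[OF _ p2, of 2] by (simp_all add: spectral_factor_def)
  have f3: "1 / 0.036987 \<le> spectral_factor 3" "spectral_factor 3 \<le> 1 / 0.0367592"
    using quotient_bounds[OF _ p3, of 1] by (simp_all add: spectral_factor_def)
  have set: "{0..3::nat} = {0, 1, 2, 3}" by auto
  \<comment> \<open>The intervals are well separated: the one for index 1 starts above 67.7, all
    others end below 53.2.\<close>
  have max: "max_spectral_factor = spectral_factor 1"
    unfolding max_spectral_factor_def
  proof (rule Max_eqI)
    show "y \<le> spectral_factor 1" if "y \<in> spectral_factor ` {0..3}" for y
      using that f0 f1 f2 f3 unfolding set by auto
  qed auto
  have ne: "spectral_factor 1 \<noteq> spectral_factor 0" using f0 f1 by auto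
  show ?thesis
    unfolding max abs_diff_le_iff using p0 p1 p2 p3 p4 f0 f1 f2 f3 ne by (intro conjI) simp_all
qed

end
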